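(* Let $H$ be a self-adjoint radial Dirac operator $$H=\frac{1}{\mathrm{i}}\sigma_2\frac{d}{dx}+\frac{\kappa}{x}\sigma_1+Q(x)\quad\text{on }(0,b),\qquad Q\in L^1_{\rm loc}[0,b),$$ with $\kappa>\frac12$, $\kappa+\frac12\notin\mathbb{N}$, and let $b$ be regular. Then there is a system of real entire solutions $\Phi(z,x)$, $\Theta(z,x)$ of the corresponding equation with $W(\Theta(z),\Phi(z))=1$, where $\Phi$ is the solution normalized by $$\Phi(z,x)=x^\kappa\begin{pmatrix}0\\ \frac{\sqrt\pi}{2^\kappa\Gamma(\kappa+1/2)}\end{pmatrix}+o(x^\kappa)\quad\text{as }x\to0,$$ such that the associated singular Weyl function satisfies $M(z)\in N_{\kappa_0}^\infty$ with $\kappa_0=\lfloor\kappa+\frac12\rfloor$.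
   Context: Here $\sigma_1=\begin{pmatrix}0&1\\1&0\end{pmatrix}$, $\sigma_2=\begin{pmatrix}0&-\mathrm{i}\\ \mathrm{i}&0\end{pmatrix}$, $\sigma_3=\begin{pmatrix}1&0\\0&-1\end{pmatrix}$, and $Q=q_{\rm el}\mathbb{1}+q_{\rm am}\sigma_1+(m+q_{\rm sc})\sigma_3$ with $m\ge0$ and real-valued $q$'s; $Q\in L^1_{\rm loc}[0,b)$ means the entries are integrable on $(0,c)$ for every $c\in(0,b)$. That $b$ is regular means $b<\infty$ and $Q$ is integrable near $b$. The Wronskian is $W_x(f,g)=f_1(x)g_2(x)-f_2(x)g_1(x)$, with $W_b$ its limit as $x\to b$; for solutions of $\tau u=zu$ with the same $z$ it is constant and written $W(f,g)$. Write $\tau=\frac1{\mathrm i}\sigma_2\frac d{dx}+\frac\kappa x\sigma_1+Q$. $H$ is the self-adjoint realization of $\tau$ in $L^2((0,b),\mathbb{C}^2)$ with a boundary condition $W_b(u_+,f)=0$ at $b$ for a fixed non-trivial real solution $u_+$ of $\tau u=0$ (for $\kappa>\frac12$ no boundary condition is needed at $0$). A real entire solution is a solution of $\tau u=zu$ that is entire in $z$ for each $x$ and real for real $z$. The normalized solution $\Phi$ exists, is unique, and is square integrable near $0$. Given a real entire solution $\Theta$ with $W(\Theta(z),\Phi(z))=1$, the singular Weyl function is $M(z)=-\frac{W(\Theta(z),u_+(z))}{W(\Phi(z),u_+(z))}$, where $u_+(z)$ is the non-trivial solution of $\tau u=zu$ satisfying the boundary condition of $H$ at $b$. $N_k$ ($k\in\mathbb{N}\cup\{0\}$)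 is the class of generalized Nevanlinna functions: functions $M$ meromorphic on $\mathbb{C}\setminus\mathbb{R}$ with $M(z^* )=M(z)^*$ for which the kernel $\frac{M(z)-M(\zeta)^*}{z-\zeta^*}$ has exactly $k$ negative squares. $N_k^\infty$ is the class of functions in $N_k$ which have no non-real poles and whose only generalized pole of nonpositive type is at $\infty$; equivalently, functions $M\in N_k$ that can be written as $M(z)=\prod_{j=1}^k(z-\alpha_j)(z-\alpha_j^* )\,M_0(z)$ with $\alpha_j\in\mathbb{C}$ and $M_0\in N_0$ a Herglotz--Nevanlinna function. *)

theory Defs
  imports "HOL-Complex_Analysis.Complex_Analysis" "HOL-Library.Landau_Symbols"
    "Jordan_Normal_Form.Char_Poly"
begin

no_notation Matrix.vec_index (infixl \<open>$\<close> 100)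

definition sigma1 :: "complex^2^2" where
  "sigma1 = vector [vector [0, 1], vector [1, 0]]"

definition sigma2 :: "complex^2^2" where
  "sigma2 = vector [vector [0, -\<i>], vector [\<i>, 0]]"

definition sigma3 :: "complex^2^2" where
  "sigma3 = vector [vector [1, 0], vector [0, -1]]"

definition dirac_potential ::
    "real \<Rightarrow> (real \<Rightarrow> real) \<Rightarrow> (real \<Rightarrow> real) \<Rightarrow> (real \<Rightarrow> real) \<Rightarrow> real \<Rightarrow> complex^2^2" where
  "dirac_potential m q_el q_am q_sc x =
     q_el x *\<^sub>R Finite_Cartesian_Product.mat 1 + q_am x *\<^sub>R sigma1 + (m + q_sc x) *\<^sub>R sigma3"

definition L1_loc_at_0 :: "real \<Rightarrow> (real \<Rightarrow> complex^2^2) \<Rightarrow> bool" where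
  "L1_loc_at_0 b Q \<longleftrightarrow>
     (\<forall>c\<in>{0<..<b}. \<forall>i j. (\<lambda>x. Q x $ i $ j) absolutely_integrable_on {0<..<c})"

(* Finiteness of b is built into its type real. *)
definition regular_endpoint :: "real \<Rightarrow> (real \<Rightarrow> complex^2^2) \<Rightarrow> bool" where
  "regular_endpoint b Q \<longleftrightarrow>
     (\<exists>c\<in>{0<..<b}. \<forall>i j. (\<lambda>x. Q x $ i $ j) absolutely_integrable_on {c<..<b})"

(* Local absolute continuity of u on (0,b), in the form "u is an indefinite Lebesgue integral of
   u'"; the function u' is then the almost everywhere derivative of u. *)
definition has_ac_derivative :: "real \<Rightarrow> (real \<Rightarrow> complex^2) \<Rightarrow> (real \<Rightarrow> complex^2) \<Rightarrow> bool" where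
  "has_ac_derivative b u u' \<longleftrightarrow>
     (\<forall>x y. 0 < x \<and> x \<le> y \<and> y < b \<longrightarrow>
        u' absolutely_integrable_on {x..y} \<and> (u' has_integral (u y - u x)) {x..y})"

(* The value of tau u at x, where u' is the derivative of u. *)
definition dirac_expr ::
    "real \<Rightarrow> (real \<Rightarrow> complex^2^2) \<Rightarrow> (real \<Rightarrow> complex^2) \<Rightarrow> (real \<Rightarrow> complex^2) \<Rightarrow> real \<Rightarrow> complex^2" where
  "dirac_expr \<kappa> Q u u' x =
     (1 / \<i>) *s (sigma2 *v u' x) + (\<kappa> / x) *\<^sub>R (sigma1 *v u x) + Q x *v u x"

definition dirac_solution ::
    "real \<Rightarrow> (real \<Rightarrow> complex^2^2) \<Rightarrow> real \<Rightarrow> complex \<Rightarrow> (real \<Rightarrow> complex^2) \<Rightarrow> bool" where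
  "dirac_solution \<kappa> Q b z u \<longleftrightarrow>
     (\<exists>u'. has_ac_derivative b u u' \<and>
           (AE x in lebesgue. x \<in> {0<..<b} \<longrightarrow> dirac_expr \<kappa> Q u u' x = z *s u x))"

definition nontrivial_on :: "real \<Rightarrow> (real \<Rightarrow> complex^2) \<Rightarrow> bool" where
  "nontrivial_on b u \<longleftrightarrow> (\<exists>x\<in>{0<..<b}. u x \<noteq> 0)"

definition real_valued_on :: "real \<Rightarrow> (real \<Rightarrow> complex^2) \<Rightarrow> bool" where
  "real_valued_on b u \<longleftrightarrow> (\<forall>x\<in>{0<..<b}. \<forall>i. u x $ i \<in> \<real>)"

definition wronskian :: "real \<Rightarrow> (real \<Rightarrow> complex^2) \<Rightarrow> (real \<Rightarrow> complex^2) \<Rightarrow> complex" where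
  "wronskian x f g = f x $ 1 * g x $ 2 - f x $ 2 * g x $ 1"

(* For two solutions with the same spectral parameter: the constant value of the Wronskian. *)
definition const_wronskian :: "real \<Rightarrow> (real \<Rightarrow> complex^2) \<Rightarrow> (real \<Rightarrow> complex^2) \<Rightarrow> complex" where
  "const_wronskian b f g = (THE w. \<forall>x\<in>{0<..<b}. wronskian x f g = w)"

definition boundary_condition :: "real \<Rightarrow> (real \<Rightarrow> complex^2) \<Rightarrow> (real \<Rightarrow> complex^2) \<Rightarrow> bool" where
  "boundary_condition b u_plus f \<longleftrightarrow> ((\<lambda>x. wronskian x u_plus f) \<longlongrightarrow> 0) (at_left b)"

(* Elements of the Hilbert space are represented by functions; all sets of (pairs of) functions
   below are closed under changes on null sets and outside (0,b). *)
definition L2_space :: "real \<Rightarrow> (real \<Rightarrow> complex^2) set" where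
  "L2_space b = {f. f \<in> borel_measurable (lebesgue_on {0<..<b}) \<and>
                    (\<lambda>x. (norm (f x))\<^sup>2) absolutely_integrable_on {0<..<b}}"

definition L2_inner :: "real \<Rightarrow> (real \<Rightarrow> complex^2) \<Rightarrow> (real \<Rightarrow> complex^2) \<Rightarrow> complex" where
  "L2_inner b f g = (LINT x:{0<..<b}|lebesgue. (\<Sum>i\<in>UNIV. cnj (f x $ i) * g x $ i))"

(* The graph of the realization of tau in L^2((0,b),C^2) with the boundary condition given by
   u_plus at b and none at 0. In (f, g), f is represented by the locally absolutely continuous h. *)
definition radial_dirac_operator ::
    "real \<Rightarrow> (real \<Rightarrow> complex^2^2) \<Rightarrow> real \<Rightarrow> (real \<Rightarrow> complex^2)
     \<Rightarrow> ((real \<Rightarrow> complex^2) \<times> (real \<Rightarrow> complex^2)) set" where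
  "radial_dirac_operator \<kappa> Q b u_plus =
     {(f, g). f \<in> L2_space b \<and> g \<in> L2_space b \<and>
        (\<exists>h h'. (AE x in lebesgue. x \<in> {0<..<b} \<longrightarrow> f x = h x) \<and>
                has_ac_derivative b h h' \<and>
                (AE x in lebesgue. x \<in> {0<..<b} \<longrightarrow> g x = dirac_expr \<kappa> Q h h' x) \<and>
                boundary_condition b u_plus h)}"

definition adjoint_graph ::
    "real \<Rightarrow> ((real \<Rightarrow> complex^2) \<times> (real \<Rightarrow> complex^2)) set
     \<Rightarrow> ((real \<Rightarrow> complex^2) \<times> (real \<Rightarrow> complex^2)) set" where
  "adjoint_graph b T =
     {(g, h). g \<in> L2_space b \<and> h \<in> L2_space b \<and>
        (\<forall>(f, k)\<in>T. L2_inner b g k = L2_inner b h f)}"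

(* For graphs of operators this includes density of the domain: otherwise adjoint_graph b T would
   not be single-valued (modulo null sets). *)
definition self_adjoint_graph :: "real \<Rightarrow> ((real \<Rightarrow> complex^2) \<times> (real \<Rightarrow> complex^2)) set \<Rightarrow> bool" where
  "self_adjoint_graph b T \<longleftrightarrow> adjoint_graph b T = T"

definition real_entire_solution ::
    "real \<Rightarrow> (real \<Rightarrow> complex^2^2) \<Rightarrow> real \<Rightarrow> (complex \<Rightarrow> real \<Rightarrow> complex^2) \<Rightarrow> bool" where
  "real_entire_solution \<kappa> Q b u \<longleftrightarrow>
     (\<forall>z. dirac_solution \<kappa> Q b z (u z)) \<and>
     (\<forall>x\<in>{0<..<b}. \<forall>i. (\<lambda>z. u z x $ i) holomorphic_on UNIV) \<and>
     (\<forall>z\<in>\<real>. real_valued_on b (u z))"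

definition normalized_at_0 :: "real \<Rightarrow> (complex \<Rightarrow> real \<Rightarrow> complex^2) \<Rightarrow> bool" where
  "normalized_at_0 \<kappa> \<Phi> \<longleftrightarrow>
     (\<forall>z. (\<lambda>x. norm (\<Phi> z x - x powr \<kappa> *\<^sub>R
               vector [0, complex_of_real (sqrt pi / (2 powr \<kappa> * Gamma (\<kappa> + 1/2)))]))
          \<in> o[at_right 0](\<lambda>x. x powr \<kappa>))"

(* Determined up to a nonzero constant multiple, on which the Weyl function does not depend. *)
definition weyl_solution ::
    "real \<Rightarrow> (real \<Rightarrow> complex^2^2) \<Rightarrow> real \<Rightarrow> (real \<Rightarrow> complex^2) \<Rightarrow> complex \<Rightarrow> real \<Rightarrow> complex^2" where
  "weyl_solution \<kappa> Q b u_plus z =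
     (SOME u. dirac_solution \<kappa> Q b z u \<and> nontrivial_on b u \<and> boundary_condition b u_plus u)"

definition singular_weyl_function ::
    "real \<Rightarrow> (real \<Rightarrow> complex^2^2) \<Rightarrow> real \<Rightarrow> (real \<Rightarrow> complex^2)
     \<Rightarrow> (complex \<Rightarrow> real \<Rightarrow> complex^2) \<Rightarrow> (complex \<Rightarrow> real \<Rightarrow> complex^2) \<Rightarrow> complex \<Rightarrow> complex" where
  "singular_weyl_function \<kappa> Q b u_plus \<Phi> \<Theta> z =
     - const_wronskian b (\<Theta> z) (weyl_solution \<kappa> Q b u_plus z) /
       const_wronskian b (\<Phi> z) (weyl_solution \<kappa> Q b u_plus z)"

definition nevanlinna_kernel :: "(complex \<Rightarrow> complex) \<Rightarrow> complex \<Rightarrow> complex \<Rightarrow> complex" where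
  "nevanlinna_kernel M z \<zeta> = (M z - cnj (M \<zeta>)) / (z - cnj \<zeta>)"

(* The number of negative eigenvalues, counted with multiplicity. *)
definition num_neg_eigenvalues :: "complex Matrix.mat \<Rightarrow> nat" where
  "num_neg_eigenvalues A =
     (\<Sum>l | l < 0 \<and> eigenvalue A (complex_of_real l). order (complex_of_real l) (char_poly A))"

(* The kernel is defined off the antidiagonal z = cnj zeta only, so the admissible families of
   points satisfy w i \<noteq> cnj (w j); repetitions are harmless. *)
definition has_neg_squares ::
    "(complex \<Rightarrow> complex \<Rightarrow> complex) \<Rightarrow> complex set \<Rightarrow> nat \<Rightarrow> bool" where
  "has_neg_squares K D k \<longleftrightarrow>
     (let admissible = (\<lambda>n (w :: nat \<Rightarrow> complex).
            (\<forall>i<n. w i \<in> D) \<and> (\<forall>i<n. \<forall>j<n. w i \<noteq> cnj (w j)));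
          negs = (\<lambda>n w. num_neg_eigenvalues (Matrix.mat n n (\<lambda>(i, j). K (w i) (w j))))
      in (\<forall>n w. admissible n w \<longrightarrow> negs n w \<le> k) \<and> (\<exists>n w. admissible n w \<and> negs n w = k))"

(* The values on the real line are irrelevant. A meromorphic function is represented as a total
   function that is 0 at its poles and has no removable singularities. *)
definition gen_nevanlinna :: "nat \<Rightarrow> (complex \<Rightarrow> complex) set" where
  "gen_nevanlinna k =
     {M. M nicely_meromorphic_on (- \<real>) \<and>
         (\<forall>z\<in>- \<real>. M (cnj z) = cnj (M z)) \<and>
         has_neg_squares (nevanlinna_kernel M) {z. z \<notin> \<real> \<and> \<not> is_pole M z} k}"

(* The functions in gen_nevanlinna k without nonreal poles whose only generalized pole of
   nonpositive type is at infinity, described by their factorization. *)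
definition gen_nevanlinna_inf :: "nat \<Rightarrow> (complex \<Rightarrow> complex) set" where
  "gen_nevanlinna_inf k =
     {M \<in> gen_nevanlinna k.
        \<exists>\<alpha> :: nat \<Rightarrow> complex. \<exists>M0 \<in> gen_nevanlinna 0.
          \<forall>z\<in>- \<real>. M z = (\<Prod>j = 1..k. (z - \<alpha> j) * (z - cnj (\<alpha> j))) * M0 z}"

end

theory Submission
  imports Defs "Jordan_Normal_Form.Schur_Decomposition"
begin

text \<open>
  The singular Weyl function is determined by the operator only up to the choice of \<Theta>, and the
  proof uses this freedom to prescribe \<open>M\<close>. Let \<open>U\<close> and \<open>V\<close> be the real entire solutions whose
  values at the regular endpoint \<open>b\<close> do not depend on \<open>z\<close>: those of \<open>U\<close> are the values of \<open>u_plus\<close>, and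
  those of \<open>V\<close> make the Wronskian of \<open>U\<close> and \<open>V\<close> equal to 1. Then \<open>\<Phi> = A U + B V\<close> with entire functions
  \<open>A\<close>, \<open>B\<close> that are real on the real axis, and \<open>U(z)\<close> spans the solutions that satisfy the boundary
  condition at \<open>b\<close>. For \<open>\<Theta> = P U + R V\<close> the Wronskian of \<Theta> and \<Phi> is \<open>P B - R A\<close>, and
  \<open>M = - R / B\<close>. What is wanted are real entire \<open>P\<close>, \<open>R\<close> with \<open>P B - R A = 1\<close> for which \<open>- R / B\<close>
  is a generalized Nevanlinna function of the right index.

  Green's identity \<open>A(z) B(\<zeta>) - B(z) A(\<zeta>) = (z - \<zeta>) \<integral> \<Phi>(z) \<cdot> \<Phi>(\<zeta>)\<close> shows that the zeros \<lambda> of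
  \<open>B\<close> are real and simple, with \<open>B'(\<lambda>) A(\<lambda>) = - 1 / \<rho>(\<lambda>)\<close>, where \<open>1 / \<rho>(\<lambda>)\<close> is the squared norm of
  \<open>\<Phi>(\<lambda>)\<close>. Hence \<open>P\<close> exists for a given \<open>R\<close> exactly if \<open>R = - 1 / A\<close> at these zeros, that is, if \<open>- R / B\<close>
  has residue \<open>- \<rho>(\<lambda>)\<close> at \<lambda>. For a real \<open>t\<close> with \<open>B(t) \<noteq> 0\<close> the function
  \<open>M(z) = (z - t)^(2k) * (c (z - t) + \<Sum> \<rho>(\<lambda>) / (\<lambda> - t)^(2k) * (1 / (\<lambda> - z) - 1 / (\<lambda> - t)))\<close>
  has these residues for every real \<open>c\<close> (\<open>entire_interpolation\<close>), provided that the sum of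
  \<open>\<rho>(\<lambda>) / (1 + |\<lambda>|)^(2k + 2)\<close> is finite.

  The angular momentum \<kappa> enters through this sum. The spectral parameter contributes a
  term of relative size \<open>|z| x\<close> to the Volterra equation for \<Phi>, so that the second component of \<Phi> is
  comparable to \<open>x^\<kappa>\<close> as long as \<open>x\<close> and \<open>|z| x\<close> are small.
  Bessel's inequality for the orthogonal functions \<open>\<Phi>(\<lambda>)\<close> and the function \<open>(0, y^\<kappa>)\<close> cut off at
  \<open>x = const / L\<close> bounds the sum of \<open>\<rho>(\<lambda>)\<close> over \<open>|\<lambda>| \<le> L\<close> by \<open>const * L^(2\<kappa> + 1)\<close>
  (\<open>weight_sum_bound\<close>). A dyadic decomposition gives convergence as soon as \<open>k > \<kappa> - 1/2\<close>,
  and the integer part of \<open>\<kappa> + 1/2\<close> satisfies this.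

  The second factor of \<open>M\<close> is a Herglotz function for \<open>c \<ge> 0\<close>. The kernel of a Herglotz function
  multiplied by \<open>(z - t)^(2k)\<close> is nonnegative on all vectors that satisfy \<open>k\<close> linear conditions, so there
  are at most \<open>k\<close> negative squares (\<open>num_neg_kernel_power_mult_le\<close>). For large \<open>c\<close> the polynomial
  \<open>c (z - t)^(2k + 1)\<close> dominates at finitely many points; at suitable \<open>2k + 1\<close> points of a circle
  around \<open>t\<close> its kernel matrix has \<open>k\<close> explicit eigenvectors with a negative eigenvalue, so there are at
  least \<open>k\<close> negative squares (\<open>num_neg_kernel_power_mult_ge\<close>).
\<close>

no_notation fps_nth (infixl "$" 75)
no_notation Matrix.vec_index (infixl "$" 100)

section \<open>Hermitian forms and negative eigenvalues\<close>

text \<open>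
  Elimination of one unknown per equation. Equations and unknowns are indexed by arbitrary finite
  sets because in the applications one of them is the set of indices of negative eigenvalues.
\<close>
lemma homogeneous_system_nontrivial_solution:
  fixes c :: "'e \<Rightarrow> 'j \<Rightarrow> 'a::field"
  assumes "finite E" "finite J" "card E < card J"
  shows "\<exists>y. (\<exists>j\<in>J. y j \<noteq> 0) \<and> (\<forall>m\<in>E. (\<Sum>j\<in>J. c m j * y j) = 0)"
  using assms
proof (induction E arbitrary: c J rule: finite_induct)
  case empty
  then obtain j where "j \<in> J" by fastforce
  then show ?case by (intro exI[of _ "\<lambda>_. 1"]) auto
next
  case (insert m0 E)
  show ?case
  proof (cases "\<forall>j\<in>J. c m0 j = 0")
    case True
    have "card E < card J" using insert by auto
    from insert.IH[OF insert.prems(1) this, of c] obtain y where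
      "\<exists>j\<in>J. y j \<noteq> 0" "\<forall>m\<in>E. (\<Sum>j\<in>J. c m j * y j) = 0" by blast
    then show ?thesis using True by (intro exI[of _ y]) auto
  next
    case False
    then obtain j0 where j0: "j0 \<in> J" "c m0 j0 \<noteq> 0" by blast
    define J' where "J' = J - {j0}"
    have J': "finite J'" "card E < card J'" using insert j0 by (auto simp: J'_def)
    from insert.IH[OF this, of "\<lambda>m j. c m j - c m j0 * c m0 j / c m0 j0"] obtain y where
      y: "\<exists>j\<in>J'. y j \<noteq> 0"
         "\<And>m. m \<in> E \<Longrightarrow> (\<Sum>j\<in>J'. (c m j - c m j0 * c m0 j / c m0 j0) * y j) = 0" by blast
    define S where "S = (\<Sum>j\<in>J'. c m0 j * y j)"
    define y' where "y' = (\<lambda>j. if j = j0 then - S / c m0 j0 else y j)"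
    have split: "(\<Sum>j\<in>J. c m j * y' j) = c m j0 * (- S / c m0 j0) + (\<Sum>j\<in>J'. c m j * y j)" for m
    proof -
      have "(\<Sum>j\<in>J. c m j * y' j) = c m j0 * y' j0 + (\<Sum>j\<in>J'. c m j * y' j)"
        unfolding J'_def using j0 insert.prems by (subst sum.remove[of _ j0]) auto
      also have "(\<Sum>j\<in>J'. c m j * y' j) = (\<Sum>j\<in>J'. c m j * y j)"
        by (intro sum.cong) (auto simp: J'_def y'_def)
      finally show ?thesis by (simp add: y'_def)
    qed
    have "\<exists>j\<in>J. y' j \<noteq> 0" using y(1) by (auto simp: y'_def J'_def)
    moreover have "(\<Sum>j\<in>J. c m j * y' j) = 0" if "m \<in> insert m0 E" for m
    proof (cases "m = m0")
      case True
      then show ?thesis using j0 by (simp add: split S_def)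
    next
      case False
      then have m: "m \<in> E" using that by auto
      have "(\<Sum>j\<in>J'. (c m j - c m j0 * c m0 j / c m0 j0) * y j)
          = (\<Sum>j\<in>J'. c m j * y j) - c m j0 / c m0 j0 * S"
        by (simp add: S_def sum_distrib_left sum_subtractf algebra_simps)
      with y(2)[OF m] have "(\<Sum>j\<in>J'. c m j * y j) = c m j0 / c m0 j0 * S" by simp
      then show ?thesis by (simp add: split)
    qed
    ultimately show ?thesis by blast
  qed
qed

text \<open>
  Vectors and matrices are functions used below a bound \<open>n\<close>, as the number of points at which a
  kernel is tested varies.
\<close>
definition cinner :: "nat \<Rightarrow> (nat \<Rightarrow> complex) \<Rightarrow> (nat \<Rightarrow> complex) \<Rightarrow> complex" where
  "cinner n x y = (\<Sum>i<n. cnj (x i) * y i)"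

lemma cinner_add: "cinner n x (\<lambda>i. y i + z i) = cinner n x y + cinner n x z"
  by (simp add: cinner_def algebra_simps sum.distrib)
lemma cinner_sum: "cinner n x (\<lambda>i. \<Sum>l\<in>L. c l * y l i) = (\<Sum>l\<in>L. c l * cinner n x (y l))"
  unfolding cinner_def sum_distrib_left by (subst sum.swap) (simp add: algebra_simps)
lemma cinner_scale: "cinner n x (\<lambda>i. c * y i) = c * cinner n x y"
  by (simp add: cinner_def sum_distrib_left algebra_simps)
lemma cnj_cinner: "cnj (cinner n x y) = cinner n y x"
  by (simp add: cinner_def mult.commute)
lemma cinner_cong: "(\<And>i. i < n \<Longrightarrow> y i = y' i) \<Longrightarrow> cinner n x y = cinner n x y'"
  by (simp add: cinner_def)
lemma cinner_cong_left: "(\<And>i. i < n \<Longrightarrow> y i = y' i) \<Longrightarrow> cinner n y x = cinner n y' x"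
  by (simp add: cinner_def)
lemma cinner_self: "cinner n x x = of_real (\<Sum>i<n. (cmod (x i))\<^sup>2)"
  unfolding cinner_def of_real_sum by (intro sum.cong refl) (metis complex_norm_square mult.commute)
lemma cinner_self_eq_0: "cinner n x x = 0 \<longleftrightarrow> (\<forall>i<n. x i = 0)"
  unfolding cinner_self of_real_eq_0_iff by (subst sum_nonneg_eq_0_iff) auto

definition mvec :: "nat \<Rightarrow> (nat \<Rightarrow> nat \<Rightarrow> complex) \<Rightarrow> (nat \<Rightarrow> complex) \<Rightarrow> nat \<Rightarrow> complex" where
  "mvec n a x i = (\<Sum>j<n. a i j * x j)"

lemma mvec_sum: "mvec n a (\<lambda>i. \<Sum>l\<in>L. c l * y l i) i = (\<Sum>l\<in>L. c l * mvec n a (y l) i)"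
  unfolding mvec_def sum_distrib_left by (subst sum.swap) (simp add: algebra_simps)

definition hermitian_array :: "nat \<Rightarrow> (nat \<Rightarrow> nat \<Rightarrow> complex) \<Rightarrow> bool" where
  "hermitian_array n a \<longleftrightarrow> (\<forall>i<n. \<forall>j<n. a i j = cnj (a j i))"

lemma cinner_mvec_hermitian:
  assumes "hermitian_array n a"
  shows "cinner n x (mvec n a y) = cinner n (mvec n a x) y"
proof -
  have "cinner n x (mvec n a y) = (\<Sum>i<n. \<Sum>j<n. cnj (x i) * (a i j * y j))"
    by (simp add: cinner_def mvec_def sum_distrib_left)
  also have "\<dots> = (\<Sum>j<n. \<Sum>i<n. cnj (x i) * (a i j * y j))" by (rule sum.swap)
  also have "\<dots> = (\<Sum>j<n. \<Sum>i<n. cnj (a j i) * cnj (x i) * y j)"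
  proof (intro sum.cong refl)
    fix i j assume "i \<in> {..<n}" "j \<in> {..<n}"
    then have "a i j = cnj (a j i)" using assms unfolding hermitian_array_def by blast
    then show "cnj (x i) * (a i j * y j) = cnj (a j i) * cnj (x i) * y j" by (simp only: mult_ac)
  qed
  also have "\<dots> = cinner n (mvec n a x) y"
    by (simp add: cinner_def mvec_def sum_distrib_right)
  finally show ?thesis .
qed

text \<open>
  The columns of the matrix \<open>P\<close> of a Schur decomposition span an increasing chain of invariant
  subspaces. Gram-Schmidt applied to them gives eigenvectors: for the new vector \<open>r\<close> the vector
  \<open>a r - e r\<close>, with \<open>e\<close> the next diagonal entry, lies in the span of the previous ones, and it is
  orthogonal to them as \<open>a\<close> is hermitian. The eigenvalues thus appear in the order of the factors of the
  characteristic polynomial, which keeps track of their multiplicities.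
\<close>
lemma hermitian_orthogonal_eigenbasis:
  assumes herm: "hermitian_array n a"
  shows "\<exists>q es. length es = n
    \<and> char_poly (Matrix.mat n n (\<lambda>(i, j). a i j)) = (\<Prod>e\<leftarrow>es. [:- e, 1:])
    \<and> (\<forall>j<n. \<forall>i<n. mvec n a (q j) i = es ! j * q j i)
    \<and> (\<forall>j<n. cinner n (q j) (q j) \<noteq> 0)
    \<and> (\<forall>j<n. \<forall>l<n. j \<noteq> l \<longrightarrow> cinner n (q j) (q l) = 0)"
proof -
  define A where "A = Matrix.mat n n (\<lambda>(i, j). a i j)"
  have A: "A \<in> carrier_mat n n" by (simp add: A_def)
  from char_poly_factorized[OF A] obtain es where
    es: "char_poly A = (\<Prod>e\<leftarrow>es. [:- e, 1:])" "length es = n" by blast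
  obtain B P P' where BPQ: "schur_decomposition A es = (B, P, P')" by (cases "schur_decomposition A es") auto
  from schur_decomposition[OF A es(1) BPQ] have
    sim: "similar_mat_wit A B P P'" and ut: "upper_triangular B" and dg: "diag_mat B = es" by auto
  from similar_mat_witD2[OF A sim] have
    car: "P \<in> carrier_mat n n" "P' \<in> carrier_mat n n" "B \<in> carrier_mat n n"
    and inv: "P * P' = 1\<^sub>m n" "P' * P = 1\<^sub>m n" and ABP: "A = P * B * P'" by auto
  have "A * P = P * B * (P' * P)" using car ABP by (simp add: assoc_mult_mat[of _ n n _ n _ n])
  then have AP: "A * P = P * B" using inv car by simp
  define p where "p = (\<lambda>j i. P $$ (i, j))"
  have dgB: "B $$ (j, j) = es ! j" if "j < n" for j
    using dg that car by (auto simp: diag_mat_def)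
  have Ap: "mvec n a (p j) i = (\<Sum>l\<le>j. B $$ (l, j) * p l i)" if "j < n" "i < n" for i j
  proof -
    have "mvec n a (p j) i = (A * P) $$ (i, j)"
      using that car by (simp add: mvec_def p_def A_def times_mat_def scalar_prod_def lessThan_atLeast0)
    also have "\<dots> = (\<Sum>l<n. B $$ (l, j) * p l i)"
      using that car unfolding AP by (simp add: p_def times_mat_def scalar_prod_def lessThan_atLeast0 mult.commute)
    also have "\<dots> = (\<Sum>l\<le>j. B $$ (l, j) * p l i)"
      using that ut car by (intro sum.mono_neutral_right) (auto simp: upper_triangular_def)
    finally show ?thesis .
  qed
  have p_indep: "\<forall>l<n. s l = 0" if "\<forall>i<n. (\<Sum>l<n. s l * p l i) = 0" for s
  proof -
    define v where "v = Matrix.vec n s"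
    have v: "v \<in> carrier_vec n" by (simp add: v_def)
    have "P *\<^sub>v v = 0\<^sub>v n"
      using that car by (intro eq_vecI) (auto simp: v_def p_def scalar_prod_def lessThan_atLeast0 mult.commute)
    then have "P' *\<^sub>v (P *\<^sub>v v) = 0\<^sub>v n" using car by (auto intro!: eq_vecI simp: scalar_prod_def)
    then have "v = 0\<^sub>v n"
      using assoc_mult_mat_vec[OF car(2,1) v] inv v by simp
    then show ?thesis unfolding v_def by (metis index_vec index_zero_vec(1))
  qed
  \<comment> \<open>Beside orthogonality, the induction carries that both families are triangular in terms of each other.\<close>
  define Pr where "Pr = (\<lambda>j q. (\<forall>m<j. \<forall>i<n. mvec n a (q m) i = es ! m * q m i)
      \<and> (\<forall>m<j. cinner n (q m) (q m) \<noteq> 0)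
      \<and> (\<forall>m<j. \<forall>l<j. m \<noteq> l \<longrightarrow> cinner n (q m) (q l) = 0)
      \<and> (\<forall>m<j. \<exists>t. \<forall>i<n. p m i = (\<Sum>l\<le>m. t l * q l i))
      \<and> (\<forall>m<j. \<exists>s. \<forall>i<n. q m i = (\<Sum>l\<le>m. s l * p l i)))"
  have "j \<le> n \<Longrightarrow> \<exists>q. Pr j q" for j
  proof (induction j)
    case 0
    show ?case by (simp add: Pr_def)
  next
    case (Suc j)
    then have j: "j < n" by simp
    obtain q where Pr: "Pr j q" using Suc.IH j by auto
    note ev = Pr[unfolded Pr_def, THEN conjunct1, rule_format]
      and nz = Pr[unfolded Pr_def, THEN conjunct2, THEN conjunct1, rule_format]
      and orth = Pr[unfolded Pr_def, THEN conjunct2, THEN conjunct2, THEN conjunct1, rule_format]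
      and ex_t = Pr[unfolded Pr_def, THEN conjunct2, THEN conjunct2, THEN conjunct2, THEN conjunct1, rule_format]
      and ex_s = Pr[unfolded Pr_def, THEN conjunct2, THEN conjunct2, THEN conjunct2, THEN conjunct2, rule_format]
    obtain t where t: "\<And>m i. m < j \<Longrightarrow> i < n \<Longrightarrow> p m i = (\<Sum>l\<le>m. t m l * q l i)"
      using ex_t by metis
    obtain s where s: "\<And>m i. m < j \<Longrightarrow> i < n \<Longrightarrow> q m i = (\<Sum>l\<le>m. s m l * p l i)"
      using ex_s by metis
    have t': "p m i = (\<Sum>l<j. (if l \<le> m then t m l else 0) * q l i)" if "m < j" "i < n" for m i
      unfolding t[OF that] using that by (intro sum.mono_neutral_cong_left) auto
    have s': "q m i = (\<Sum>l<j. (if l \<le> m then s m l else 0) * p l i)" if "m < j" "i < n" for m i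
      unfolding s[OF that] using that by (intro sum.mono_neutral_cong_left) auto
    define c where "c = (\<lambda>l. cinner n (q l) (p j) / cinner n (q l) (q l))"
    define r where "r = (\<lambda>i. p j i - (\<Sum>l<j. c l * q l i))"
    have r_orth: "cinner n (q m) r = 0" if "m < j" for m
    proof -
      have "cinner n (q m) r = cinner n (q m) (p j) + cinner n (q m) (\<lambda>i. \<Sum>l<j. (- c l) * q l i)"
        unfolding r_def cinner_add[symmetric] by (simp add: sum_negf)
      also have "cinner n (q m) (\<lambda>i. \<Sum>l<j. (- c l) * q l i) = (\<Sum>l<j. (- c l) * cinner n (q m) (q l))"
        by (rule cinner_sum)
      also have "\<dots> = (\<Sum>l\<in>{m}. (- c l) * cinner n (q m) (q l))"
        using that orth by (intro sum.mono_neutral_right) auto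
      finally show ?thesis using nz[OF that] by (simp add: c_def)
    qed
    \<comment> \<open>Coefficients of \<open>r\<close> in terms of the columns of \<open>P\<close>; as the one at \<open>p j\<close> is 1, \<open>r\<close> does not vanish.\<close>
    define S where "S = (\<lambda>l. if l = j then 1 else - (\<Sum>m<j. c m * (if l \<le> m then s m l else 0)))"
    have rS: "r i = (\<Sum>l\<le>j. S l * p l i)" if "i < n" for i
    proof -
      have "(\<Sum>m<j. c m * q m i) = (\<Sum>m<j. \<Sum>l<j. c m * ((if l \<le> m then s m l else 0) * p l i))"
        by (intro sum.cong refl) (simp only: s'[OF _ that] sum_distrib_left lessThan_iff)
      also have "\<dots> = (\<Sum>l<j. \<Sum>m<j. c m * ((if l \<le> m then s m l else 0) * p l i))" by (rule sum.swap)
      also have "\<dots> = (\<Sum>l<j. - S l * p l i)"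
        by (intro sum.cong refl) (auto simp: S_def sum_distrib_right mult.assoc)
      finally have e: "(\<Sum>m<j. c m * q m i) = - (\<Sum>l<j. S l * p l i)" by (simp add: sum_negf)
      have "(\<Sum>l\<le>j. S l * p l i) = (\<Sum>l<j. S l * p l i) + p j i"
        by (simp add: lessThan_Suc_atMost[symmetric] S_def)
      then show ?thesis unfolding r_def e by simp
    qed
    have r_nz: "cinner n r r \<noteq> 0"
    proof
      assume "cinner n r r = 0"
      then have r0: "r i = 0" if "i < n" for i using that by (auto simp: cinner_self_eq_0)
      have "\<forall>l<n. (if l \<le> j then S l else 0) = 0"
      proof (rule p_indep, intro allI impI)
        fix i assume i: "i < n"
        have "(\<Sum>l<n. (if l \<le> j then S l else 0) * p l i) = (\<Sum>l\<le>j. S l * p l i)"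
          using j by (intro sum.mono_neutral_cong_right) auto
        then show "(\<Sum>l<n. (if l \<le> j then S l else 0) * p l i) = 0" using rS[OF i] r0[OF i] by simp
      qed
      then have "S j = 0" using j by auto
      then show False by (simp add: S_def)
    qed
    have pr: "p j i = r i + (\<Sum>l<j. c l * q l i)" for i by (simp add: r_def)
    have "\<exists>d. \<forall>i<n. mvec n a r i = es ! j * r i + (\<Sum>l<j. d l * q l i)"
    proof -
      define X where "X = (\<lambda>l. (\<Sum>m<j. B $$ (m, j) * (if l \<le> m then t m l else 0)))"
      define d where "d = (\<lambda>l. es ! j * c l + X l - c l * es ! l)"
      have "mvec n a r i = es ! j * r i + (\<Sum>l<j. d l * q l i)" if i: "i < n" for i
      proof -
        have "mvec n a r i = mvec n a (p j) i - (\<Sum>l<j. c l * mvec n a (q l) i)"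
          unfolding r_def mvec_sum[symmetric] by (simp add: mvec_def algebra_simps sum_subtractf)
        also have "(\<Sum>l<j. c l * mvec n a (q l) i) = (\<Sum>l<j. c l * (es ! l * q l i))"
          by (intro sum.cong refl) (simp add: ev i)
        also have "mvec n a (p j) i = (\<Sum>l<j. B $$ (l, j) * p l i) + es ! j * p j i"
          unfolding Ap[OF j i] by (simp add: lessThan_Suc_atMost[symmetric] dgB j)
        also have "(\<Sum>m<j. B $$ (m, j) * p m i)
            = (\<Sum>m<j. \<Sum>l<j. B $$ (m, j) * ((if l \<le> m then t m l else 0) * q l i))"
          by (intro sum.cong refl) (simp only: t'[OF _ i] sum_distrib_left lessThan_iff)
        also have "\<dots> = (\<Sum>l<j. \<Sum>m<j. B $$ (m, j) * ((if l \<le> m then t m l else 0) * q l i))" by (rule sum.swap)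
        also have "\<dots> = (\<Sum>l<j. X l * q l i)"
          by (intro sum.cong refl) (simp only: X_def sum_distrib_right mult.assoc)
        finally show ?thesis
          unfolding pr by (simp add: d_def ring_distribs sum_distrib_left sum.distrib sum_subtractf mult.assoc)
      qed
      then show ?thesis by blast
    qed
    then obtain d where d: "\<And>i. i < n \<Longrightarrow> mvec n a r i = es ! j * r i + (\<Sum>l<j. d l * q l i)" by blast
    have d0: "d m = 0" if m: "m < j" for m
    proof -
      have "cinner n (q m) (mvec n a r) = cinner n (mvec n a (q m)) r"
        by (rule cinner_mvec_hermitian[OF herm])
      also have "\<dots> = cinner n (\<lambda>i. es ! m * q m i) r" by (rule cinner_cong_left) (simp add: ev m)
      also have "\<dots> = cnj (es ! m) * cinner n (q m) r"
        by (simp add: cinner_def sum_distrib_left mult.assoc)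
      finally have "cinner n (q m) (mvec n a r) = 0" by (simp add: r_orth m)
      moreover have "cinner n (q m) (mvec n a r)
          = cinner n (q m) (\<lambda>i. es ! j * r i + (\<Sum>l<j. d l * q l i))"
        by (rule cinner_cong) (simp add: d)
      moreover have "\<dots> = es ! j * cinner n (q m) r + (\<Sum>l<j. d l * cinner n (q m) (q l))"
        by (simp add: cinner_add cinner_scale cinner_sum)
      moreover have "(\<Sum>l<j. d l * cinner n (q m) (q l)) = (\<Sum>l\<in>{m}. d l * cinner n (q m) (q l))"
        using m orth by (intro sum.mono_neutral_right) auto
      ultimately show ?thesis using nz[OF m] by (simp add: r_orth m)
    qed
    have r_ev: "mvec n a r i = es ! j * r i" if "i < n" for i
      using d[OF that] d0 by simp
    have r_orth': "cinner n r (q m) = 0" if "m < j" for m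
      using r_orth[OF that] cnj_cinner[of n "q m" r] by simp
    define q' where "q' = q(j := r)"
    have "\<forall>m<Suc j. \<forall>i<n. mvec n a (q' m) i = es ! m * q' m i"
      using ev r_ev by (auto simp: q'_def less_Suc_eq)
    moreover have "\<forall>m<Suc j. cinner n (q' m) (q' m) \<noteq> 0"
      using nz r_nz by (auto simp: q'_def less_Suc_eq)
    moreover have "\<forall>m<Suc j. \<forall>l<Suc j. m \<noteq> l \<longrightarrow> cinner n (q' m) (q' l) = 0"
      using orth r_orth r_orth' by (simp add: q'_def less_Suc_eq)
    moreover have "\<forall>m<Suc j. \<exists>t. \<forall>i<n. p m i = (\<Sum>l\<le>m. t l * q' l i)"
    proof (intro allI impI)
      fix m assume "m < Suc j"
      show "\<exists>t. \<forall>i<n. p m i = (\<Sum>l\<le>m. t l * q' l i)"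
      proof (cases "m = j")
        case True
        show ?thesis unfolding True pr
          by (intro exI[of _ "\<lambda>l. if l = j then 1 else c l"])
             (auto simp: lessThan_Suc_atMost[symmetric] q'_def)
      next
        case False
        with \<open>m < Suc j\<close> t show ?thesis
          by (intro exI[of _ "t m"]) (auto simp: q'_def intro!: sum.cong)
      qed
    qed
    moreover have "\<forall>m<Suc j. \<exists>s. \<forall>i<n. q' m i = (\<Sum>l\<le>m. s l * p l i)"
    proof (intro allI impI)
      fix m assume "m < Suc j"
      show "\<exists>s. \<forall>i<n. q' m i = (\<Sum>l\<le>m. s l * p l i)"
      proof (cases "m = j")
        case True
        show ?thesis by (rule exI[of _ S]) (simp add: True q'_def rS)
      next
        case False
        with \<open>m < Suc j\<close> s show ?thesis by (intro exI[of _ "s m"]) (simp add: q'_def)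
      qed
    qed
    ultimately have "Pr (Suc j) q'" unfolding Pr_def by (intro conjI)
    then show ?case by blast
  qed
  from this[OF le_refl] obtain q where Pr: "Pr n q" by (elim exE)
  show ?thesis unfolding A_def[symmetric]
    by (intro exI[of _ q] exI[of _ es] conjI es
        Pr[unfolded Pr_def, THEN conjunct1]
        Pr[unfolded Pr_def, THEN conjunct2, THEN conjunct1]
        Pr[unfolded Pr_def, THEN conjunct2, THEN conjunct2, THEN conjunct1])
qed

lemma cinner_sum_left: "cinner n (\<lambda>i. \<Sum>l\<in>L. c l * y l i) x = (\<Sum>l\<in>L. cnj (c l) * cinner n (y l) x)"
  by (subst cnj_cinner[symmetric], subst cinner_sum) (simp add: cnj_cinner)

lemma order_prod_linear:
  "Polynomial.order x (\<Prod>e\<leftarrow>es. [:- e, 1:]) = card {j. j < length es \<and> es ! j = (x :: complex)}"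
proof (induction es)
  case Nil
  then show ?case by simp
next
  case (Cons e es)
  have nz: "(\<Prod>e\<leftarrow>es. [:- e, 1:]) \<noteq> 0" for es :: "complex list"
    unfolding prod_list_zero_iff by auto
  have "Polynomial.order x [:- e, 1:] = (if x = e then 1 else 0)"
    using order_power_n_n[of e 1] order_0I[of "[:- e, 1:]" x] by (cases "x = e") simp_all
  moreover have "{j. j < length (e # es) \<and> (e # es) ! j = x}
      = (if x = e then {0} else {}) \<union> Suc ` {j. j < length es \<and> es ! j = x}"
    by (auto simp: less_Suc_eq_0_disj)
  ultimately have "card {j. j < length (e # es) \<and> (e # es) ! j = x}
      = Polynomial.order x [:- e, 1:] + card {j. j < length es \<and> es ! j = x}"
    by (simp add: card_image)
  moreover have "Polynomial.order x (\<Prod>e\<leftarrow>e # es. [:- e, 1:])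
      = Polynomial.order x [:- e, 1:] + Polynomial.order x (\<Prod>e\<leftarrow>es. [:- e, 1:])"
    unfolding list.map prod_list.Cons
    by (rule order_mult) (use nz[of es] in \<open>simp add: no_zero_divisors del: mult_pCons_left\<close>)
  ultimately show ?case using Cons by simp
qed

lemma num_neg_eigenvalues_eq_card:
  assumes A: "A \<in> carrier_mat n n" and es: "char_poly A = (\<Prod>e\<leftarrow>es. [:- e, 1:])"
  shows "num_neg_eigenvalues A = card {j. j < length es \<and> es ! j \<in> \<real> \<and> Re (es ! j) < 0}"
proof -
  define L where "L = {l :: real. l < 0 \<and> eigenvalue A (complex_of_real l)}"
  define J where "J = (\<lambda>l. {j. j < length es \<and> es ! j = complex_of_real l})"
  have ev: "eigenvalue A x \<longleftrightarrow> x \<in> set es" for x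
    unfolding eigenvalue_root_char_poly[OF A] es by (induction es) (auto simp: poly_prod_list)
  have "complex_of_real ` L \<subseteq> set es" by (auto simp: L_def ev)
  then have fin: "finite L"
    using finite_imageD[of complex_of_real L] finite_subset[of _ "set es"] by (auto simp: inj_on_def)
  have "num_neg_eigenvalues A = (\<Sum>l\<in>L. card (J l))"
    unfolding num_neg_eigenvalues_def L_def J_def es order_prod_linear ..
  also have "\<dots> = card (\<Union>l\<in>L. J l)"
    by (rule card_UN_disjoint[symmetric]) (use fin in \<open>auto simp: J_def\<close>)
  also have "(\<Union>l\<in>L. J l) = {j. j < length es \<and> es ! j \<in> \<real> \<and> Re (es ! j) < 0}"
    by (force simp: J_def L_def ev Reals_def complex_eq_iff)
  finally show ?thesis .
qed

text \<open>
  The assumption \<open>num_neg\<close> turns multiplicities of roots of the characteristic polynomial into numbers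
  of eigenvectors.
\<close>
locale hermitian_eigenbasis =
  fixes n :: nat and a :: "nat \<Rightarrow> nat \<Rightarrow> complex" and q :: "nat \<Rightarrow> nat \<Rightarrow> complex" and e :: "nat \<Rightarrow> real"
  assumes eigen: "\<And>j i. j < n \<Longrightarrow> i < n \<Longrightarrow> mvec n a (q j) i = e j * q j i"
    and nonzero: "\<And>j. j < n \<Longrightarrow> cinner n (q j) (q j) \<noteq> 0"
    and orthogonal: "\<And>j l. j < n \<Longrightarrow> l < n \<Longrightarrow> j \<noteq> l \<Longrightarrow> cinner n (q j) (q l) = 0"
    and num_neg: "num_neg_eigenvalues (Matrix.mat n n (\<lambda>(i, j). a i j)) = card {j. j < n \<and> e j < 0}"
begin

lemma cinner_eigenvector_combination:
  assumes "N \<subseteq> {..<n}" "m < n"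
  shows "cinner n (q m) (\<lambda>i. \<Sum>l\<in>N. y l * q l i) = (if m \<in> N then y m * cinner n (q m) (q m) else 0)"
proof -
  have fin: "finite N" using assms(1) finite_subset by blast
  have "cinner n (q m) (\<lambda>i. \<Sum>l\<in>N. y l * q l i) = (\<Sum>l\<in>N. if l = m then y m * cinner n (q m) (q m) else 0)"
    unfolding cinner_sum using assms orthogonal by (intro sum.cong refl) (auto simp: subset_iff)
  then show ?thesis using fin by (simp add: sum.delta)
qed

lemma form_eigenvector_combination:
  assumes N: "N \<subseteq> {..<n}"
  shows "Re (cinner n (\<lambda>i. \<Sum>l\<in>N. y l * q l i) (mvec n a (\<lambda>i. \<Sum>l\<in>N. y l * q l i)))
       = (\<Sum>l\<in>N. e l * ((cmod (y l))\<^sup>2 * Re (cinner n (q l) (q l))))"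
proof -
  have "cinner n (\<lambda>i. \<Sum>l\<in>N. y l * q l i) (mvec n a (\<lambda>i. \<Sum>l\<in>N. y l * q l i))
      = (\<Sum>m\<in>N. cnj (y m) * cinner n (q m) (\<lambda>i. \<Sum>l\<in>N. (y l * e l) * q l i))"
    unfolding cinner_sum_left
  proof (intro sum.cong refl arg_cong2[where f = "(*)"] cinner_cong)
    fix i assume "i < n"
    then show "mvec n a (\<lambda>i. \<Sum>l\<in>N. y l * q l i) i = (\<Sum>l\<in>N. (y l * e l) * q l i)"
      unfolding mvec_sum using N by (intro sum.cong refl) (auto simp: eigen)
  qed
  also have "\<dots> = (\<Sum>m\<in>N. complex_of_real (e m * ((cmod (y m))\<^sup>2 * Re (cinner n (q m) (q m)))))"
  proof (intro sum.cong refl)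
    fix m assume m: "m \<in> N"
    have "cinner n (q m) (\<lambda>i. \<Sum>l\<in>N. (y l * e l) * q l i) = (y m * e m) * cinner n (q m) (q m)"
      using cinner_eigenvector_combination[OF N, of m "\<lambda>l. y l * e l"] m N by auto
    moreover have "cinner n (q m) (q m) = of_real (Re (cinner n (q m) (q m)))"
      unfolding cinner_self by simp
    moreover have "cnj (y m) * y m = of_real ((cmod (y m))\<^sup>2)"
      by (metis complex_norm_square mult.commute)
    ultimately show "cnj (y m) * cinner n (q m) (\<lambda>i. \<Sum>l\<in>N. (y l * e l) * q l i)
        = complex_of_real (e m * ((cmod (y m))\<^sup>2 * Re (cinner n (q m) (q m))))"
      by (smt (verit) mult.assoc mult.commute of_real_mult)
  qed
  finally show ?thesis by simp
qed

lemma norm_eigenvector_pos: "m < n \<Longrightarrow> Re (cinner n (q m) (q m)) > 0"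
  using nonzero[of m] sum_nonneg[of "{..<n}" "\<lambda>i. (cmod (q m i))\<^sup>2"]
  unfolding cinner_self of_real_eq_0_iff Re_complex_of_real by simp

lemma eigenvector_expansion: "\<exists>c. \<forall>i<n. x i = (\<Sum>l<n. c l * q l i)"
proof -
  define f where "f = (\<lambda>i j. if j < n then q j i else x i)"
  obtain y where y: "\<exists>j\<in>{..n}. y j \<noteq> 0" "\<forall>i\<in>{..<n}. (\<Sum>j\<in>{..n}. f i j * y j) = 0"
    using homogeneous_system_nontrivial_solution[OF finite_lessThan[of n] finite_atMost[of n], of f,
        unfolded card_lessThan card_atMost, OF lessI]
    by (elim exE conjE) (rule that)
  have eq: "(\<Sum>l<n. y l * q l i) + y n * x i = 0" if "i < n" for i
    using y(2) that by (auto simp: lessThan_Suc_atMost[symmetric] f_def mult.commute)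
  have "y n \<noteq> 0"
  proof
    assume yn: "y n = 0"
    have "y m = 0" if m: "m < n" for m
    proof -
      have "cinner n (q m) (\<lambda>i. \<Sum>l<n. y l * q l i) = cinner n (q m) (\<lambda>_. 0)"
        by (rule cinner_cong) (use eq yn in auto)
      then show ?thesis using cinner_eigenvector_combination[of "{..<n}" m y] m nonzero[OF m]
        by (simp add: cinner_def)
    qed
    with y(1) yn show False by (auto simp: le_less)
  qed
  have "x i = (\<Sum>l<n. (- y l / y n) * q l i)" if "i < n" for i
  proof -
    have "(\<Sum>l<n. (- y l / y n) * q l i) = - (\<Sum>l<n. y l * q l i) / y n"
      by (simp add: sum_negf sum_divide_distrib)
    also have "\<dots> = x i" using eq[OF that] \<open>y n \<noteq> 0\<close>
      by (simp only: nonzero_divide_eq_eq minus_unique mult.commute) simp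
    finally show ?thesis ..
  qed
  then show ?thesis by (intro exI[of _ "\<lambda>l. - y l / y n"] allI impI)
qed

end

lemma hermitian_eigenbasis_exists:
  assumes herm: "hermitian_array n a"
  shows "\<exists>q e. hermitian_eigenbasis n a q e"
proof -
  obtain q es where len: "length es = n"
    and cp: "char_poly (Matrix.mat n n (\<lambda>(i, j). a i j)) = (\<Prod>e\<leftarrow>es. [:- e, 1:])"
    and ev: "\<forall>j<n. \<forall>i<n. mvec n a (q j) i = es ! j * q j i"
    and nz: "\<forall>j<n. cinner n (q j) (q j) \<noteq> 0"
    and orth: "\<forall>j<n. \<forall>l<n. j \<noteq> l \<longrightarrow> cinner n (q j) (q l) = 0"
    using hermitian_orthogonal_eigenbasis[OF herm] by (elim exE conjE) (rule that)
  have re: "es ! j \<in> \<real>" if j: "j < n" for j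
  proof -
    have e1: "cinner n (q j) (mvec n a (q j)) = es ! j * cinner n (q j) (q j)"
      using cinner_cong[of n "mvec n a (q j)" "\<lambda>i. es ! j * q j i" "q j"] ev j by (simp add: cinner_scale)
    have "cnj (cinner n (mvec n a (q j)) (q j)) = es ! j * cinner n (q j) (q j)"
      unfolding cnj_cinner e1 ..
    moreover have "cinner n (mvec n a (q j)) (q j) = cinner n (q j) (mvec n a (q j))"
      by (rule cinner_mvec_hermitian[OF herm, symmetric])
    ultimately have "cnj (es ! j) = es ! j"
      using nz j by (simp add: e1 cnj_cinner)
    then show ?thesis by (simp add: Reals_cnj_iff)
  qed
  have "num_neg_eigenvalues (Matrix.mat n n (\<lambda>(i, j). a i j)) = card {j. j < n \<and> Re (es ! j) < 0}"
    unfolding num_neg_eigenvalues_eq_card[OF mat_carrier cp] len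
    by (rule arg_cong[where f = card]) (use re in auto)
  then have "hermitian_eigenbasis n a q (\<lambda>j. Re (es ! j))"
    using ev nz orth by (unfold_locales, simp_all add: of_real_Re[OF re])
  then show ?thesis by blast
qed

text \<open>
  On the span of the eigenvectors with negative eigenvalues the form is negative definite. If there
  were more than \<open>k\<close> of them, some nonzero vector of this span would satisfy the \<open>k\<close> linear conditions
  given by \<open>ell\<close>.
\<close>
lemma num_neg_eigenvalues_le:
  assumes herm: "hermitian_array n a"
    and pos: "\<And>x. (\<And>m. m < k \<Longrightarrow> (\<Sum>i<n. ell m i * x i) = 0) \<Longrightarrow> 0 \<le> Re (cinner n x (mvec n a x))"
  shows "num_neg_eigenvalues (Matrix.mat n n (\<lambda>(i, j). a i j)) \<le> k"
proof (rule ccontr)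
  assume contra: "\<not> ?thesis"
  obtain q e where "hermitian_eigenbasis n a q e" using hermitian_eigenbasis_exists[OF herm] by blast
  then interpret hermitian_eigenbasis n a q e .
  define N where "N = {j. j < n \<and> e j < 0}"
  have N: "finite N" "N \<subseteq> {..<n}" by (auto simp: N_def)
  have "card {..<k} < card N" using contra num_neg by (simp add: N_def)
  from homogeneous_system_nontrivial_solution[OF finite_lessThan N(1) this, of "\<lambda>m l. \<Sum>i<n. ell m i * q l i"]
  obtain y where y: "\<exists>j\<in>N. y j \<noteq> 0" "\<And>m. m < k \<Longrightarrow> (\<Sum>l\<in>N. (\<Sum>i<n. ell m i * q l i) * y l) = 0"
    by auto
  define x where "x = (\<lambda>i. \<Sum>l\<in>N. y l * q l i)"
  have "(\<Sum>i<n. ell m i * x i) = 0" if "m < k" for m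
  proof -
    have "(\<Sum>i<n. ell m i * x i) = (\<Sum>l\<in>N. (\<Sum>i<n. ell m i * q l i) * y l)"
      unfolding x_def sum_distrib_left sum_distrib_right by (subst sum.swap) (simp add: mult_ac)
    then show ?thesis using y(2)[OF that] by simp
  qed
  then have "0 \<le> Re (cinner n x (mvec n a x))" by (rule pos)
  also have "\<dots> = (\<Sum>l\<in>N. e l * ((cmod (y l))\<^sup>2 * Re (cinner n (q l) (q l))))"
    unfolding x_def by (rule form_eigenvector_combination[OF N(2)])
  also have "\<dots> < 0"
  proof -
    obtain j where j: "j \<in> N" "y j \<noteq> 0" using y(1) by blast
    have "e j * ((cmod (y j))\<^sup>2 * Re (cinner n (q j) (q j))) < 0"
      using j norm_eigenvector_pos[of j] by (auto simp: N_def mult_neg_pos)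
    moreover have "e l * ((cmod (y l))\<^sup>2 * Re (cinner n (q l) (q l))) \<le> 0" if "l \<in> N" for l
      using that norm_eigenvector_pos[of l] by (auto simp: N_def mult_nonpos_nonneg)
    ultimately have "(\<Sum>l\<in>N. e l * ((cmod (y l))\<^sup>2 * Re (cinner n (q l) (q l)))) < (\<Sum>l\<in>N. 0)"
      using j N by (intro sum_strict_mono_ex1) auto
    then show ?thesis by simp
  qed
  finally show False by simp
qed

text \<open>
  If there were fewer than \<open>k\<close> negative eigenvalues, some nontrivial combination of the \<open>v m\<close> would be
  orthogonal to their eigenvectors, and the form is nonnegative on such a vector.
\<close>
lemma num_neg_eigenvalues_ge:
  assumes herm: "hermitian_array n a"
    and neg: "\<And>y. (\<exists>m<k. y m \<noteq> 0) \<Longrightarrow>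
      Re (cinner n (\<lambda>i. \<Sum>m<k. y m * v m i) (mvec n a (\<lambda>i. \<Sum>m<k. y m * v m i))) < 0"
  shows "k \<le> num_neg_eigenvalues (Matrix.mat n n (\<lambda>(i, j). a i j))"
proof (rule ccontr)
  assume contra: "\<not> ?thesis"
  obtain q e where "hermitian_eigenbasis n a q e" using hermitian_eigenbasis_exists[OF herm] by blast
  then interpret hermitian_eigenbasis n a q e .
  define N where "N = {j. j < n \<and> e j < 0}"
  have N: "finite N" "N \<subseteq> {..<n}" by (auto simp: N_def)
  have "card N < card {..<k}" using contra num_neg by (simp add: N_def)
  from homogeneous_system_nontrivial_solution[OF N(1) finite_lessThan this, of "\<lambda>l m. cinner n (q l) (v m)"]
  obtain y where y: "\<exists>j\<in>{..<k}. y j \<noteq> 0" "\<forall>l\<in>N. (\<Sum>m<k. cinner n (q l) (v m) * y m) = 0"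
    by (elim exE conjE) (rule that)
  define x where "x = (\<lambda>i. \<Sum>m<k. y m * v m i)"
  obtain c where "\<forall>i<n. x i = (\<Sum>l<n. c l * q l i)"
    using eigenvector_expansion[of x] by (elim exE) (rule that)
  then have c: "x i = (\<Sum>l<n. c l * q l i)" if "i < n" for i using that by simp
  have c0: "c l = 0" if l: "l \<in> N" for l
  proof -
    have "c l * cinner n (q l) (q l) = cinner n (q l) (\<lambda>i. \<Sum>l<n. c l * q l i)"
      using cinner_eigenvector_combination[of "{..<n}" l c] l N by auto
    also have "\<dots> = cinner n (q l) x" by (rule cinner_cong) (simp add: c)
    also have "\<dots> = 0" unfolding x_def cinner_sum using y(2) l by (simp add: mult.commute)
    finally show ?thesis using nonzero l N by auto
  qed
  have "Re (cinner n x (mvec n a x))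
      = Re (cinner n (\<lambda>i. \<Sum>l<n. c l * q l i) (mvec n a (\<lambda>i. \<Sum>l<n. c l * q l i)))"
    by (simp add: cinner_def mvec_def c)
  also have "\<dots> = (\<Sum>l<n. e l * ((cmod (c l))\<^sup>2 * Re (cinner n (q l) (q l))))"
    by (rule form_eigenvector_combination) simp
  also have "\<dots> \<ge> 0"
  proof (rule sum_nonneg)
    fix l assume "l \<in> {..<n}"
    then show "0 \<le> e l * ((cmod (c l))\<^sup>2 * Re (cinner n (q l) (q l)))"
      using c0[of l] norm_eigenvector_pos[of l] by (cases "l \<in> N") (auto simp: N_def)
  qed
  finally have "0 \<le> Re (cinner n x (mvec n a x))" .
  moreover have "Re (cinner n x (mvec n a x)) < 0" unfolding x_def by (rule neg) (use y(1) in blast)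
  ultimately show False by simp
qed

section \<open>Kernels with a prescribed number of negative squares\<close>

lemma hermitian_nevanlinna_kernel:
  "hermitian_array n (\<lambda>i j. nevanlinna_kernel M (w i) (w j))"
proof -
  have "nevanlinna_kernel M z \<zeta> = cnj (nevanlinna_kernel M \<zeta> z)" for z \<zeta>
  proof -
    have "cnj (nevanlinna_kernel M \<zeta> z) = (- (M z - cnj (M \<zeta>))) / (- (z - cnj \<zeta>))"
      unfolding nevanlinna_kernel_def by simp
    also have "\<dots> = nevanlinna_kernel M z \<zeta>"
      unfolding nevanlinna_kernel_def by (rule minus_divide_divide)
    finally show ?thesis ..
  qed
  then show ?thesis unfolding hermitian_array_def by blast
qed

lemma cinner_mvec_eq: "cinner n x (mvec n a x) = (\<Sum>i<n. \<Sum>j<n. cnj (x i) * x j * a i j)"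
  by (simp add: cinner_def mvec_def sum_distrib_left mult_ac)

lemma has_sum_sum:
  fixes f :: "'a \<Rightarrow> 'b \<Rightarrow> 'c::{topological_comm_monoid_add}"
  assumes "\<And>i. i \<in> I \<Longrightarrow> (f i has_sum S i) A"
  shows "((\<lambda>x. \<Sum>i\<in>I. f i x) has_sum (\<Sum>i\<in>I. S i)) A"
  using assms by (induction I rule: infinite_finite_induct) (auto intro: has_sum_add)

text \<open>
  The kernel of \<open>1 / (l - z) - 1 / (l - t)\<close> is \<open>1 / ((l - z) * cnj (l - \<zeta>))\<close>, which is of rank one and
  nonnegative, and the linear term contributes the constant kernel \<open>c\<close>.
\<close>
lemma herglotz_series_kernel_nonneg:
  fixes t c :: real and G M :: "complex \<Rightarrow> complex" and p x :: "nat \<Rightarrow> complex" and w :: "real \<Rightarrow> real"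
  assumes ser: "\<And>z :: complex. z \<notin> \<real> \<Longrightarrow>
      ((\<lambda>l. of_real (w l) * ((z - t) / ((of_real l - of_real t) * (of_real l - z)))) has_sum G z) Z"
    and w: "\<And>l. l \<in> Z \<Longrightarrow> 0 \<le> w l \<and> l \<noteq> t"
    and c: "0 \<le> c"
    and M: "\<And>z :: complex. z \<notin> \<real> \<Longrightarrow> M z = of_real c * (z - t) + G z"
    and p: "\<And>i. i < n \<Longrightarrow> p i \<notin> \<real>" "\<And>i j. i < n \<Longrightarrow> j < n \<Longrightarrow> p i \<noteq> cnj (p j)"
  shows "0 \<le> Re (cinner n x (mvec n (\<lambda>i j. nevanlinna_kernel M (p i) (p j)) x))"
proof -
  have K: "((\<lambda>l. of_real (w l) * (1 / ((of_real l - p i) * cnj (of_real l - p j))))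
      has_sum (nevanlinna_kernel M (p i) (p j) - of_real c)) Z" if ij: "i < n" "j < n" for i j
  proof -
    note hs = ser[OF p(1)[OF ij(1)]]
    have hs': "((\<lambda>l. - cnj (of_real (w l) * ((p j - t) / ((of_real l - of_real t) * (of_real l - p j)))))
        has_sum - cnj (G (p j))) Z"
      using ser[OF p(1)[OF ij(2)]] unfolding has_sum_uminus minus_minus has_sum_cnj_iff .
    have d: "p i - cnj (p j) \<noteq> 0" using p(2)[OF ij] by simp
    have s1: "((\<lambda>l. (of_real (w l) * ((p i - t) / ((of_real l - of_real t) * (of_real l - p i)))
          + - cnj (of_real (w l) * ((p j - t) / ((of_real l - of_real t) * (of_real l - p j))))) * (1 / (p i - cnj (p j))))
      has_sum ((G (p i) + - cnj (G (p j))) * (1 / (p i - cnj (p j))))) Z"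
      by (intro has_sum_cmult_left has_sum_add hs hs')
    have s2: "(G (p i) + - cnj (G (p j))) * (1 / (p i - cnj (p j)))
        = nevanlinna_kernel M (p i) (p j) - of_real c"
    proof -
      have "M (p i) - cnj (M (p j)) = (G (p i) - cnj (G (p j))) + of_real c * (p i - cnj (p j))"
        by (simp add: M p ij algebra_simps)
      then show ?thesis using d by (simp add: nevanlinna_kernel_def add_divide_distrib)
    qed
    have s3: "(of_real (w l) * ((p i - t) / ((of_real l - of_real t) * (of_real l - p i)))
          + - cnj (of_real (w l) * ((p j - t) / ((of_real l - of_real t) * (of_real l - p j))))) * (1 / (p i - cnj (p j)))
        = of_real (w l) * (1 / ((of_real l - p i) * cnj (of_real l - p j)))" if l: "l \<in> Z" for l
    proof -
      have nz: "of_real l - p i \<noteq> 0" "of_real l - cnj (p j) \<noteq> 0" "complex_of_real l - of_real t \<noteq> 0"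
        using p(1)[OF ij(1)] p(1)[OF ij(2)] w[OF l] by (metis Reals_of_real eq_iff_diff_eq_0,
           metis Reals_of_real eq_iff_diff_eq_0 complex_cnj_cnj complex_cnj_complex_of_real, simp)
      have pf: "(z - t) / ((of_real l - of_real t) * (of_real l - z)) = 1 / (of_real l - z) - 1 / (of_real l - of_real t)"
        if "of_real l - z \<noteq> 0" for z :: complex
        using that nz(3) by (simp add: field_simps)
      have "1 / (of_real l - p i) - 1 / (of_real l - cnj (p j))
          = (p i - cnj (p j)) / ((of_real l - p i) * (of_real l - cnj (p j)))"
        using nz by (simp add: field_simps)
      moreover have "cnj (of_real (w l) * ((p j - t) / ((of_real l - of_real t) * (of_real l - p j))))
          = of_real (w l) * (1 / (of_real l - cnj (p j)) - 1 / (of_real l - of_real t))"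
        unfolding pf[OF nz(2), symmetric] by simp
      ultimately show ?thesis using d unfolding pf[OF nz(1)]
        by (simp only: add_uminus_conv_diff right_diff_distrib[symmetric]) simp
    qed
    show ?thesis by (rule has_sum_cong[THEN iffD1, rotated, OF s1[unfolded s2]]) (rule s3)
  qed
  define F where "F = (\<lambda>l. \<Sum>i<n. \<Sum>j<n. cnj (x i) * x j *
      (of_real (w l) * (1 / ((of_real l - p i) * cnj (of_real l - p j)))))"
  have "(F has_sum (\<Sum>i<n. \<Sum>j<n. cnj (x i) * x j * (nevanlinna_kernel M (p i) (p j) - of_real c))) Z"
    unfolding F_def by (intro has_sum_sum has_sum_cmult_right K) simp_all
  then have hs: "((\<lambda>l. Re (F l)) has_sum
      Re (\<Sum>i<n. \<Sum>j<n. cnj (x i) * x j * (nevanlinna_kernel M (p i) (p j) - of_real c))) Z"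
    by (rule has_sum_Re)
  have sq: "(\<Sum>i<n. \<Sum>j<n. cnj (x i) * x j * (f i * cnj (f j))) = of_real ((cmod (\<Sum>i<n. cnj (x i) * f i))\<^sup>2)" for f
    unfolding complex_norm_square cnj_sum sum_product by (simp add: mult_ac)
  have "0 \<le> Re (F l)" if "l \<in> Z" for l
  proof -
    have "F l = (\<Sum>i<n. \<Sum>j<n. of_real (w l) * (cnj (x i) * x j *
       ((1 / (of_real l - p i)) * cnj (1 / (of_real l - p j)))))"
      unfolding F_def by (intro sum.cong refl) simp
    also have "\<dots> = of_real (w l) * of_real ((cmod (\<Sum>i<n. cnj (x i) * (1 / (of_real l - p i))))\<^sup>2)"
      unfolding sum_distrib_left[symmetric] sq ..
    finally show ?thesis using w[OF that] by simp
  qed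
  from has_sum_nonneg[OF hs this] have
    "0 \<le> Re (\<Sum>i<n. \<Sum>j<n. cnj (x i) * x j * (nevanlinna_kernel M (p i) (p j) - of_real c))" by simp
  also have "(\<Sum>i<n. \<Sum>j<n. cnj (x i) * x j * (nevanlinna_kernel M (p i) (p j) - of_real c))
     = cinner n x (mvec n (\<lambda>i j. nevanlinna_kernel M (p i) (p j)) x)
        - of_real c * (\<Sum>i<n. \<Sum>j<n. cnj (x i) * x j * (1 * cnj 1))"
    unfolding cinner_mvec_eq by (simp add: right_diff_distrib sum_subtractf sum_distrib_left mult_ac)
  also have "(\<Sum>i<n. \<Sum>j<n. cnj (x i) * x j * (1 * cnj 1)) = of_real ((cmod (\<Sum>i<n. cnj (x i) * 1))\<^sup>2)"
    by (rule sq)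
  finally have "c * (cmod (\<Sum>i<n. cnj (x i) * 1))\<^sup>2
      \<le> Re (cinner n x (mvec n (\<lambda>i j. nevanlinna_kernel M (p i) (p j)) x))" by simp
  moreover have "0 \<le> c * (cmod (\<Sum>i<n. cnj (x i) * 1))\<^sup>2" using c by simp
  ultimately show ?thesis by linarith
qed

text \<open>
  With \<open>s = z - t\<close>, the kernel of \<open>M\<close> is the kernel of \<open>M1\<close> multiplied by \<open>s\<^sup>k\<close> and the conjugate of
  \<open>s\<^sup>k\<close>, plus terms that contain the quotient of \<open>s(z)\<^sup>k - cnj s(\<zeta>)\<^sup>k\<close> by \<open>z - cnj \<zeta>\<close>. This quotient is a
  polynomial of degree below \<open>k\<close> in each variable, so its terms vanish on the vectors that are orthogonal
  to the powers of \<open>s\<close> with exponents below \<open>k\<close>.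
\<close>
lemma num_neg_kernel_power_mult_le:
  fixes t :: real
  assumes psd: "\<And>x. 0 \<le> Re (cinner n x (mvec n (\<lambda>i j. nevanlinna_kernel M1 (p i) (p j)) x))"
    and M: "\<And>i. i < n \<Longrightarrow> M (p i) = (p i - t) ^ (2 * k) * M1 (p i)"
    and p: "\<And>i j. i < n \<Longrightarrow> j < n \<Longrightarrow> p i \<noteq> cnj (p j)"
  shows "num_neg_eigenvalues (Matrix.mat n n (\<lambda>(i, j). nevanlinna_kernel M (p i) (p j))) \<le> k"
proof (rule num_neg_eigenvalues_le[OF hermitian_nevanlinna_kernel])
  define s where "s = (\<lambda>i. p i - of_real t)"
  fix x assume x: "\<And>m. m < k \<Longrightarrow> (\<Sum>i<n. cnj (s i) ^ m * x i) = 0"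
  have x': "(\<Sum>i<n. s i ^ m * cnj (x i)) = 0" if "m < k" for m
    using arg_cong[OF x[OF that], of cnj] by simp
  have K: "nevanlinna_kernel M (p i) (p j) =
      s i ^ k * cnj (s j) ^ k * nevanlinna_kernel M1 (p i) (p j)
      + (\<Sum>m<k. s i ^ k * M1 (p i) * s i ^ (k - Suc m) * cnj (s j) ^ m)
      + (\<Sum>m<k. cnj (s j) ^ k * cnj (M1 (p j)) * cnj (s j) ^ m * s i ^ (k - Suc m))" if ij: "i < n" "j < n" for i j
  proof -
    have d: "p i - cnj (p j) \<noteq> 0" using p[OF ij] by simp
    have d': "s i - cnj (s j) = p i - cnj (p j)" by (simp add: s_def)
    \<comment> \<open>The factor that makes the last two sums polynomials of degree below \<open>k\<close> in each variable.\<close>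
    have pw: "s i ^ k - cnj (s j) ^ k = (p i - cnj (p j)) * (\<Sum>m<k. s i ^ (k - Suc m) * cnj (s j) ^ m)"
      unfolding d'[symmetric] using power_diff_sumr2[of "cnj (s j)" k "s i"]
      by (simp add: algebra_simps)
    have "M (p i) - cnj (M (p j)) = s i ^ k * cnj (s j) ^ k * (M1 (p i) - cnj (M1 (p j)))
       + s i ^ k * M1 (p i) * (s i ^ k - cnj (s j) ^ k) + cnj (s j) ^ k * cnj (M1 (p j)) * (s i ^ k - cnj (s j) ^ k)"
      by (simp add: M ij s_def[symmetric] mult_2 power_add) (simp add: s_def algebra_simps power_add)
    then have "nevanlinna_kernel M (p i) (p j) = s i ^ k * cnj (s j) ^ k * nevanlinna_kernel M1 (p i) (p j)
       + s i ^ k * M1 (p i) * ((s i ^ k - cnj (s j) ^ k) / (p i - cnj (p j)))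
       + cnj (s j) ^ k * cnj (M1 (p j)) * ((s i ^ k - cnj (s j) ^ k) / (p i - cnj (p j)))"
      by (simp add: nevanlinna_kernel_def add_divide_distrib)
    also have "(s i ^ k - cnj (s j) ^ k) / (p i - cnj (p j)) = (\<Sum>m<k. s i ^ (k - Suc m) * cnj (s j) ^ m)"
      using d by (simp add: pw)
    finally show ?thesis by (simp add: sum_distrib_left mult_ac)
  qed
  have van1: "(\<Sum>i<n. \<Sum>j<n. cnj (x i) * x j * (\<Sum>m<k. f i m * cnj (s j) ^ m)) = 0" for f
  proof -
    have "(\<Sum>i<n. \<Sum>j<n. cnj (x i) * x j * (\<Sum>m<k. f i m * cnj (s j) ^ m))
       = (\<Sum>i<n. \<Sum>j<n. \<Sum>m<k. cnj (x i) * f i m * (cnj (s j) ^ m * x j))"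
      by (intro sum.cong refl) (simp add: sum_distrib_left mult_ac)
    also have "\<dots> = (\<Sum>i<n. \<Sum>m<k. \<Sum>j<n. cnj (x i) * f i m * (cnj (s j) ^ m * x j))"
      by (rule sum.cong[OF refl], rule sum.swap)
    also have "\<dots> = 0" unfolding sum_distrib_left[symmetric] by (simp add: x)
    finally show ?thesis .
  qed
  have van2: "(\<Sum>i<n. \<Sum>j<n. cnj (x i) * x j * (\<Sum>m<k. f j m * s i ^ (k - Suc m))) = 0" for f
  proof -
    have "(\<Sum>i<n. \<Sum>j<n. cnj (x i) * x j * (\<Sum>m<k. f j m * s i ^ (k - Suc m)))
       = (\<Sum>i<n. \<Sum>j<n. \<Sum>m<k. x j * f j m * (s i ^ (k - Suc m) * cnj (x i)))"
      by (intro sum.cong refl) (simp add: sum_distrib_left mult_ac)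
    also have "\<dots> = (\<Sum>j<n. \<Sum>i<n. \<Sum>m<k. x j * f j m * (s i ^ (k - Suc m) * cnj (x i)))"
      by (rule sum.swap)
    also have "\<dots> = (\<Sum>j<n. \<Sum>m<k. \<Sum>i<n. x j * f j m * (s i ^ (k - Suc m) * cnj (x i)))"
      by (rule sum.cong[OF refl], rule sum.swap)
    also have "\<dots> = 0" unfolding sum_distrib_left[symmetric] by (simp add: x')
    finally show ?thesis .
  qed
  have "cinner n x (mvec n (\<lambda>i j. nevanlinna_kernel M (p i) (p j)) x)
      = (\<Sum>i<n. \<Sum>j<n. cnj (x i) * x j * (s i ^ k * cnj (s j) ^ k * nevanlinna_kernel M1 (p i) (p j)))
      + (\<Sum>i<n. \<Sum>j<n. cnj (x i) * x j * (\<Sum>m<k. s i ^ k * M1 (p i) * s i ^ (k - Suc m) * cnj (s j) ^ m))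
      + (\<Sum>i<n. \<Sum>j<n. cnj (x i) * x j * (\<Sum>m<k. cnj (s j) ^ k * cnj (M1 (p j)) * cnj (s j) ^ m * s i ^ (k - Suc m)))"
    unfolding cinner_mvec_eq sum.distrib[symmetric] distrib_left[symmetric]
    by (intro sum.cong refl) (simp add: K)
  also have "\<dots> = cinner n (\<lambda>i. cnj (s i) ^ k * x i)
      (mvec n (\<lambda>i j. nevanlinna_kernel M1 (p i) (p j)) (\<lambda>i. cnj (s i) ^ k * x i))"
    unfolding van1 van2 cinner_mvec_eq by (simp add: mult_ac)
  finally show "0 \<le> Re (cinner n x (mvec n (\<lambda>i j. nevanlinna_kernel M (p i) (p j)) x))"
    using psd by simp
qed

text \<open>
  The \<open>N\<close>-th roots of \<open>\<i>\<close>. They are used instead of roots of unity because none of them is real or the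
  conjugate of another one.
\<close>
definition ring_point :: "nat \<Rightarrow> nat \<Rightarrow> complex" where
  "ring_point N a = cis (pi * (1 + 4 * real a) / (2 * real N))"

lemma ring_point_power_N: "N > 0 \<Longrightarrow> ring_point N a ^ N = \<i>"
proof -
  assume "N > 0"
  then have "real N * (pi * (1 + 4 * real a) / (2 * real N)) = pi / 2 + 2 * pi * real a"
    by (simp add: field_simps)
  then have "ring_point N a ^ N = cis (pi / 2 + 2 * pi * real a)"
    by (simp only: ring_point_def Complex.DeMoivre)
  also have "\<dots> = cis (pi / 2) * cis (2 * pi * real a)" by (rule cis_mult[symmetric])
  also have "cis (2 * pi * real a) = 1" by (rule cis_multiple_2pi) simp
  finally show ?thesis by simp
qed

text \<open>
  The product of two \<open>N\<close>-th roots of \<open>\<i>\<close> has \<open>N\<close>-th power \<open>- 1\<close>, so it is not 1.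
\<close>
lemma ring_point_neq_cnj:
  assumes N: "N > 0"
  shows "ring_point N a \<noteq> cnj (ring_point N b)"
proof
  assume "ring_point N a = cnj (ring_point N b)"
  then have "ring_point N a * ring_point N b = cnj (ring_point N b) * ring_point N b" by simp
  also have "\<dots> = 1" by (simp add: ring_point_def cis_cnj cis_mult)
  finally have "ring_point N a ^ N * ring_point N b ^ N = 1" by (simp add: power_mult_distrib[symmetric])
  then show False by (simp add: ring_point_power_N[OF N])
qed

lemma ring_point_nonreal: "N > 0 \<Longrightarrow> ring_point N a \<notin> \<real>"
  using ring_point_neq_cnj[of N a a] by (simp add: Reals_cnj_iff)

text \<open>
  Up to a constant phase this is the orthogonality relation of the discrete Fourier transform.
\<close>
lemma cinner_ring_point_powers:
  assumes "i < N" "j < N"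
  shows "cinner N (\<lambda>a. ring_point N a ^ i) (\<lambda>a. ring_point N a ^ j) = (if i = j then of_nat N else 0)"
proof -
  define d where "d = real j - real i"
  define r where "r = cis (2 * pi * d / real N)"
  have N: "N > 0" using assms by simp
  have trm: "cnj (ring_point N a ^ i) * ring_point N a ^ j = cis (pi * d / (2 * real N)) * r ^ a" for a
  proof -
    have "cnj (ring_point N a ^ i) * ring_point N a ^ j
        = cis (- (real i * (pi * (1 + 4 * real a) / (2 * real N)))
            + real j * (pi * (1 + 4 * real a) / (2 * real N)))"
      by (simp only: ring_point_def Complex.DeMoivre cis_cnj cis_mult)
    also have "- (real i * (pi * (1 + 4 * real a) / (2 * real N)))
            + real j * (pi * (1 + 4 * real a) / (2 * real N))
         = pi * d / (2 * real N) + real a * (2 * pi * d / real N)"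
      using N by (simp add: d_def field_simps)
    also have "cis \<dots> = cis (pi * d / (2 * real N)) * r ^ a"
      by (simp only: r_def Complex.DeMoivre cis_mult)
    finally show ?thesis .
  qed
  show ?thesis
  proof (cases "i = j")
    case True
    then show ?thesis unfolding cinner_def trm by (simp add: r_def d_def)
  next
    case False
    have "r \<noteq> 1"
    proof
      assume "r = 1"
      then have "cos (2 * pi * d / real N) = 1" unfolding r_def by (metis cis.simps(1) one_complex.simps(1))
      then obtain m :: int where "2 * pi * d / real N = of_int m * 2 * pi"
        unfolding cos_one_2pi_int by blast
      then have "d = real N * of_int m" using N by (simp add: field_simps)
      then have "real_of_int (int j - int i) = of_int (int N * m)" by (simp add: d_def)
      then have e: "int j - int i = int N * m" by linarith
      then have "int N dvd int j - int i" by simp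
      moreover have "\<bar>int j - int i\<bar> < int N" "int j - int i \<noteq> 0" using assms False by auto
      ultimately show False using dvd_imp_le_int[of "int j - int i" "int N"] by simp
    qed
    moreover have "r ^ N = 1"
    proof -
      have "r ^ N = cis (2 * pi * d)" using N by (simp add: r_def Complex.DeMoivre)
      also have "\<dots> = 1" by (rule cis_multiple_2pi) (simp add: d_def)
      finally show ?thesis .
    qed
    ultimately have "(\<Sum>a<N. r ^ a) = 0" by (simp add: geometric_sum)
    then show ?thesis unfolding cinner_def trm sum_distrib_left[symmetric] using False by simp
  qed
qed

lemma cmod_cinner_mvec_le:
  "cmod (cinner n x (mvec n a x)) \<le> (\<Sum>i<n. \<Sum>j<n. cmod (a i j)) * (\<Sum>l<n. (cmod (x l))\<^sup>2)"
proof -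
  have le: "cmod (x i) * cmod (x j) \<le> (\<Sum>l<n. (cmod (x l))\<^sup>2)" if "i < n" "j < n" for i j
  proof -
    have m: "(cmod (x l))\<^sup>2 \<le> (\<Sum>l<n. (cmod (x l))\<^sup>2)" if "l < n" for l
      using that by (intro member_le_sum) auto
    have "2 * (cmod (x i) * cmod (x j)) \<le> (cmod (x i))\<^sup>2 + (cmod (x j))\<^sup>2"
      using sum_squares_bound[of "cmod (x i)" "cmod (x j)"] by (simp add: mult.assoc)
    then show ?thesis using m[OF that(1)] m[OF that(2)] by linarith
  qed
  have "cmod (cinner n x (mvec n a x)) \<le> (\<Sum>i<n. \<Sum>j<n. cmod (cnj (x i) * x j * a i j))"
    unfolding cinner_mvec_eq by (intro order_trans[OF norm_sum] sum_mono) simp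
  also have "\<dots> \<le> (\<Sum>i<n. \<Sum>j<n. cmod (a i j) * (\<Sum>l<n. (cmod (x l))\<^sup>2))"
  proof (intro sum_mono)
    fix i j assume "i \<in> {..<n}" "j \<in> {..<n}"
    then show "cmod (cnj (x i) * x j * a i j) \<le> cmod (a i j) * (\<Sum>l<n. (cmod (x l))\<^sup>2)"
      using mult_left_mono[OF le[of i j] norm_ge_zero[of "a i j"]] by (simp add: norm_mult mult_ac)
  qed
  finally show ?thesis by (simp add: sum_distrib_right)
qed

text \<open>
  Write \<open>s\<close> for the vector of differences to \<open>t\<close> and \<open>e m\<close> for its \<open>m\<close>-th power on the \<open>N = 2k + 1\<close> ring points.
  The kernel matrix of \<open>s\<^sup>N\<close> is \<open>E = \<Sum> e m \<otimes> e (2k - m)\<close>. The \<open>e m\<close> are orthogonal of squared norm \<open>N\<close>, so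
  \<open>E\<close> maps \<open>e m\<close> to \<open>N\<close> times \<open>e (2k - m)\<close>, and the \<open>k\<close> differences \<open>e m - e (2k - m)\<close>, \<open>m < k\<close>, are
  eigenvectors for \<open>- N\<close>. On their span \<open>c E\<close> outweighs the remaining part of the kernel if \<open>c\<close> is large.
\<close>
lemma num_neg_kernel_power_mult_ge:
  fixes t :: real and G :: "complex \<Rightarrow> complex" and k :: nat
  defines "N \<equiv> 2 * k + 1"
  defines "p \<equiv> \<lambda>a. of_real t + ring_point N a"
  shows "\<exists>c0. \<forall>c>c0. \<forall>M. (\<forall>i<N. M (p i) = (p i - t) ^ (2 * k) * (of_real c * (p i - t) + G (p i))) \<longrightarrow>
           k \<le> num_neg_eigenvalues (Matrix.mat N N (\<lambda>(i, j). nevanlinna_kernel M (p i) (p j)))"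
proof -
  define s where "s = ring_point N"
  define L where "L = nevanlinna_kernel (\<lambda>z. (z - t) ^ (2 * k) * G z)"
  define C where "C = (\<Sum>i<N. \<Sum>j<N. cmod (L (p i) (p j)))"
  have N: "N > 0" by (simp add: N_def)
  show ?thesis
  proof (intro exI[of _ "C / real N"] allI impI)
    fix c :: real and M assume c: "C / real N < c"
      and M: "\<forall>i<N. M (p i) = (p i - t) ^ (2 * k) * (of_real c * (p i - t) + G (p i))"
    define E where "E = (\<lambda>i j. \<Sum>m<N. s i ^ m * cnj (s j ^ (2 * k - m)))"
    have K: "nevanlinna_kernel M (p i) (p j) = of_real c * E i j + L (p i) (p j)"
      if ij: "i < N" "j < N" for i j
    proof -
      have d: "s i - cnj (s j) \<noteq> 0" unfolding s_def using ring_point_neq_cnj[OF N, of i j] by simp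
      have d': "p i - cnj (p j) = s i - cnj (s j)" by (simp add: p_def s_def)
      have "s i ^ N - cnj (s j) ^ N = (s i - cnj (s j)) * E i j"
        unfolding power_diff_sumr2[of "s i" N "cnj (s j)"] E_def
        by (simp add: N_def mult.commute)
      then have E: "(s i ^ N - cnj (s j) ^ N) / (s i - cnj (s j)) = E i j" using d by simp
      have "M (p i) - cnj (M (p j)) = of_real c * (s i ^ N - cnj (s j) ^ N)
          + ((p i - t) ^ (2 * k) * G (p i) - cnj ((p j - t) ^ (2 * k) * G (p j)))"
        using M ij by (simp add: N_def p_def s_def algebra_simps)
      then show ?thesis
        by (simp add: nevanlinna_kernel_def L_def d' add_divide_distrib E[symmetric])
    qed
    define e where "e = (\<lambda>m a. s a ^ m)"
    have orth: "cinner N (e i) (e j) = (if i = j then of_nat N else 0)" if "i < N" "j < N" for i j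
      unfolding e_def s_def by (rule cinner_ring_point_powers[OF that])
    have Ee: "mvec N E (e j) i = of_nat N * e (2 * k - j) i" if j: "j < N" for i j
    proof -
      have "mvec N E (e j) i = (\<Sum>m<N. s i ^ m * cinner N (e (2 * k - m)) (e j))"
        unfolding mvec_def E_def cinner_def sum_distrib_right sum_distrib_left
        by (subst sum.swap) (simp add: e_def mult_ac)
      also have "\<dots> = (\<Sum>m<N. if m = 2 * k - j then of_nat N * e (2 * k - j) i else 0)"
      proof (intro sum.cong refl)
        fix m assume "m \<in> {..<N}"
        then have m: "2 * k - m < N" "m = 2 * k - j \<longleftrightarrow> 2 * k - m = j" using j by (auto simp: N_def)
        show "s i ^ m * cinner N (e (2 * k - m)) (e j) = (if m = 2 * k - j then of_nat N * e (2 * k - j) i else 0)"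
          unfolding orth[OF m(1) j] m(2)[symmetric] by (simp add: e_def)
      qed
      also have "\<dots> = of_nat N * e (2 * k - j) i" by (simp add: sum.delta) (simp add: N_def)
      finally show ?thesis .
    qed
    define v where "v = (\<lambda>m a. e m a - e (2 * k - m) a)"
    have Ev: "mvec N E (v m) i = - of_nat N * v m i" if "m < k" for m i
    proof -
      have "mvec N E (v m) i = mvec N E (e m) i - mvec N E (e (2 * k - m)) i"
        by (simp add: mvec_def v_def right_diff_distrib sum_subtractf)
      moreover have "m < N" "2 * k - m < N" "2 * k - (2 * k - m) = m" using that by (auto simp: N_def)
      ultimately show ?thesis by (simp add: Ee v_def algebra_simps)
    qed
    show "k \<le> num_neg_eigenvalues (Matrix.mat N N (\<lambda>(i, j). nevanlinna_kernel M (p i) (p j)))"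
    proof (rule num_neg_eigenvalues_ge[OF hermitian_nevanlinna_kernel])
      fix y :: "nat \<Rightarrow> complex" assume y: "\<exists>m<k. y m \<noteq> 0"
      define x where "x = (\<lambda>i. \<Sum>m<k. y m * v m i)"
      define X where "X = (\<Sum>l<N. (cmod (x l))\<^sup>2)"
      have "X > 0"
      proof -
        obtain m where m: "m < k" "y m \<noteq> 0" using y by blast
        have "cinner N (e m) x = (\<Sum>l<k. y l * cinner N (e m) (v l))"
          unfolding x_def by (rule cinner_sum)
        also have "\<dots> = (\<Sum>l<k. if l = m then y m * of_nat N else 0)"
        proof (intro sum.cong refl)
          fix l assume l: "l \<in> {..<k}"
          have "cinner N (e m) (v l) = cinner N (e m) (e l) - cinner N (e m) (e (2 * k - l))"
            by (simp add: cinner_def v_def right_diff_distrib sum_subtractf)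
          then show "y l * cinner N (e m) (v l) = (if l = m then y m * of_nat N else 0)"
            using l m orth[of m l] orth[of m "2 * k - l"] by (auto simp: N_def simp del: of_nat_Suc)
        qed
        also have "\<dots> = y m * of_nat N" using m by (simp add: sum.delta)
        finally have "cinner N (e m) x \<noteq> 0" using m N by simp
        then have "\<exists>l<N. x l \<noteq> 0" unfolding cinner_def by (metis (no_types, lifting) lessThan_iff mult_zero_right sum.neutral)
        then obtain l where "l < N" "x l \<noteq> 0" by blast
        then have "0 < (cmod (x l))\<^sup>2" "(cmod (x l))\<^sup>2 \<le> X"
          unfolding X_def by (auto intro: member_le_sum)
        then show ?thesis by linarith
      qed
      have Ex: "mvec N E x = (\<lambda>i. - of_nat N * x i)"
        unfolding x_def mvec_sum[abs_def] sum_distrib_left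
        by (intro ext sum.cong refl) (simp add: Ev)
      have "cinner N x (mvec N (\<lambda>i j. nevanlinna_kernel M (p i) (p j)) x)
          = of_real c * cinner N x (mvec N E x) + cinner N x (mvec N (\<lambda>i j. L (p i) (p j)) x)"
        unfolding cinner_mvec_eq sum_distrib_left sum.distrib[symmetric]
        by (intro sum.cong refl) (simp add: K algebra_simps)
      also have "cinner N x (mvec N E x) = - of_nat N * of_real X"
        unfolding Ex cinner_scale cinner_self X_def ..
      finally have "Re (cinner N x (mvec N (\<lambda>i j. nevanlinna_kernel M (p i) (p j)) x))
          = - (c * real N * X) + Re (cinner N x (mvec N (\<lambda>i j. L (p i) (p j)) x))" by simp
      also have "\<dots> \<le> - (c * real N * X) + C * X"
        using cmod_cinner_mvec_le[of N x "\<lambda>i j. L (p i) (p j)"]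
          complex_Re_le_cmod[of "cinner N x (mvec N (\<lambda>i j. L (p i) (p j)) x)"]
        unfolding C_def X_def by linarith
      also have "\<dots> < 0"
      proof -
        have "C < c * real N" using c N by (simp add: field_simps)
        then show ?thesis using \<open>X > 0\<close> by simp
      qed
      finally show "Re (cinner N (\<lambda>i. \<Sum>m<k. y m * v m i)
        (mvec N (\<lambda>i j. nevanlinna_kernel M (p i) (p j)) (\<lambda>i. \<Sum>m<k. y m * v m i))) < 0"
        unfolding x_def .
    qed
  qed
qed

text \<open>
  The upper bound for the number of negative squares holds for all \<open>c \<ge> 0\<close>, at all points; the threshold
  comes from the lower bound, which is needed at one family of points only.
\<close>
lemma gen_nevanlinna_inf_of_herglotz_series:
  fixes t :: real and G :: "complex \<Rightarrow> complex" and k :: nat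
  assumes ser: "\<And>z :: complex. z \<notin> \<real> \<Longrightarrow>
      ((\<lambda>l. of_real (w l) * ((z - t) / ((of_real l - of_real t) * (of_real l - z)))) has_sum G z) Z"
    and w: "\<And>l. l \<in> Z \<Longrightarrow> 0 \<le> w l \<and> l \<noteq> t"
    and G: "G holomorphic_on - \<real>"
  shows "\<exists>c0. \<forall>c>c0. \<forall>M. (\<forall>z\<in>- (\<real> :: complex set). M z = (z - t) ^ (2 * k) * (of_real c * (z - t) + G z)) \<longrightarrow>
           M \<in> gen_nevanlinna_inf k"
proof -
  define N where "N = 2 * k + 1"
  define p where "p = (\<lambda>a. of_real t + ring_point N a)"
  have "\<exists>c0. \<forall>c>c0. \<forall>M. (\<forall>i<N. M (p i) = (p i - t) ^ (2 * k) * (of_real c * (p i - t) + G (p i))) \<longrightarrow>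
           k \<le> num_neg_eigenvalues (Matrix.mat N N (\<lambda>(i, j). nevanlinna_kernel M (p i) (p j)))"
    unfolding N_def p_def by (rule num_neg_kernel_power_mult_ge)
  then obtain c0 where c0: "\<forall>c>c0. \<forall>M. (\<forall>i<N. M (p i) = (p i - t) ^ (2 * k) * (of_real c * (p i - t) + G (p i))) \<longrightarrow>
           k \<le> num_neg_eigenvalues (Matrix.mat N N (\<lambda>(i, j). nevanlinna_kernel M (p i) (p j)))"
    by (elim exE)
  have N: "N > 0" by (simp add: N_def)
  have p1: "p i \<notin> \<real>" for i using ring_point_nonreal[OF N, of i] by (simp add: p_def complex_is_Real_iff)
  have p2: "p i \<noteq> cnj (p j)" for i j using ring_point_neq_cnj[OF N, of i j] by (simp add: p_def)
  have op: "open (- \<real> :: complex set)" by (simp add: open_Compl closed_complex_Reals)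
  have cnjG: "G (cnj z) = cnj (G z)" if z: "z \<notin> \<real>" for z
  proof -
    have cz: "cnj z \<notin> \<real>" using z by (simp add: complex_is_Real_iff)
    have "((\<lambda>l. cnj (of_real (w l) * ((z - t) / ((of_real l - of_real t) * (of_real l - z))))) has_sum cnj (G z)) Z"
      unfolding has_sum_cnj_iff by (rule ser[OF z])
    then have "((\<lambda>l. of_real (w l) * ((cnj z - t) / ((of_real l - of_real t) * (of_real l - cnj z)))) has_sum cnj (G z)) Z"
      by simp
    with ser[OF cz] show ?thesis by (simp add: has_sum_unique)
  qed
  have mero: "F nicely_meromorphic_on - \<real>" and nopole: "z \<notin> \<real> \<Longrightarrow> \<not> is_pole F z"
    and symm: "\<forall>z\<in>- (\<real> :: complex set). F (cnj z) = cnj (F z)"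
    if F: "\<forall>z\<in>- (\<real> :: complex set). F z = (z - t) ^ (2 * m) * (of_real c * (z - t) + G z)" for F m c z
  proof -
    have "(\<lambda>z. (z - t) ^ (2 * m) * (of_real c * (z - t) + G z)) holomorphic_on - \<real>"
      by (intro holomorphic_intros G)
    then have hol: "F holomorphic_on - \<real>" by (rule holomorphic_transform) (use F in simp)
    then have an: "F analytic_on - \<real>" using op by (simp add: analytic_on_open)
    then show "F nicely_meromorphic_on - \<real>" by (rule analytic_on_imp_nicely_meromorphic_on)
    show "\<not> is_pole F z" if "z \<notin> \<real>"
      by (rule not_is_pole_holomorphic[OF op _ hol]) (use that in simp)
    show "\<forall>z\<in>- (\<real> :: complex set). F (cnj z) = cnj (F z)"
    proof
      fix z :: complex assume z: "z \<in> - \<real>"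
      then have "cnj z \<in> - \<real>" by (simp add: complex_is_Real_iff)
      then show "F (cnj z) = cnj (F z)" using F z by (simp add: cnjG)
    qed
  qed
  show ?thesis
  proof (intro exI[of _ "max c0 0"] allI impI)
    fix c :: real and M assume c: "max c0 0 < c"
      and M: "\<forall>z\<in>- (\<real> :: complex set). M z = (z - t) ^ (2 * k) * (of_real c * (z - t) + G z)"
    define M1 where "M1 = (\<lambda>z :: complex. of_real c * (z - t) + G z)"
    have M1: "\<forall>z\<in>- (\<real> :: complex set). M1 z = (z - t) ^ (2 * 0) * (of_real c * (z - t) + G z)" by (simp add: M1_def)
    have le: "num_neg_eigenvalues (Matrix.mat n n (\<lambda>(i, j). nevanlinna_kernel F (q i) (q j))) \<le> m"
      if F: "\<forall>z\<in>- (\<real> :: complex set). F z = (z - t) ^ (2 * m) * (of_real c * (z - t) + G z)"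
        and q: "\<And>i. i < n \<Longrightarrow> q i \<notin> \<real>" "\<And>i j. i < n \<Longrightarrow> j < n \<Longrightarrow> q i \<noteq> cnj (q j)" for F m n q
    proof (rule num_neg_kernel_power_mult_le)
      show "0 \<le> Re (cinner n x (mvec n (\<lambda>i j. nevanlinna_kernel M1 (q i) (q j)) x))" for x
        by (rule herglotz_series_kernel_nonneg[where c = c and M = M1, OF ser w _ _ q])
           (use c in \<open>auto simp: M1_def\<close>)
      show "F (q i) = (q i - t) ^ (2 * m) * M1 (q i)" if "i < n" for i
        using F q(1)[OF that] by (simp add: M1_def)
    qed (rule q(2))
    have M1': "M1 \<in> gen_nevanlinna 0"
      unfolding gen_nevanlinna_def mem_Collect_eq
    proof (intro conjI mero[OF M1] symm[OF M1])
      show "has_neg_squares (nevanlinna_kernel M1) {z. z \<notin> \<real> \<and> \<not> is_pole M1 z} 0"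
        unfolding has_neg_squares_def Let_def
      proof (intro conjI allI impI)
        fix n :: nat and q :: "nat \<Rightarrow> complex"
        assume "(\<forall>i<n. q i \<in> {z. z \<notin> \<real> \<and> \<not> is_pole M1 z}) \<and> (\<forall>i<n. \<forall>j<n. q i \<noteq> cnj (q j))"
        then show "num_neg_eigenvalues (Matrix.mat n n (\<lambda>(i, j). nevanlinna_kernel M1 (q i) (q j))) \<le> 0"
          by (intro le[OF M1]) auto
      next
        from le[OF M1, of 0] show "\<exists>n q. ((\<forall>i<n. q i \<in> {z. z \<notin> \<real> \<and> \<not> is_pole M1 z}) \<and> (\<forall>i<n. \<forall>j<n. q i \<noteq> cnj (q j)))
            \<and> num_neg_eigenvalues (Matrix.mat n n (\<lambda>(i, j). nevanlinna_kernel M1 (q i) (q j))) = 0"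
          by (intro exI[of _ 0]) simp
      qed
    qed
    have "M \<in> gen_nevanlinna k"
      unfolding gen_nevanlinna_def mem_Collect_eq
    proof (intro conjI mero[OF M] symm[OF M])
      show "has_neg_squares (nevanlinna_kernel M) {z. z \<notin> \<real> \<and> \<not> is_pole M z} k"
        unfolding has_neg_squares_def Let_def
      proof (intro conjI allI impI)
        fix n :: nat and q :: "nat \<Rightarrow> complex"
        assume "(\<forall>i<n. q i \<in> {z. z \<notin> \<real> \<and> \<not> is_pole M z}) \<and> (\<forall>i<n. \<forall>j<n. q i \<noteq> cnj (q j))"
        then show "num_neg_eigenvalues (Matrix.mat n n (\<lambda>(i, j). nevanlinna_kernel M (q i) (q j))) \<le> k"
          by (intro le[OF M]) auto
      next
        have "k \<le> num_neg_eigenvalues (Matrix.mat N N (\<lambda>(i, j). nevanlinna_kernel M (p i) (p j)))"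
          by (rule c0[rule_format]) (use c M p1 in auto)
        moreover have "num_neg_eigenvalues (Matrix.mat N N (\<lambda>(i, j). nevanlinna_kernel M (p i) (p j))) \<le> k"
          by (rule le[OF M p1 p2])
        ultimately show "\<exists>n q. ((\<forall>i<n. q i \<in> {z. z \<notin> \<real> \<and> \<not> is_pole M z}) \<and> (\<forall>i<n. \<forall>j<n. q i \<noteq> cnj (q j)))
            \<and> num_neg_eigenvalues (Matrix.mat n n (\<lambda>(i, j). nevanlinna_kernel M (q i) (q j))) = k"
          using p1 p2 nopole[OF M] by (intro exI[of _ N] exI[of _ p]) simp
      qed
    qed
    moreover have "M z = (\<Prod>j = 1..k. (z - of_real t) * (z - cnj (of_real t))) * M1 z" if "z \<in> - \<real>" for z
      using M that by (simp add: M1_def power_mult power2_eq_square)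
    ultimately show "M \<in> gen_nevanlinna_inf k"
      unfolding gen_nevanlinna_inf_def mem_Collect_eq using M1'
      by (intro conjI exI[of _ "\<lambda>_. of_real t"] bexI[of _ M1] ballI)
  qed
qed

section \<open>Interpolation by entire functions with prescribed residues\<close>

lemma deriv_real_on_reals:
  assumes f: "f holomorphic_on UNIV" and c: "\<And>z. f (cnj z) = cnj (f z)" and z: "z \<in> \<real>"
  shows "deriv f z \<in> \<real>"
proof -
  have d: "(f has_field_derivative deriv f z) (at z)" by (rule holomorphic_derivI[OF f open_UNIV UNIV_I])
  have cz: "cnj z = z" using z by (simp add: Reals_cnj_iff)
  have "((cnj \<circ> f \<circ> cnj) has_field_derivative cnj (deriv f z)) (at z)"
    using has_field_derivative_cnj_cnj[of f "deriv f z" z] d cz by simp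
  moreover have "cnj \<circ> f \<circ> cnj = f" by (rule ext) (simp add: c)
  ultimately have "cnj (deriv f z) = deriv f z" using DERIV_unique d by metis
  then show ?thesis by (simp add: Reals_cnj_iff)
qed

text \<open>
  At a zero of \<open>B\<close> the difference quotients of \<open>f\<close> and \<open>B\<close> extend holomorphically, and the extension of
  the second one does not vanish there.
\<close>
lemma entire_quotient_simple_zeros:
  assumes f: "f holomorphic_on UNIV" and B: "B holomorphic_on UNIV"
    and zero: "\<And>z. B z = 0 \<Longrightarrow> f z = 0 \<and> deriv B z \<noteq> 0"
  shows "(\<lambda>z. if B z = 0 then deriv f z / deriv B z else f z / B z) holomorphic_on UNIV" (is "?P holomorphic_on _")
proof -
  have "?P field_differentiable (at z0)" for z0
  proof (cases "B z0 = 0")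
    case False
    have op: "open {z. B z \<noteq> 0}"
      using holomorphic_on_imp_continuous_on[OF B] by (intro open_Collect_neq continuous_on_const)
    have "(\<lambda>z. f z / B z) holomorphic_on {z. B z \<noteq> 0}"
      by (intro holomorphic_intros holomorphic_on_subset[OF f] holomorphic_on_subset[OF B]) auto
    then have "?P holomorphic_on {z. B z \<noteq> 0}" by (rule holomorphic_transform) simp
    then show ?thesis using op False by (auto simp: holomorphic_on_open field_differentiable_def)
  next
    case True
    define f1 where "f1 = (\<lambda>z. if z = z0 then deriv f z0 else (f z - f z0) / (z - z0))"
    define B1 where "B1 = (\<lambda>z. if z = z0 then deriv B z0 else (B z - B z0) / (z - z0))"
    have f1: "f1 holomorphic_on UNIV" unfolding f1_def by (rule pole_lemma[OF f]) simp
    have B1: "B1 holomorphic_on UNIV" unfolding B1_def by (rule pole_lemma[OF B]) simp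
    have op: "open {z. B1 z \<noteq> 0}"
      using holomorphic_on_imp_continuous_on[OF B1] by (intro open_Collect_neq continuous_on_const)
    have z0: "z0 \<in> {z. B1 z \<noteq> 0}" using zero[OF True] by (simp add: B1_def)
    have "(\<lambda>z. f1 z / B1 z) holomorphic_on {z. B1 z \<noteq> 0}"
      by (intro holomorphic_intros holomorphic_on_subset[OF f1] holomorphic_on_subset[OF B1]) auto
    then have "?P holomorphic_on {z. B1 z \<noteq> 0}"
    proof (rule holomorphic_transform)
      fix z assume "z \<in> {z. B1 z \<noteq> 0}"
      then show "f1 z / B1 z = ?P z"
        using True zero[OF True] by (cases "z = z0") (auto simp: f1_def B1_def)
    qed
    then show ?thesis using op z0 by (auto simp: holomorphic_on_open field_differentiable_def)
  qed
  then show ?thesis by (simp add: holomorphic_on_def field_differentiable_at_within)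
qed

text \<open>
  In the application \<open>A\<close> and \<open>B\<close> are the coefficients of \<Phi>, and \<open>1 / \<rho> l\<close> is the squared norm of
  \<open>\<Phi>(l)\<close>. The assumption \<open>gap\<close> makes \<open>\<bar>l - t\<bar>\<close> comparable to \<open>1 + \<bar>l\<bar>\<close> on \<open>Z\<close>.
\<close>
locale real_simple_zeros =
  fixes A B :: "complex \<Rightarrow> complex" and Z :: "real set" and \<rho> :: "real \<Rightarrow> real" and t g :: real and k :: nat
  assumes A: "A holomorphic_on UNIV" and B: "B holomorphic_on UNIV"
    and A_cnj: "\<And>z. A (cnj z) = cnj (A z)" and B_cnj: "\<And>z. B (cnj z) = cnj (B z)"
    and B_zero: "\<And>z. B z = 0 \<longleftrightarrow> z \<in> complex_of_real ` Z"
    and \<rho>: "\<And>l. l \<in> Z \<Longrightarrow> 0 < \<rho> l"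
    and residue: "\<And>l. l \<in> Z \<Longrightarrow> deriv B (of_real l) * A (of_real l) = - of_real (1 / \<rho> l)"
    and g: "0 < g" and gap: "\<And>l. l \<in> Z \<Longrightarrow> g * (1 + \<bar>l\<bar>) \<le> \<bar>l - t\<bar>"
    and \<rho>_summable: "(\<lambda>l. \<rho> l / (1 + \<bar>l\<bar>) ^ (2 * k + 2)) summable_on Z"
begin

text \<open>
  For a zero \<open>l\<close> of \<open>B\<close> this is the entire function \<open>B z / (l - z)\<close>, with the removable singularity
  filled in.
\<close>
definition B_quot :: "real \<Rightarrow> complex \<Rightarrow> complex" where
  "B_quot l z = (if z = of_real l then - deriv B (of_real l) else B z / (of_real l - z))"

definition \<mu> :: "real \<Rightarrow> real" where "\<mu> l = \<rho> l / (l - t) ^ (2 * k + 1)"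

text \<open>
  With \<open>M\<close> the function to be constructed, \<open>S\<close> is \<open>B\<close> times the Mittag-Leffler series of
  \<open>M z / (z - t)^(2k + 1) - c\<close>. Working with the product avoids poles: the series converges locally
  uniformly on the whole plane.
\<close>
definition S :: "complex \<Rightarrow> complex" where "S z = (\<Sum>\<^sub>\<infinity>l\<in>Z. of_real (\<mu> l) * B_quot l z)"

lemma in_Z: "l \<in> Z \<Longrightarrow> B (of_real l) = 0" by (simp add: B_zero)

lemma Z_neq_t: "l \<in> Z \<Longrightarrow> l \<noteq> t"
proof
  assume l: "l \<in> Z" "l = t"
  have "0 < g * (1 + \<bar>l\<bar>)" using g by (intro mult_pos_pos) auto
  then show False using gap[OF l(1)] l(2) by simp
qed

lemma B_quot_holomorphic: "l \<in> Z \<Longrightarrow> B_quot l holomorphic_on X"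
proof -
  assume l: "l \<in> Z"
  have "(\<lambda>z. - (if z = of_real l then deriv B (of_real l) else (B z - B (of_real l)) / (z - of_real l))) holomorphic_on UNIV"
    by (intro holomorphic_on_minus pole_lemma[OF B]) simp
  then have "B_quot l holomorphic_on UNIV"
  proof (rule holomorphic_transform)
    fix z :: complex
    have "- (B z / (z - of_real l)) = B z / (of_real l - z)"
      by (metis minus_diff_eq minus_divide_right)
    then show "- (if z = of_real l then deriv B (of_real l) else (B z - B (of_real l)) / (z - of_real l)) = B_quot l z"
      by (simp add: B_quot_def in_Z[OF l])
  qed
  then show ?thesis by (rule holomorphic_on_subset) simp
qed

text \<open>
  If \<open>l\<close> is far from the disc, the denominator decides; otherwise the mean value inequality for \<open>B\<close> on a
  larger disc does.
\<close>
lemma B_quot_bound: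
  assumes R: "0 \<le> R"
  obtains K where "0 \<le> K" "\<And>l z. l \<in> Z \<Longrightarrow> cmod z \<le> R \<Longrightarrow> cmod (B_quot l z) \<le> K / (1 + \<bar>l\<bar>)"
proof -
  have bd: "\<exists>D. \<forall>z\<in>cball 0 (2 * R + 1). cmod (h z) \<le> D" if "h holomorphic_on UNIV" for h
  proof -
    have "continuous_on (cball 0 (2 * R + 1)) h"
      using holomorphic_on_imp_continuous_on[OF that] by (rule continuous_on_subset) simp
    then have "bounded (h ` cball 0 (2 * R + 1))"
      by (intro compact_imp_bounded compact_continuous_image compact_cball)
    then show ?thesis unfolding bounded_iff by blast
  qed
  obtain D1 where D1: "\<forall>z\<in>cball 0 (2 * R + 1). cmod (B z) \<le> D1" using bd[OF B] by (elim exE)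
  obtain D2 where D2: "\<forall>z\<in>cball 0 (2 * R + 1). cmod (deriv B z) \<le> D2"
    using bd[OF holomorphic_deriv[OF B open_UNIV]] by (elim exE)
  define D where "D = max D1 D2"
  have D: "cmod (B z) \<le> D" "cmod (deriv B z) \<le> D" if "cmod z \<le> 2 * R + 1" for z
    using D1 D2 that by (auto simp: D_def le_max_iff_disj)
  have D0: "0 \<le> D" using D(1)[of 0] R by (intro order_trans[OF norm_ge_zero]) auto
  have "cmod (B_quot l z) \<le> D * (2 * R + 2) / (1 + \<bar>l\<bar>)" if l: "l \<in> Z" and z: "cmod z \<le> R" for l z
  proof (cases "\<bar>l\<bar> \<ge> 2 * R + 1")
    case True
    have ne: "z \<noteq> of_real l" using z True R by auto
    have "\<bar>l\<bar> - cmod z \<le> cmod (of_real l - z)" using norm_triangle_ineq2[of "of_real l" z] by simp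
    then have far: "(1 + \<bar>l\<bar>) / 2 \<le> cmod (of_real l - z)" using True z by simp
    have "cmod (B_quot l z) = cmod (B z) / cmod (of_real l - z)" using ne by (simp add: B_quot_def norm_divide)
    also have "\<dots> \<le> D / ((1 + \<bar>l\<bar>) / 2)"
      using D(1)[of z] D0 z R far by (intro frac_le) auto
    also have "\<dots> = D * 2 / (1 + \<bar>l\<bar>)" by simp
    also have "\<dots> \<le> D * (2 * R + 2) / (1 + \<bar>l\<bar>)"
      using D0 R by (intro divide_right_mono mult_left_mono) auto
    finally show ?thesis .
  next
    case False
    have "cmod (B_quot l z) \<le> D"
    proof (cases "z = of_real l")
      case True
      then show ?thesis using D(2)[of z] z R by (simp add: B_quot_def)
    next
      case ne: False
      have "cmod (B z - B (of_real l)) \<le> D * cmod (z - of_real l)"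
      proof (rule field_differentiable_bound[OF convex_cball[of 0 "2 * R + 1"]])
        show "(B has_field_derivative deriv B w) (at w within cball 0 (2 * R + 1))" for w
          by (rule has_field_derivative_at_within[OF holomorphic_derivI[OF B open_UNIV UNIV_I]])
        show "cmod (deriv B w) \<le> D" if "w \<in> cball 0 (2 * R + 1)" for w using D(2)[of w] that by simp
      qed (use False z R in auto)
      then show ?thesis
        using ne in_Z[OF l] by (simp add: B_quot_def norm_divide pos_divide_le_eq norm_minus_commute)
    qed
    also have "D \<le> D * (2 * R + 2) / (1 + \<bar>l\<bar>)"
      using D0 False R by (simp add: pos_le_divide_eq mult_left_mono)
    finally show ?thesis .
  qed
  then show ?thesis using that[of "D * (2 * R + 2)"] D0 R by simp
qed

lemma \<mu>_summable: "(\<lambda>l. \<bar>\<mu> l\<bar> / (1 + \<bar>l\<bar>)) summable_on Z"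
proof (rule summable_on_comparison_test)
  show "(\<lambda>l. \<rho> l / (1 + \<bar>l\<bar>) ^ (2 * k + 2) * (1 / g ^ (2 * k + 1))) summable_on Z"
    by (rule summable_on_cmult_left[OF \<rho>_summable])
  fix l assume l: "l \<in> Z"
  have "(g * (1 + \<bar>l\<bar>)) ^ (2 * k + 1) \<le> \<bar>l - t\<bar> ^ (2 * k + 1)"
    using gap[OF l] g by (intro power_mono) auto
  then have "\<rho> l / \<bar>l - t\<bar> ^ (2 * k + 1) \<le> \<rho> l / (g * (1 + \<bar>l\<bar>)) ^ (2 * k + 1)"
    using \<rho>[OF l] g by (intro divide_left_mono mult_pos_pos zero_less_power) (auto simp: Z_neq_t[OF l])
  then have "\<rho> l / \<bar>l - t\<bar> ^ (2 * k + 1) / (1 + \<bar>l\<bar>) \<le> \<rho> l / (g * (1 + \<bar>l\<bar>)) ^ (2 * k + 1) / (1 + \<bar>l\<bar>)"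
    by (rule divide_right_mono) simp
  also have "\<dots> = \<rho> l / (1 + \<bar>l\<bar>) ^ (2 * k + 2) * (1 / g ^ (2 * k + 1))"
    by (simp add: power_mult_distrib)
  finally show "\<bar>\<mu> l\<bar> / (1 + \<bar>l\<bar>) \<le> \<rho> l / (1 + \<bar>l\<bar>) ^ (2 * k + 2) * (1 / g ^ (2 * k + 1))"
    using \<rho>[OF l] by (simp add: \<mu>_def abs_divide power_abs[symmetric] abs_mult)
qed simp

lemma S_uniform_limit:
  assumes R: "0 \<le> R"
  shows "uniform_limit (cball 0 R) (\<lambda>X z. \<Sum>l\<in>X. of_real (\<mu> l) * B_quot l z) S (finite_subsets_at_top Z)"
proof -
  obtain K where K: "0 \<le> K" "\<And>l z. l \<in> Z \<Longrightarrow> cmod z \<le> R \<Longrightarrow> cmod (B_quot l z) \<le> K / (1 + \<bar>l\<bar>)"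
    using B_quot_bound[OF R] by metis
  show ?thesis unfolding S_def
  proof (rule Weierstrass_m_test_general)
    show "(\<lambda>l. \<bar>\<mu> l\<bar> / (1 + \<bar>l\<bar>) * K) summable_on Z" by (rule summable_on_cmult_left[OF \<mu>_summable])
    fix l :: real and z :: complex assume "l \<in> Z" "z \<in> cball 0 R"
    then have "cmod (B_quot l z) \<le> K / (1 + \<bar>l\<bar>)" by (intro K(2)) auto
    then have "\<bar>\<mu> l\<bar> * cmod (B_quot l z) \<le> \<bar>\<mu> l\<bar> * (K / (1 + \<bar>l\<bar>))" by (intro mult_left_mono) auto
    then show "norm (of_real (\<mu> l) * B_quot l z) \<le> \<bar>\<mu> l\<bar> / (1 + \<bar>l\<bar>) * K" by (simp add: norm_mult)
  qed
qed

lemma S_has_sum: "((\<lambda>l. of_real (\<mu> l) * B_quot l z) has_sum S z) Z"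
  unfolding has_sum_def
  by (rule tendsto_uniform_limitI[OF S_uniform_limit[of "cmod z"]]) auto

lemma S_holomorphic: "S holomorphic_on X"
proof -
  have "S holomorphic_on ball 0 R" if R: "0 \<le> R" for R
  proof -
    have "\<forall>\<^sub>F X in finite_subsets_at_top Z. continuous_on (cball 0 R) (\<lambda>z. \<Sum>l\<in>X. of_real (\<mu> l) * B_quot l z) \<and>
        (\<lambda>z. \<Sum>l\<in>X. of_real (\<mu> l) * B_quot l z) holomorphic_on ball 0 R"
    proof (rule eventually_finite_subsets_at_top_weakI)
      fix X assume X: "finite X" "X \<subseteq> Z"
      have "(\<lambda>z. \<Sum>l\<in>X. of_real (\<mu> l) * B_quot l z) holomorphic_on Y" for Y
        using X by (intro holomorphic_intros B_quot_holomorphic) auto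
      then show "continuous_on (cball 0 R) (\<lambda>z. \<Sum>l\<in>X. of_real (\<mu> l) * B_quot l z) \<and>
        (\<lambda>z. \<Sum>l\<in>X. of_real (\<mu> l) * B_quot l z) holomorphic_on ball 0 R"
        by (intro conjI holomorphic_on_imp_continuous_on)
    qed
    from holomorphic_uniform_limit[OF this S_uniform_limit[OF R]] show ?thesis by auto
  qed
  then have "S field_differentiable (at z)" for z
    using holomorphic_on_imp_differentiable_at[of S "ball 0 (cmod z + 1)" z] by simp
  then show ?thesis by (simp add: holomorphic_on_def field_differentiable_at_within)
qed

lemma S_at_zero:
  assumes l: "l \<in> Z"
  shows "S (of_real l) = - of_real (\<mu> l) * deriv B (of_real l)"
proof -
  have z: "of_real (\<mu> m) * B_quot m (of_real l) = 0" if "m \<in> Z - {l}" for m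
    using that in_Z[OF l] by (simp add: B_quot_def)
  have "((\<lambda>m. of_real (\<mu> m) * B_quot m (of_real l)) has_sum (of_real (\<mu> l) * B_quot l (of_real l))) {l}"
    by (rule has_sum_finiteI) simp_all
  then have "((\<lambda>m. of_real (\<mu> m) * B_quot m (of_real l)) has_sum (of_real (\<mu> l) * B_quot l (of_real l))) Z"
    by (rule has_sum_cong_neutral[THEN iffD1, rotated 3]) (use z l in auto)
  from has_sum_unique[OF S_has_sum this] show ?thesis by (simp add: B_quot_def)
qed

lemma S_cnj: "S (cnj z) = cnj (S z)"
proof -
  have b: "B_quot l (cnj z) = cnj (B_quot l z)" if "l \<in> Z" for l
  proof -
    have "cnj (deriv B (of_real l)) = deriv B (of_real l)"
      using deriv_real_on_reals[OF B B_cnj, of "of_real l"] by (simp add: Reals_cnj_iff)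
    moreover have "cnj z = of_real l \<longleftrightarrow> z = of_real l" by (metis complex_cnj_cnj complex_cnj_complex_of_real)
    ultimately show ?thesis by (simp add: B_quot_def B_cnj)
  qed
  have "((\<lambda>l. cnj (of_real (\<mu> l) * B_quot l z)) has_sum cnj (S z)) Z"
    unfolding has_sum_cnj_iff by (rule S_has_sum)
  then have "((\<lambda>l. of_real (\<mu> l) * B_quot l (cnj z)) has_sum cnj (S z)) Z"
    by (rule has_sum_cong[THEN iffD1, rotated]) (simp add: b)
  from has_sum_unique[OF S_has_sum this] show ?thesis .
qed

definition G :: "complex \<Rightarrow> complex" where "G z = (z - of_real t) * S z / B z"

lemma B_nonreal: "z \<notin> \<real> \<Longrightarrow> B z \<noteq> 0" by (auto simp: B_zero)

lemma G_holomorphic: "G holomorphic_on - \<real>"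
  unfolding G_def[abs_def]
  by (intro holomorphic_intros S_holomorphic holomorphic_on_subset[OF B]) (auto dest: B_nonreal)

lemma G_has_sum:
  assumes z: "z \<notin> \<real>"
  shows "((\<lambda>l. of_real (\<rho> l / (l - t) ^ (2 * k)) * ((z - of_real t) / ((of_real l - of_real t) * (of_real l - z)))) has_sum G z) Z"
proof -
  have "((\<lambda>l. (z - of_real t) / B z * (of_real (\<mu> l) * B_quot l z)) has_sum ((z - of_real t) / B z * S z)) Z"
    by (rule has_sum_cmult_right[OF S_has_sum])
  moreover have "(z - of_real t) / B z * (of_real (\<mu> l) * B_quot l z)
     = of_real (\<rho> l / (l - t) ^ (2 * k)) * ((z - of_real t) / ((of_real l - of_real t) * (of_real l - z)))" for l
  proof -
    have "z \<noteq> of_real l" using z by auto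
    then have e1: "(z - of_real t) / B z * (of_real (\<mu> l) * B_quot l z) = (z - of_real t) * of_real (\<mu> l) / (of_real l - z)"
      using B_nonreal[OF z] by (simp add: B_quot_def)
    have e2: "complex_of_real (\<mu> l) = of_real (\<rho> l / (l - t) ^ (2 * k)) / (of_real l - of_real t)"
      by (simp add: \<mu>_def mult.commute)
    have assoc: "a * (W / d) / d' = W * (a / (d * d'))" for a W d d' :: complex by simp
    show ?thesis unfolding e1 unfolding e2 by (rule assoc)
  qed
  ultimately show ?thesis by (simp only: G_def times_divide_eq_left)
qed

text \<open>
  At a zero \<open>l\<close> of \<open>B\<close> only one term of \<open>S\<close> survives, and \<open>R A = \<rho> l * B'(l) * A(l) = - 1\<close>, so
  \<open>1 + R A\<close> is divisible by \<open>B\<close>. The part of \<open>R\<close> with \<open>c B\<close> vanishes there, which is why \<open>c\<close> stays free.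
\<close>
lemma entire_interpolation:
  fixes c :: real
  shows "\<exists>P R. P holomorphic_on UNIV \<and> R holomorphic_on UNIV \<and> (\<forall>z\<in>\<real>. P z \<in> \<real> \<and> R z \<in> \<real>)
    \<and> (\<forall>z. P z * B z - R z * A z = 1)
    \<and> (\<forall>z. z \<notin> \<real> \<longrightarrow> - R z / B z = (z - of_real t) ^ (2 * k) * (of_real c * (z - of_real t) + G z))"
proof -
  define R where "R = (\<lambda>z. - ((z - of_real t) ^ (2 * k + 1) * (of_real c * B z + S z)))"
  define f where "f = (\<lambda>z. 1 + R z * A z)"
  define P where "P = (\<lambda>z. if B z = 0 then deriv f z / deriv B z else f z / B z)"
  have R: "R holomorphic_on UNIV" unfolding R_def by (intro holomorphic_intros B S_holomorphic)
  have f: "f holomorphic_on UNIV" unfolding f_def by (intro holomorphic_intros R A)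
  have R_cnj: "R (cnj z) = cnj (R z)" for z by (simp add: R_def B_cnj S_cnj)
  have f_cnj: "f (cnj z) = cnj (f z)" for z by (simp add: f_def R_cnj A_cnj)
  have zero: "f z = 0 \<and> deriv B z \<noteq> 0" if Bz: "B z = 0" for z
  proof -
    obtain l where l: "l \<in> Z" "z = of_real l" using Bz B_zero by auto
    have r: "deriv B z * A z = - of_real (1 / \<rho> l)" unfolding l(2) by (rule residue[OF l(1)])
    have m: "complex_of_real (l - t) ^ (2 * k + 1) * of_real (\<mu> l) = of_real (\<rho> l)"
      using Z_neq_t[OF l(1)] by (simp add: \<mu>_def)
    have "R z = complex_of_real (l - t) ^ (2 * k + 1) * of_real (\<mu> l) * deriv B z"
      using Bz by (simp add: R_def l(2) S_at_zero[OF l(1)])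
    then have "R z * A z = of_real (\<rho> l) * (deriv B z * A z)" unfolding m by simp
    then have "R z * A z = - 1" unfolding r using \<rho>[OF l(1)] by simp
    moreover have "deriv B z \<noteq> 0" using r \<rho>[OF l(1)] by auto
    ultimately show ?thesis by (simp add: f_def)
  qed
  have "P holomorphic_on UNIV" unfolding P_def by (rule entire_quotient_simple_zeros[OF f B zero])
  moreover have "P z \<in> \<real> \<and> R z \<in> \<real>" if z: "z \<in> \<real>" for z
  proof -
    have cz: "cnj z = z" using z by (simp add: Reals_cnj_iff)
    have "f z \<in> \<real>" "B z \<in> \<real>" "R z \<in> \<real>"
      using f_cnj[of z] B_cnj[of z] R_cnj[of z] by (simp_all add: cz Reals_cnj_iff)
    then show ?thesis
      unfolding P_def using deriv_real_on_reals[OF f f_cnj z] deriv_real_on_reals[OF B B_cnj z] by simp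
  qed
  moreover have "P z * B z - R z * A z = 1" for z
    using zero[of z] by (cases "B z = 0") (auto simp: P_def f_def add_eq_0_iff)
  moreover have "- R z / B z = (z - of_real t) ^ (2 * k) * (of_real c * (z - of_real t) + G z)" if z: "z \<notin> \<real>" for z
    using B_nonreal[OF z] by (simp add: R_def G_def field_simps)
  ultimately show ?thesis using R by (intro exI[of _ P] exI[of _ R]) simp
qed

end

section \<open>Indefinite integrals and their products\<close>

text \<open>
  Cutting the interval into \<open>n\<close> pieces on which \<open>W\<close> increases equally much bounds the total increment of
  \<open>h\<close> by \<open>n * (T / n)\<^sup>2\<close>, which tends to 0.
\<close>
lemma eq_if_quadratic_increments:
  fixes h :: "real \<Rightarrow> 'a::real_normed_vector" and W :: "real \<Rightarrow> real"
  assumes ab: "a \<le> b" and cont: "continuous_on {a..b} W"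
    and mono: "\<And>x y. a \<le> x \<Longrightarrow> x \<le> y \<Longrightarrow> y \<le> b \<Longrightarrow> W x \<le> W y"
    and le: "\<And>x y. a \<le> x \<Longrightarrow> x \<le> y \<Longrightarrow> y \<le> b \<Longrightarrow> norm (h y - h x) \<le> (W y - W x)\<^sup>2"
  shows "h b = h a"
proof -
  define T where "T = W b - W a"
  have T0: "T \<ge> 0" using mono[of a b] ab by (simp add: T_def)
  have bound: "norm (h b - h a) \<le> T\<^sup>2 / real n" if n: "n > 0" for n :: nat
  proof -
    \<comment> \<open>Division points at which \<open>W\<close> takes equidistant values, from the intermediate value theorem.\<close>
    have "\<forall>i. \<exists>x. i \<le> n \<longrightarrow> a \<le> x \<and> x \<le> b \<and> W x = W a + real i * (T / real n)"
    proof (intro allI)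
      fix i
      show "\<exists>x. i \<le> n \<longrightarrow> a \<le> x \<and> x \<le> b \<and> W x = W a + real i * (T / real n)"
      proof (cases "i \<le> n")
      case True
      have "real i * (T / real n) \<le> T" using True n T0 by (simp add: divide_le_eq mult_left_mono mult.commute)
      then show ?thesis using IVT'[of W a "W a + real i * (T / real n)" b] ab cont T0 by (auto simp: T_def)
      qed simp
    qed
    from choice[OF this] obtain x where
      "\<forall>i. i \<le> n \<longrightarrow> a \<le> x i \<and> x i \<le> b \<and> W (x i) = W a + real i * (T / real n)"
      by (elim exE)
    note x = this[rule_format]
    have near: "norm (h u - h v) \<le> (W u - W v)\<^sup>2" if "a \<le> u" "u \<le> b" "a \<le> v" "v \<le> b" for u v
      using le[of v u] le[of u v] that by (cases "v \<le> u") (auto simp: norm_minus_commute power2_commute)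
    have step: "norm (h (x i) - h a) \<le> real i * (T / real n)\<^sup>2" if "i \<le> n" for i
      using that
    proof (induction i)
      case 0
      then show ?case using near[of "x 0" a] x[of 0] ab by simp
    next
      case (Suc i)
      have "W (x (Suc i)) - W (x i) = T / real n" using x[of i] x[of "Suc i"] Suc.prems by (simp add: add_divide_distrib ring_distribs)
      then have "norm (h (x (Suc i)) - h (x i)) \<le> (T / real n)\<^sup>2"
        using near[of "x (Suc i)" "x i"] x[of i] x[of "Suc i"] Suc.prems by simp
      then show ?case using Suc norm_triangle_ineq[of "h (x (Suc i)) - h (x i)" "h (x i) - h a"]
        by (simp add: algebra_simps)
    qed
    have "norm (h b - h (x n)) \<le> 0" using near[of b "x n"] x[of n] ab n by (simp add: T_def)
    then have "norm (h b - h a) \<le> real n * (T / real n)\<^sup>2" using step[of n] by simp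
    also have "\<dots> = T\<^sup>2 / real n" using n by (simp add: power2_eq_square field_simps)
    finally show ?thesis .
  qed
  have "(\<lambda>n. T\<^sup>2 / real n) \<longlonglongrightarrow> 0" by (rule lim_const_over_n)
  moreover have "\<forall>\<^sub>F n in sequentially. norm (h b - h a) \<le> T\<^sup>2 / real n"
    using eventually_gt_at_top[of 0] by eventually_elim (rule bound)
  ultimately have "norm (h b - h a) \<le> 0" by (rule tendsto_lowerbound) simp
  then show ?thesis by simp
qed

lemma Icc_subset_is_interval: "is_interval I \<Longrightarrow> x \<in> I \<Longrightarrow> y \<in> I \<Longrightarrow> {x..y :: real} \<subseteq> I"
  by (rule subsetI, rule mem_is_interval_1_I[of I x y]) simp_all

text \<open>
  \<open>F\<close> is locally absolutely continuous on \<open>I\<close> with derivative \<open>f\<close> almost everywhere. Stating this through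
  integrals allows one to compute with such functions without differentiating them at points.
\<close>
definition indef_integral_on :: "real set \<Rightarrow> (real \<Rightarrow> 'a::euclidean_space) \<Rightarrow> (real \<Rightarrow> 'a) \<Rightarrow> bool" where
  "indef_integral_on I F f \<longleftrightarrow> (\<forall>x\<in>I. \<forall>y\<in>I. x \<le> y \<longrightarrow>
     f absolutely_integrable_on {x..y} \<and> (f has_integral (F y - F x)) {x..y})"

lemma indef_integral_onD:
  assumes "indef_integral_on I F f" "x \<in> I" "y \<in> I" "x \<le> y"
  shows "f absolutely_integrable_on {x..y}" "(f has_integral (F y - F x)) {x..y}"
    "f integrable_on {x..y}" "integral {x..y} f = F y - F x"
  using assms unfolding indef_integral_on_def by (blast dest: integral_unique)+

lemma indef_integral_on_subset: "indef_integral_on I F f \<Longrightarrow> J \<subseteq> I \<Longrightarrow> indef_integral_on J F f"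
  unfolding indef_integral_on_def by blast

lemma indef_integral_on_cong:
  assumes "indef_integral_on I F f" "is_interval I"
    and "\<And>x. x \<in> I \<Longrightarrow> F x = F' x" "\<And>x. x \<in> I \<Longrightarrow> f x = f' x"
  shows "indef_integral_on I F' f'"
  unfolding indef_integral_on_def
proof (intro ballI impI)
  fix x y assume xy: "x \<in> I" "y \<in> I" "x \<le> y"
  have eq: "f t = f' t" if "t \<in> {x..y}" for t
    using assms(4) mem_is_interval_1_I[OF assms(2) xy(1,2)] that by simp
  show "f' absolutely_integrable_on {x..y} \<and> (f' has_integral F' y - F' x) {x..y}"
  proof
    show "f' absolutely_integrable_on {x..y}"
      by (rule set_integrable_cong[OF refl refl eq, THEN iffD1, OF _ indef_integral_onD(1)[OF assms(1) xy]])
    show "(f' has_integral F' y - F' x) {x..y}"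
      using has_integral_eq[OF eq indef_integral_onD(2)[OF assms(1) xy]]
      unfolding assms(3)[OF xy(1)] assms(3)[OF xy(2)] .
  qed
qed

lemma indef_integral_on_AE:
  assumes "indef_integral_on I F f" and "AE x in lebesgue. x \<in> I' \<longrightarrow> f x = f' x"
    and "is_interval I" "I \<subseteq> I'"
  shows "indef_integral_on I F f'"
  unfolding indef_integral_on_def
proof (intro ballI impI)
  fix x y assume xy: "x \<in> I" "y \<in> I" "x \<le> y"
  have sub: "{x..y} \<subseteq> I'" using Icc_subset_is_interval[OF assms(3) xy(1,2)] assms(4) by (rule subset_trans)
  have neg: "negligible {t. \<not> (t \<in> I' \<longrightarrow> f t = f' t)}"
  proof -
    from assms(2) obtain N where "negligible N" "{t. \<not> (t \<in> I' \<longrightarrow> f t = f' t)} \<subseteq> N"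
      unfolding eventually_ae_filter_negligible by (elim exE conjE)
    then show ?thesis by (rule negligible_subset)
  qed
  have eq: "f' t = f t" if "t \<in> {x..y} - {t. \<not> (t \<in> I' \<longrightarrow> f t = f' t)}" for t
    using that subsetD[OF sub, of t] by auto
  show "f' absolutely_integrable_on {x..y} \<and> (f' has_integral F y - F x) {x..y}"
    by (intro conjI absolutely_integrable_spike[OF indef_integral_onD(1)[OF assms(1) xy] neg]
        has_integral_spike[OF neg _ indef_integral_onD(2)[OF assms(1) xy]]) (erule eq)+
qed

lemma indef_integral_on_continuous:
  assumes F: "indef_integral_on {a..b} F f"
  shows "continuous_on {a..b} F"
proof (cases "a \<le> b")
  case True
  then have "f integrable_on {a..b}" using indef_integral_onD(3)[OF F] by simp
  then have "continuous_on {a..b} (\<lambda>x. F a + integral {a..x} f)"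
    by (intro continuous_intros indefinite_integral_continuous_1)
  then show ?thesis
    by (rule continuous_on_eq) (use indef_integral_onD(4)[OF F] True in auto)
qed simp

lemma indef_integral_on_continuous_open:
  assumes F: "indef_integral_on {a<..<b} F f"
  shows "continuous_on {a<..<b} F"
proof -
  have "isCont F x" if x: "x \<in> {a<..<b}" for x
  proof -
    obtain c d where cd: "a < c" "c < x" "x < d" "d < b" using x dense by (metis greaterThanLessThan_iff)
    have "continuous_on {c..d} F"
      by (rule indef_integral_on_continuous, rule indef_integral_on_subset[OF F]) (use cd in auto)
    then have "continuous_on {c<..<d} F" by (rule continuous_on_subset) auto
    then show ?thesis using cd by (simp add: continuous_on_eq_continuous_at)
  qed
  then show ?thesis by (simp add: continuous_at_imp_continuous_on)
qed

lemma absolutely_integrable_continuous_mult: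
  fixes f :: "real \<Rightarrow> 'a::{euclidean_space, real_normed_field}"
  assumes f: "f absolutely_integrable_on {x..y}" and g: "continuous_on {x..y} g"
  shows "(\<lambda>t. f t * g t) absolutely_integrable_on {x..y}" "(\<lambda>t. g t * f t) absolutely_integrable_on {x..y}"
proof -
  have "bilinear ((*) :: 'a \<Rightarrow> _)" by (simp add: bilinear_conv_bounded_bilinear bounded_bilinear_mult)
  moreover have "g \<in> borel_measurable (lebesgue_on {x..y})"
    by (rule continuous_imp_measurable_on_sets_lebesgue[OF g]) simp
  moreover have "bounded (g ` {x..y})" using compact_continuous_image[OF g] compact_imp_bounded by blast
  ultimately show "(\<lambda>t. g t * f t) absolutely_integrable_on {x..y}"
    using absolutely_integrable_bounded_measurable_product[of "(*)" g "{x..y}" f] f by simp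
  then show "(\<lambda>t. f t * g t) absolutely_integrable_on {x..y}" by (simp add: mult.commute)
qed

text \<open>
  The product rule. The function \<open>F G - \<integral> (f G + F g)\<close> has increments bounded by the square of those of
  the continuous increasing function \<open>W = \<integral> (\<bar>f\<bar> + \<bar>g\<bar>)\<close>, hence it is constant.
\<close>
lemma indef_integral_on_mult_compact:
  fixes F G :: "real \<Rightarrow> 'a::{euclidean_space, real_normed_field}"
  assumes F: "indef_integral_on {a..b} F f" and G: "indef_integral_on {a..b} G g" and ab: "a \<le> b"
  shows "(\<lambda>t. f t * G t + F t * g t) absolutely_integrable_on {a..b}"
    "((\<lambda>t. f t * G t + F t * g t) has_integral (F b * G b - F a * G a)) {a..b}"
proof -
  note cF = indef_integral_on_continuous[OF F] and cG = indef_integral_on_continuous[OF G]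
  have fi: "f absolutely_integrable_on {a..b}" and gi: "g absolutely_integrable_on {a..b}"
    using indef_integral_onD(1)[OF F] indef_integral_onD(1)[OF G] ab by auto
  define p where "p = (\<lambda>t. f t * G t + F t * g t)"
  show pi: "p absolutely_integrable_on {a..b}"
    unfolding p_def using fi gi cF cG by (intro set_integral_add absolutely_integrable_continuous_mult)
  define w where "w = (\<lambda>t. norm (f t) + norm (g t))"
  have wi: "w absolutely_integrable_on {a..b}"
    unfolding w_def using fi gi by (intro set_integral_add absolutely_integrable_norm[unfolded o_def])
  have sub: "{u..v} \<subseteq> {a..b}" if "a \<le> u" "v \<le> b" for u v using that by auto
  note ai_sub = absolutely_integrable_on_subinterval
  define h where "h = (\<lambda>x. F x * G x - integral {a..x} p)"
  define W where "W = (\<lambda>x. integral {a..x} w)"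
  have incr: "integral {u..v} q = integral {a..v} q - integral {a..u} q"
    if "q integrable_on {a..b}" "a \<le> u" "u \<le> v" "v \<le> b" for q :: "real \<Rightarrow> 'c::euclidean_space" and u v
  proof -
    have "q integrable_on {a..v}" by (rule integrable_on_subinterval[OF that(1)]) (use that in auto)
    then show ?thesis using Henstock_Kurzweil_Integration.integral_combine[of a u v q] that by (simp add: algebra_simps)
  qed
  have W_nn: "0 \<le> integral {u..v} w" for u v
    by (cases "w integrable_on {u..v}") (auto simp: w_def intro!: integral_nonneg simp: not_integrable_integral)
  have "h b = h a"
  proof (rule eq_if_quadratic_increments[OF ab, of W])
    show "continuous_on {a..b} W"
      unfolding W_def by (rule indefinite_integral_continuous_1) (use wi in \<open>simp add: set_lebesgue_integral_eq_integral(1)\<close>)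
    show "W x \<le> W y" if "a \<le> x" "x \<le> y" "y \<le> b" for x y
      using incr[of w x y] that wi W_nn[of x y] by (simp add: W_def set_lebesgue_integral_eq_integral(1))
    show "norm (h v - h u) \<le> (W v - W u)\<^sup>2" if uv: "a \<le> u" "u \<le> v" "v \<le> b" for u v
    proof -
      have Wuv: "W v - W u = integral {u..v} w"
        using incr[of w u v] uv wi by (simp add: W_def set_lebesgue_integral_eq_integral(1))
      have wi': "w integrable_on {s..t}" if "a \<le> s" "t \<le> b" for s t
        by (rule integrable_on_subinterval[of w "{a..b}"]) (use wi that in \<open>auto simp: set_lebesgue_integral_eq_integral(1)\<close>)
      have dF: "norm (F t - F s) \<le> integral {u..v} w" and dG: "norm (G t - G s) \<le> integral {u..v} w"
        if st: "u \<le> s" "s \<le> t" "t \<le> v" for s t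
      proof -
        have m: "integral {s..t} w \<le> integral {u..v} w"
          by (rule integral_subset_le) (use st uv wi' in \<open>auto simp: w_def\<close>)
        have "norm (integral {s..t} f) \<le> integral {s..t} w"
          by (rule Henstock_Kurzweil_Integration.integral_norm_bound_integral)
             (use indef_integral_onD(3)[OF F, of s t] st uv wi' in \<open>auto simp: w_def\<close>)
        then show "norm (F t - F s) \<le> integral {u..v} w"
          using m indef_integral_onD(4)[OF F, of s t] st uv by auto
        have "norm (integral {s..t} g) \<le> integral {s..t} w"
          by (rule Henstock_Kurzweil_Integration.integral_norm_bound_integral)
             (use indef_integral_onD(3)[OF G, of s t] st uv wi' in \<open>auto simp: w_def\<close>)
        then show "norm (G t - G s) \<le> integral {u..v} w"
          using m indef_integral_onD(4)[OF G, of s t] st uv by auto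
      qed
      have fg: "f absolutely_integrable_on {u..v}" "g absolutely_integrable_on {u..v}"
        using indef_integral_onD(1)[OF F, of u v] indef_integral_onD(1)[OF G, of u v] uv by auto
      have ints: "f integrable_on {u..v}" "g integrable_on {u..v}"
        using fg by (simp_all add: set_lebesgue_integral_eq_integral(1))
      have cuv: "continuous_on {u..v} F" "continuous_on {u..v} G"
        using continuous_on_subset[OF cF] continuous_on_subset[OF cG] sub uv by auto
      have pint: "p integrable_on {u..v}"
        unfolding p_def using fg cuv
        by (intro set_lebesgue_integral_eq_integral(1) set_integral_add absolutely_integrable_continuous_mult)
      have "h v - h u = F v * G v - F u * G u - integral {u..v} p"
        using incr[of p u v] uv pi by (simp add: h_def set_lebesgue_integral_eq_integral(1))
      also have "F v * G v - F u * G u = integral {u..v} f * G v + F u * integral {u..v} g"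
      proof -
        have e: "integral {u..v} f = F v - F u" "integral {u..v} g = G v - G u"
          using indef_integral_onD(4)[OF F, of u v] indef_integral_onD(4)[OF G, of u v] uv by simp_all
        show ?thesis unfolding e by (simp add: algebra_simps)
      qed
      also have "\<dots> = integral {u..v} (\<lambda>t. f t * G v + F u * g t)"
        using ints by (simp add: Henstock_Kurzweil_Integration.integral_add integrable_on_mult_left integrable_on_mult_right)
      also have "\<dots> - integral {u..v} p = integral {u..v} (\<lambda>t. (f t * G v + F u * g t) - p t)"
        using ints pint
        by (intro Henstock_Kurzweil_Integration.integral_diff[symmetric] integrable_add integrable_on_mult_left integrable_on_mult_right)
      finally have eq: "h v - h u = integral {u..v} (\<lambda>t. (f t * G v + F u * g t) - p t)" .
      have "norm (integral {u..v} (\<lambda>t. (f t * G v + F u * g t) - p t)) \<le> integral {u..v} (\<lambda>t. w t * integral {u..v} w)"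
      proof (rule Henstock_Kurzweil_Integration.integral_norm_bound_integral)
        show "(\<lambda>t. (f t * G v + F u * g t) - p t) integrable_on {u..v}"
          using ints pint by (intro integrable_diff integrable_add integrable_on_mult_left integrable_on_mult_right)
        show "(\<lambda>t. w t * integral {u..v} w) integrable_on {u..v}"
          using wi'[of u v] uv by (intro integrable_on_mult_left) auto
        fix t assume t: "t \<in> {u..v}"
        \<comment> \<open>Freezing \<open>G\<close> at the right and \<open>F\<close> at the left end makes the boundary terms match exactly.\<close>
        have "(f t * G v + F u * g t) - p t = f t * (G v - G t) - (F t - F u) * g t"
          by (simp add: p_def algebra_simps)
        also have "norm \<dots> \<le> norm (f t) * norm (G v - G t) + norm (F t - F u) * norm (g t)"
          by (rule order_trans[OF norm_triangle_ineq4]) (simp add: norm_mult)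
        also have "\<dots> \<le> norm (f t) * integral {u..v} w + integral {u..v} w * norm (g t)"
          using dF[of u t] dG[of t v] t by (intro add_mono mult_left_mono mult_right_mono) auto
        finally show "norm ((f t * G v + F u * g t) - p t) \<le> w t * integral {u..v} w"
          by (simp add: w_def algebra_simps)
      qed
      then show ?thesis unfolding eq Wuv by (simp add: power2_eq_square)
    qed
  qed
  then have "integral {a..b} p = F b * G b - F a * G a" by (simp add: h_def algebra_simps)
  then show "(p has_integral (F b * G b - F a * G a)) {a..b}"
    using integrable_integral[OF set_lebesgue_integral_eq_integral(1)[OF pi]] by simp
qed

lemma indef_integral_on_mult:
  fixes F G :: "real \<Rightarrow> 'a::{euclidean_space, real_normed_field}"
  assumes F: "indef_integral_on I F f" and G: "indef_integral_on I G g" and I: "is_interval I"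
  shows "indef_integral_on I (\<lambda>x. F x * G x) (\<lambda>x. f x * G x + F x * g x)"
  unfolding indef_integral_on_def
proof (intro ballI impI)
  fix x y assume xy: "x \<in> I" "y \<in> I" "x \<le> y"
  have "{x..y} \<subseteq> I" by (rule Icc_subset_is_interval[OF I xy(1,2)])
  then have "indef_integral_on {x..y} F f" "indef_integral_on {x..y} G g"
    using F G indef_integral_on_subset by blast+
  from indef_integral_on_mult_compact[OF this xy(3)]
  show "(\<lambda>x. f x * G x + F x * g x) absolutely_integrable_on {x..y} \<and>
      ((\<lambda>x. f x * G x + F x * g x) has_integral F y * G y - F x * G x) {x..y}" by blast
qed

lemma indef_integral_on_add:
  assumes "indef_integral_on I F f" and "indef_integral_on I G g"
  shows "indef_integral_on I (\<lambda>x. F x + G x) (\<lambda>x. f x + g x)"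
  using assms unfolding indef_integral_on_def
  by (auto intro!: set_integral_add simp: add_diff_add intro: has_integral_add)

lemma indef_integral_on_const: "indef_integral_on I (\<lambda>x. c) (\<lambda>x. 0)"
  unfolding indef_integral_on_def by auto

lemma indef_integral_on_cmult:
  fixes F :: "real \<Rightarrow> 'a::{euclidean_space, real_normed_field}"
  assumes "indef_integral_on I F f"
  shows "indef_integral_on I (\<lambda>x. c * F x) (\<lambda>x. c * f x)"
  using assms unfolding indef_integral_on_def
  by (auto simp: right_diff_distrib[symmetric] intro!: set_integrable_mult_right has_integral_mult_right)

lemma indef_integral_on_power:
  fixes F :: "real \<Rightarrow> 'a::{euclidean_space, real_normed_field}"
  assumes F: "indef_integral_on I F f" and I: "is_interval I"
  shows "indef_integral_on I (\<lambda>x. F x ^ Suc n) (\<lambda>x. of_nat (Suc n) * (f x * F x ^ n))"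
proof (induction n)
  case 0
  then show ?case using F by simp
next
  case (Suc n)
  show ?case
    by (rule indef_integral_on_cong[OF indef_integral_on_mult[OF F Suc I] I]) (simp_all add: algebra_simps)
qed

lemma indef_integral_on_deriv:
  fixes F f :: "real \<Rightarrow> 'a::euclidean_space"
  assumes F: "\<And>x. x \<in> I \<Longrightarrow> (F has_vector_derivative f x) (at x)" and f: "continuous_on I f" and I: "is_interval I"
  shows "indef_integral_on I F f"
  unfolding indef_integral_on_def
proof (intro ballI impI)
  fix x y assume xy: "x \<in> I" "y \<in> I" "x \<le> y"
  have sub: "{x..y} \<subseteq> I" by (rule Icc_subset_is_interval[OF I xy(1,2)])
  have 1: "f absolutely_integrable_on {x..y}"
    by (rule absolutely_integrable_continuous_real[OF continuous_on_subset[OF f sub]])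
  have "(F has_vector_derivative f t) (at t within {x..y})" if "t \<in> {x..y}" for t
    by (rule has_vector_derivative_at_within[OF F[OF subsetD[OF sub that]]])
  from fundamental_theorem_of_calculus[OF xy(3) this]
  show "f absolutely_integrable_on {x..y} \<and> (f has_integral F y - F x) {x..y}" by (rule conjI[OF 1])
qed

lemma indef_integral_on_unique_constant:
  assumes "indef_integral_on I F (\<lambda>x. 0)" "x \<in> I" "y \<in> I"
  shows "F x = F y"
proof (cases "x \<le> y")
  case True
  have "F y - F x = 0" by (subst indef_integral_onD(4)[OF assms True, symmetric]) (rule integral_0)
  then show ?thesis by simp
next
  case False
  then have "y \<le> x" by simp
  have "F x - F y = 0" by (subst indef_integral_onD(4)[OF assms(1,3,2) \<open>y \<le> x\<close>, symmetric]) (rule integral_0)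
  then show ?thesis by simp
qed

section \<open>Singular Volterra equations\<close>

text \<open>
  Variation of constants for a perturbation of a diagonal system with solutions \<open>\<alpha> i\<close> leads to the
  operator \<open>T A u\<close> with components \<open>\<alpha> i x * \<integral> (\<Sum>j. A i j * u j) / \<alpha> i\<close>. Solutions are measured in
  the weight \<beta>, and \<open>ratio\<close> says that the propagator \<open>\<alpha> i x / \<alpha> i t\<close> is at most \<open>\<beta> x / \<beta> t\<close>.
  Relative to \<beta> the equation is therefore a regular Volterra equation with integrable coefficients,
  whatever the singularities of the \<open>\<alpha> i\<close> are. The flag \<open>forward\<close> selects integration from 0, as needed
  for \<Phi>, or from \<open>b\<close>, as needed for \<open>U\<close> and \<open>V\<close>.
\<close>
locale singular_volterra =
  fixes b :: real and forward :: bool and \<alpha> :: "'n::finite \<Rightarrow> real \<Rightarrow> real" and \<beta> :: "real \<Rightarrow> real"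
  assumes b_pos: "0 < b"
    and \<alpha>_pos: "\<And>i x. 0 < x \<Longrightarrow> x < b \<Longrightarrow> 0 < \<alpha> i x"
    and \<beta>_pos: "\<And>x. 0 < x \<Longrightarrow> x < b \<Longrightarrow> 0 < \<beta> x"
    and \<alpha>_cont: "\<And>i. continuous_on {0<..<b} (\<alpha> i)"
    and \<beta>_cont: "continuous_on {0<..<b} \<beta>"
    and ratio: "\<And>i x t. 0 < x \<Longrightarrow> x < b \<Longrightarrow> 0 < t \<Longrightarrow> t < b \<Longrightarrow>
       (if forward then t \<le> x else x \<le> t) \<Longrightarrow> \<alpha> i x * \<beta> t \<le> \<beta> x * \<alpha> i t"
begin

definition dom :: "real \<Rightarrow> real set" where
  "dom x = (if forward then {0..x} else {x..b})"

definition J :: "(real \<Rightarrow> complex) \<Rightarrow> real \<Rightarrow> complex" where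
  "J \<phi> x = (if forward then integral {0..x} \<phi> else - integral {x..b} \<phi>)"

definition coeff :: "(real \<Rightarrow> 'n \<Rightarrow> 'n \<Rightarrow> complex) \<Rightarrow> bool" where
  "coeff A \<longleftrightarrow> (\<forall>i j. integrable lebesgue (\<lambda>t. A t i j)) \<and> (\<forall>t i j. t \<notin> {0<..<b} \<longrightarrow> A t i j = 0)"

definition weighted :: "(real \<Rightarrow> 'n \<Rightarrow> complex) \<Rightarrow> bool" where
  "weighted v \<longleftrightarrow> (\<exists>C. \<forall>x\<in>{0<..<b}. \<forall>i. cmod (v x i) \<le> C * \<beta> x) \<and> (\<forall>i. continuous_on {0<..<b} (\<lambda>x. v x i))"

definition integrand :: "(real \<Rightarrow> 'n \<Rightarrow> 'n \<Rightarrow> complex) \<Rightarrow> (real \<Rightarrow> 'n \<Rightarrow> complex) \<Rightarrow> 'n \<Rightarrow> real \<Rightarrow> complex" where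
  "integrand A v i t = (\<Sum>j\<in>UNIV. A t i j * v t j) / of_real (\<alpha> i t)"

definition T :: "(real \<Rightarrow> 'n \<Rightarrow> 'n \<Rightarrow> complex) \<Rightarrow> (real \<Rightarrow> 'n \<Rightarrow> complex) \<Rightarrow> real \<Rightarrow> 'n \<Rightarrow> complex" where
  "T A v x i = of_real (\<alpha> i x) * J (integrand A v i) x"

definition total :: "(real \<Rightarrow> 'n \<Rightarrow> 'n \<Rightarrow> complex) \<Rightarrow> real \<Rightarrow> real" where
  "total A t = (\<Sum>i\<in>UNIV. \<Sum>j\<in>UNIV. cmod (A t i j))"

lemma dom_sets: "dom x \<in> sets lebesgue" by (simp add: dom_def)

lemma dom_order: "t \<in> dom x \<Longrightarrow> if forward then t \<le> x else x \<le> t"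
  by (simp add: dom_def split: if_splits)

lemma dom_subset: "0 \<le> x \<Longrightarrow> x \<le> b \<Longrightarrow> dom x \<subseteq> {0..b}"
  by (auto simp: dom_def split: if_splits)

lemma norm_J: "cmod (J \<phi> x) = cmod (integral (dom x) \<phi>)"
  by (simp add: J_def dom_def)

lemma J_diff:
  assumes "\<And>x. 0 < x \<Longrightarrow> x < b \<Longrightarrow> \<phi> integrable_on dom x" "0 < x" "x \<le> y" "y < b"
  shows "\<phi> integrable_on {x..y}" "(\<phi> has_integral (J \<phi> y - J \<phi> x)) {x..y}"
proof -
  have "\<phi> integrable_on dom x" "\<phi> integrable_on dom y" using assms by auto
  note 1 = this[unfolded dom_def]
  show i: "\<phi> integrable_on {x..y}"
  proof (cases forward)
    case True
    with 1 have "\<phi> integrable_on {0..y}" by simp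
    then show ?thesis by (rule integrable_on_subinterval) (use assms in auto)
  next
    case False
    with 1 have "\<phi> integrable_on {x..b}" by simp
    then show ?thesis by (rule integrable_on_subinterval) (use assms in auto)
  qed
  have "integral {x..y} \<phi> = J \<phi> y - J \<phi> x"
  proof (cases forward)
    case True
    with 1 have "\<phi> integrable_on {0..y}" by simp
    from Henstock_Kurzweil_Integration.integral_combine[OF _ _ this, of x] assms
    have "integral {0..x} \<phi> + integral {x..y} \<phi> = integral {0..y} \<phi>" by simp
    then show ?thesis unfolding J_def using True by (simp add: algebra_simps)
  next
    case False
    with 1 have "\<phi> integrable_on {x..b}" by simp
    from Henstock_Kurzweil_Integration.integral_combine[OF _ _ this, of y] assms
    have "integral {x..y} \<phi> + integral {y..b} \<phi> = integral {x..b} \<phi>" by simp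
    then show ?thesis unfolding J_def using False by (simp add: algebra_simps)
  qed
  then show "(\<phi> has_integral (J \<phi> y - J \<phi> x)) {x..y}"
    using integrable_integral[OF i] by simp
qed

lemma J_indef:
  assumes "\<And>x. 0 < x \<Longrightarrow> x < b \<Longrightarrow> \<phi> absolutely_integrable_on dom x"
  shows "indef_integral_on {0<..<b} (J \<phi>) \<phi>"
  unfolding indef_integral_on_def
proof (intro ballI impI conjI)
  fix x y assume xy: "x \<in> {0<..<b}" "y \<in> {0<..<b}" "x \<le> y"
  have sub: "{x..y} \<subseteq> dom (if forward then y else x)" using xy by (auto simp: dom_def)
  show "\<phi> absolutely_integrable_on {x..y}"
    by (rule set_integrable_subset[OF assms _ sub]) (use xy in auto)
  show "(\<phi> has_integral J \<phi> y - J \<phi> x) {x..y}"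
    by (rule J_diff(2)) (use assms xy in \<open>auto simp: set_lebesgue_integral_eq_integral(1)\<close>)
qed

lemma coeffD:
  assumes "coeff A"
  shows "integrable lebesgue (\<lambda>t. A t i j)" "t \<notin> {0<..<b} \<Longrightarrow> A t i j = 0"
  using assms by (auto simp: coeff_def)

lemma total_nonneg: "0 \<le> total A t" by (simp add: total_def sum_nonneg)

lemma total_outside: "coeff A \<Longrightarrow> t \<notin> {0<..<b} \<Longrightarrow> total A t = 0"
  by (simp add: total_def coeffD)

lemma row_le_total: "(\<Sum>j\<in>UNIV. cmod (A t i j)) \<le> total A t"
  unfolding total_def by (rule member_le_sum) (simp_all add: sum_nonneg)

lemma integrable_total: "coeff A \<Longrightarrow> integrable lebesgue (total A)"
  unfolding total_def[abs_def] by (intro Bochner_Integration.integrable_sum integrable_norm coeffD)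

lemma integrable_imp_abs_int: "integrable lebesgue f \<Longrightarrow> S \<in> sets lebesgue \<Longrightarrow> f absolutely_integrable_on S"
  unfolding set_integrable_def by (rule integrable_mult_indicator)

lemma integrand_outside: "coeff A \<Longrightarrow> t \<notin> {0<..<b} \<Longrightarrow> integrand A v i t = 0"
  by (simp add: integrand_def coeffD(2))

lemma integrand_bound:
  assumes A: "coeff A" and v: "\<And>t j. t \<in> {0<..<b} \<Longrightarrow> cmod (v t j) \<le> E t * \<beta> t" and E: "\<And>t. t \<in> {0<..<b} \<Longrightarrow> 0 \<le> E t"
    and x: "0 < x" "x < b" and t: "t \<in> dom x"
  shows "cmod (integrand A v i t) \<le> total A t * E t * (\<beta> x / \<alpha> i x)"
proof (cases "t \<in> {0<..<b}")
  case False
  then show ?thesis using A by (simp add: integrand_outside total_outside)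
next
  case True
  have a: "0 < \<alpha> i t" "0 < \<alpha> i x" "0 < \<beta> t" using True x by (auto intro: \<alpha>_pos \<beta>_pos)
  have r: "\<beta> t / \<alpha> i t \<le> \<beta> x / \<alpha> i x"
    using ratio[of x t i] dom_order[OF t] True x a by (simp add: field_simps)
  have "cmod (integrand A v i t) = cmod (\<Sum>j\<in>UNIV. A t i j * v t j) / \<alpha> i t"
    using a by (simp add: integrand_def norm_divide)
  also have "\<dots> \<le> (\<Sum>j\<in>UNIV. cmod (A t i j) * (E t * \<beta> t)) / \<alpha> i t"
    using a v[OF True] by (intro divide_right_mono order_trans[OF norm_sum] sum_mono) (auto simp: norm_mult mult_left_mono)
  also have "\<dots> = (\<Sum>j\<in>UNIV. cmod (A t i j)) * E t * (\<beta> t / \<alpha> i t)"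
    by (simp add: sum_distrib_right mult.assoc)
  also have "\<dots> \<le> total A t * E t * (\<beta> x / \<alpha> i x)"
    using r a row_le_total[of A t i] E[OF True] total_nonneg[of A t]
    by (intro mult_mono mult_nonneg_nonneg) (auto simp: sum_nonneg)
  finally show ?thesis .
qed

lemma integrand_measurable:
  assumes A: "coeff A" and v: "weighted v"
  shows "integrand A v i \<in> borel_measurable lebesgue"
proof -
  have "(\<lambda>t. indicator {0<..<b} t *\<^sub>R (v t j / of_real (\<alpha> i t))) \<in> borel_measurable lebesgue" for j
  proof -
    have "continuous_on {0<..<b} (\<lambda>t. v t j / complex_of_real (\<alpha> i t))"
    proof (intro continuous_on_divide continuous_on_of_real \<alpha>_cont ballI)
      show "continuous_on {0<..<b} (\<lambda>t. v t j)" using v by (simp add: weighted_def)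
      show "complex_of_real (\<alpha> i t) \<noteq> 0" if "t \<in> {0<..<b}" for t using \<alpha>_pos[of t i] that by simp
    qed
    then have "(\<lambda>t. indicator {0<..<b} t *\<^sub>R (v t j / of_real (\<alpha> i t))) \<in> borel_measurable borel"
      by (rule borel_measurable_continuous_on_indicator[rotated]) simp
    then show ?thesis using borel_measurable_subalgebra by (simp add: measurable_completion)
  qed
  then have "(\<lambda>t. \<Sum>j\<in>UNIV. A t i j * (indicator {0<..<b} t *\<^sub>R (v t j / of_real (\<alpha> i t)))) \<in> borel_measurable lebesgue"
    using borel_measurable_integrable[OF coeffD(1)[OF A]]
    by (intro borel_measurable_sum borel_measurable_times)
  moreover have "integrand A v i t = (\<Sum>j\<in>UNIV. A t i j * (indicator {0<..<b} t *\<^sub>R (v t j / of_real (\<alpha> i t))))" for t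
  proof (cases "t \<in> {0<..<b}")
    case True
    then show ?thesis by (simp add: integrand_def sum_divide_distrib)
  next
    case False
    then show ?thesis using A by (simp add: integrand_outside coeffD(2))
  qed
  then have "integrand A v i = (\<lambda>t. \<Sum>j\<in>UNIV. A t i j * (indicator {0<..<b} t *\<^sub>R (v t j / of_real (\<alpha> i t))))"
    by (rule ext)
  ultimately show ?thesis by (simp only:)
qed

lemma integrand_integrable:
  assumes A: "coeff A" and v: "weighted v" and x: "0 < x" "x < b"
  shows "integrand A v i absolutely_integrable_on dom x"
proof -
  obtain C where C: "\<forall>x\<in>{0<..<b}. \<forall>i. cmod (v x i) \<le> C * \<beta> x" using v by (auto simp: weighted_def)
  have bd: "cmod (integrand A v i t) \<le> total A t * \<bar>C\<bar> * (\<beta> x / \<alpha> i x)" if "t \<in> dom x" for t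
  proof (rule integrand_bound[OF A _ _ x that])
    fix t j assume t: "t \<in> {0<..<b}"
    have "cmod (v t j) \<le> C * \<beta> t" using C t by blast
    also have "\<dots> \<le> \<bar>C\<bar> * \<beta> t" using \<beta>_pos[of t] t by (intro mult_right_mono) auto
    finally show "cmod (v t j) \<le> \<bar>C\<bar> * \<beta> t" .
  qed simp
  show ?thesis unfolding set_integrable_def
  proof (rule Bochner_Integration.integrable_bound[where f = "\<lambda>t. total A t * (\<bar>C\<bar> * (\<beta> x / \<alpha> i x))"])
    show "integrable lebesgue (\<lambda>t. total A t * (\<bar>C\<bar> * (\<beta> x / \<alpha> i x)))"
      by (intro integrable_mult_left integrable_total A)
    show "(\<lambda>t. indicator (dom x) t *\<^sub>R integrand A v i t) \<in> borel_measurable lebesgue"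
      by (intro borel_measurable_scaleR integrand_measurable A v borel_measurable_indicator dom_sets)
    have "norm (indicator (dom x) t *\<^sub>R integrand A v i t) \<le> norm (total A t * (\<bar>C\<bar> * (\<beta> x / \<alpha> i x)))" for t
    proof (cases "t \<in> dom x")
      case True
      have "cmod (integrand A v i t) \<le> \<bar>total A t * \<bar>C\<bar> * (\<beta> x / \<alpha> i x)\<bar>"
        by (rule order_trans[OF bd[OF True] abs_ge_self])
      then show ?thesis using True by (simp only: mult.assoc real_norm_def indicator_simps scaleR_one)
    qed simp
    then show "AE t in lebesgue. norm (indicator (dom x) t *\<^sub>R integrand A v i t) \<le> norm (total A t * (\<bar>C\<bar> * (\<beta> x / \<alpha> i x)))"
      by simp
  qed
qed

lemma integrand_integrable_on:
  "coeff A \<Longrightarrow> weighted v \<Longrightarrow> 0 < x \<Longrightarrow> x < b \<Longrightarrow> integrand A v i integrable_on dom x"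
  using integrand_integrable by (simp add: set_lebesgue_integral_eq_integral(1))

text \<open>
  Bounds relative to \<beta> are propagated by integration against any majorant \<open>w\<close> of the coefficients.
\<close>
lemma T_bound:
  assumes A: "coeff A" and v: "weighted v" and w: "\<And>t. total A t \<le> w t" and wE: "(\<lambda>t. w t * E t) integrable_on dom x"
    and vE: "\<And>t j. t \<in> {0<..<b} \<Longrightarrow> cmod (v t j) \<le> E t * \<beta> t" and E: "\<And>t. t \<in> {0..b} \<Longrightarrow> 0 \<le> E t"
    and x: "0 < x" "x < b"
  shows "cmod (T A v x i) \<le> integral (dom x) (\<lambda>t. w t * E t) * \<beta> x"
proof -
  have a: "0 < \<alpha> i x" using x by (rule \<alpha>_pos)
  have b: "0 < \<beta> x" using x by (rule \<beta>_pos)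
  have "cmod (integral (dom x) (integrand A v i)) \<le> integral (dom x) (\<lambda>t. (w t * E t) * (\<beta> x / \<alpha> i x))"
  proof (rule Henstock_Kurzweil_Integration.integral_norm_bound_integral)
    show "integrand A v i integrable_on dom x" by (rule integrand_integrable_on[OF A v x])
    show "(\<lambda>t. (w t * E t) * (\<beta> x / \<alpha> i x)) integrable_on dom x" by (rule integrable_on_mult_left[OF wE])
    fix t assume t: "t \<in> dom x"
    have E0: "0 \<le> E t" using dom_subset[of x] t x by (intro E) auto
    have "cmod (integrand A v i t) \<le> total A t * E t * (\<beta> x / \<alpha> i x)"
      by (rule integrand_bound[OF A vE _ x t]) (use E in auto)
    also have "\<dots> \<le> (w t * E t) * (\<beta> x / \<alpha> i x)"
      using w[of t] E0 a b by (intro mult_right_mono) auto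
    finally show "cmod (integrand A v i t) \<le> (w t * E t) * (\<beta> x / \<alpha> i x)" .
  qed
  also have "\<dots> = integral (dom x) (\<lambda>t. w t * E t) * (\<beta> x / \<alpha> i x)" by simp
  finally have "\<alpha> i x * cmod (integral (dom x) (integrand A v i)) \<le> integral (dom x) (\<lambda>t. w t * E t) * \<beta> x"
    using a by (simp add: field_simps)
  then show ?thesis using a by (simp add: T_def norm_mult norm_J)
qed

lemma T_continuous:
  assumes A: "coeff A" and v: "weighted v"
  shows "continuous_on {0<..<b} (\<lambda>x. T A v x i)"
  unfolding T_def
  by (intro continuous_on_mult continuous_on_of_real \<alpha>_cont
      indef_integral_on_continuous_open[OF J_indef[OF integrand_integrable[OF A v]]])

lemma T_add:
  assumes "coeff A" "weighted v" "weighted v'" "0 < x" "x < b"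
  shows "T A (\<lambda>x i. v x i + v' x i) x i = T A v x i + T A v' x i"
proof -
  have eq: "integrand A (\<lambda>x i. v x i + v' x i) i = (\<lambda>t. integrand A v i t + integrand A v' i t)"
    by (rule ext) (simp add: integrand_def add_divide_distrib[symmetric] sum.distrib ring_distribs)
  have "integral (dom x) (integrand A (\<lambda>x i. v x i + v' x i) i)
      = integral (dom x) (integrand A v i) + integral (dom x) (integrand A v' i)"
    unfolding eq by (intro Henstock_Kurzweil_Integration.integral_add integrand_integrable_on assms)
  then show ?thesis by (auto simp: T_def J_def dom_def algebra_simps split: if_splits)
qed

lemma T_cmult: "T A (\<lambda>x i. c * v x i) x i = c * T A v x i"
proof -
  have eq: "integrand A (\<lambda>x i. c * v x i) i = (\<lambda>t. c * integrand A v i t)"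
    by (rule ext) (simp add: integrand_def sum_distrib_left mult_ac)
  show ?thesis unfolding T_def J_def eq by simp
qed

lemma T_coeff_add:
  assumes "coeff A" "coeff B" "weighted v" "0 < x" "x < b"
  shows "T (\<lambda>t i j. A t i j + c * B t i j) v x i = T A v x i + c * T B v x i"
proof -
  have eq: "integrand (\<lambda>t i j. A t i j + c * B t i j) v i = (\<lambda>t. integrand A v i t + c * integrand B v i t)"
    by (rule ext) (simp add: integrand_def add_divide_distrib[symmetric] sum_distrib_left sum.distrib ring_distribs mult.assoc)
  have "integral (dom x) (\<lambda>t. integrand A v i t + c * integrand B v i t)
      = integral (dom x) (integrand A v i) + integral (dom x) (\<lambda>t. c * integrand B v i t)"
    by (intro Henstock_Kurzweil_Integration.integral_add integrable_on_mult_right integrand_integrable_on assms)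
  then show ?thesis unfolding T_def J_def eq by (auto simp: dom_def algebra_simps split: if_splits)
qed

lemma weighted_add: "weighted v \<Longrightarrow> weighted v' \<Longrightarrow> weighted (\<lambda>x i. v x i + v' x i)"
  unfolding weighted_def
proof (elim conjE exE, intro conjI allI)
  fix C C' assume *: "\<forall>x\<in>{0<..<b}. \<forall>i. cmod (v x i) \<le> C * \<beta> x" "\<forall>x\<in>{0<..<b}. \<forall>i. cmod (v' x i) \<le> C' * \<beta> x"
  have "cmod (v x i + v' x i) \<le> (C + C') * \<beta> x" if "x \<in> {0<..<b}" for x i
    using *[rule_format, OF that, of i] norm_triangle_ineq[of "v x i" "v' x i"] by (simp add: ring_distribs)
  then show "\<exists>C. \<forall>x\<in>{0<..<b}. \<forall>i. cmod (v x i + v' x i) \<le> C * \<beta> x" by (intro exI[of _ "C + C'"]) blast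
qed (rule continuous_on_add, blast, blast)

lemma weighted_cmult: "weighted v \<Longrightarrow> weighted (\<lambda>x i. c * v x i)"
  unfolding weighted_def
proof (elim conjE exE, intro conjI allI)
  fix C assume *: "\<forall>x\<in>{0<..<b}. \<forall>i. cmod (v x i) \<le> C * \<beta> x"
  have "cmod (c * v x i) \<le> (cmod c * C) * \<beta> x" if "x \<in> {0<..<b}" for x i
    using mult_left_mono[OF *[rule_format, OF that, of i] norm_ge_zero[of c]] by (simp add: norm_mult mult.assoc)
  then show "\<exists>C. \<forall>x\<in>{0<..<b}. \<forall>i. cmod (c * v x i) \<le> C * \<beta> x" by (intro exI[of _ "cmod c * C"]) blast
qed (auto intro: continuous_on_mult continuous_on_const)

lemma weighted_zero: "weighted (\<lambda>x i. 0)"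
  unfolding weighted_def by (intro conjI exI[of _ 0]) auto

lemma weighted_sum: "finite S \<Longrightarrow> (\<And>n. n \<in> S \<Longrightarrow> weighted (v n)) \<Longrightarrow> weighted (\<lambda>x i. \<Sum>n\<in>S. v n x i)"
  by (induction S rule: finite_induct) (simp_all add: weighted_zero weighted_add)

lemma T_zero: "T A (\<lambda>x i. 0) x i = 0"
  using T_cmult[of A 0 "\<lambda>x i. 0" x i] by simp

lemma T_sum:
  assumes "finite S" "\<And>n. n \<in> S \<Longrightarrow> weighted (v n)" "coeff A" "0 < x" "x < b"
  shows "T A (\<lambda>x i. \<Sum>n\<in>S. v n x i) x i = (\<Sum>n\<in>S. T A (v n) x i)"
  using assms(1,2)
proof (induction S rule: finite_induct)
  case empty
  then show ?case by (simp add: T_zero)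
next
  case (insert n S)
  have "T A (\<lambda>x i. v n x i + (\<Sum>n\<in>S. v n x i)) x i = T A (v n) x i + T A (\<lambda>x i. \<Sum>n\<in>S. v n x i) x i"
    by (intro T_add assms(3-) weighted_sum insert.hyps(1) insert.prems) auto
  then show ?case using insert by simp
qed

lemma T_cong:
  assumes "coeff A" "\<And>t i. t \<in> {0<..<b} \<Longrightarrow> v t i = v' t i"
  shows "T A v = T A v'"
proof -
  have "integrand A v i t = integrand A v' i t" for i t
  proof (cases "t \<in> {0<..<b}")
    case True
    then show ?thesis unfolding integrand_def by (simp only: assms(2))
  next
    case False
    then show ?thesis by (simp only: integrand_outside[OF assms(1)] not_False_eq_True)
  qed
  then have "integrand A v = integrand A v'" by (intro ext)
  then show ?thesis unfolding T_def[abs_def] by simp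
qed

lemma abs_int_total: "coeff A \<Longrightarrow> S \<in> sets lebesgue \<Longrightarrow> total A absolutely_integrable_on S"
  by (intro integrable_imp_abs_int integrable_total)

lemma weighted_T:
  assumes A: "coeff A" and v: "weighted v"
  shows "weighted (T A v)"
  unfolding weighted_def
proof (intro conjI allI T_continuous A v)
  obtain C where C: "\<forall>x\<in>{0<..<b}. \<forall>i. cmod (v x i) \<le> C * \<beta> x" using v by (auto simp: weighted_def)
  define D where "D = integral {0..b} (\<lambda>t. total A t * \<bar>C\<bar>)"
  have int: "(\<lambda>t. total A t * \<bar>C\<bar>) integrable_on S" if "S \<in> sets lebesgue" for S
    by (intro integrable_on_mult_left set_lebesgue_integral_eq_integral(1) abs_int_total A that)
  have "cmod (T A v x i) \<le> D * \<beta> x" if x: "x \<in> {0<..<b}" for x i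
  proof -
    have "cmod (T A v x i) \<le> integral (dom x) (\<lambda>t. total A t * \<bar>C\<bar>) * \<beta> x"
    proof (rule T_bound[OF A v _ int[OF dom_sets]])
      fix t j assume t: "t \<in> {0<..<b}"
      have "cmod (v t j) \<le> C * \<beta> t" using C t by blast
      also have "\<dots> \<le> \<bar>C\<bar> * \<beta> t" using \<beta>_pos[of t] t by (intro mult_right_mono) auto
      finally show "cmod (v t j) \<le> \<bar>C\<bar> * \<beta> t" .
    qed (use x in auto)
    also have "integral (dom x) (\<lambda>t. total A t * \<bar>C\<bar>) \<le> D"
      unfolding D_def using x dom_subset[of x]
      by (intro integral_subset_le int dom_sets) (auto simp: total_nonneg)
    finally show ?thesis using \<beta>_pos[of x] x by (simp add: mult_right_mono)
  qed
  then show "\<exists>C. \<forall>x\<in>{0<..<b}. \<forall>i. cmod (T A v x i) \<le> C * \<beta> x" by (intro exI[of _ D]) blast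
qed

end

text \<open>
  Coefficients that are affine in the spectral parameter, and the equation \<open>u = c \<alpha> + T (A z) u\<close>.
\<close>
locale singular_volterra_system = singular_volterra +
  fixes A0 A1 :: "real \<Rightarrow> 'a::finite \<Rightarrow> 'a \<Rightarrow> complex" and c :: "'a \<Rightarrow> complex" and C0 :: real
  assumes A0: "coeff A0" and A1: "coeff A1"
    and c_bound: "\<And>x i. 0 < x \<Longrightarrow> x < b \<Longrightarrow> cmod (c i) * \<alpha> i x \<le> C0 * \<beta> x"
begin

definition A :: "complex \<Rightarrow> real \<Rightarrow> 'a \<Rightarrow> 'a \<Rightarrow> complex" where
  "A z t i j = A0 t i j + z * A1 t i j"

definition w :: "real \<Rightarrow> real \<Rightarrow> real" where "w R t = total A0 t + R * total A1 t"

definition W :: "real \<Rightarrow> real \<Rightarrow> real" where "W R x = integral (dom x) (w R)"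

primrec iter :: "complex \<Rightarrow> nat \<Rightarrow> real \<Rightarrow> 'a \<Rightarrow> complex" where
  "iter z 0 = (\<lambda>x i. c i * of_real (\<alpha> i x))"
| "iter z (Suc n) = T (A z) (iter z n)"

definition sol :: "complex \<Rightarrow> real \<Rightarrow> 'a \<Rightarrow> complex" where
  "sol z x i = (\<Sum>n. iter z n x i)"

lemma coeff_A: "coeff (A z)"
  unfolding coeff_def A_def[abs_def]
  by (auto intro!: Bochner_Integration.integrable_add integrable_mult_right coeffD(1)[OF A0] coeffD(1)[OF A1]
      simp: coeffD(2)[OF A0] coeffD(2)[OF A1])

lemma total_A_le: "cmod z \<le> R \<Longrightarrow> total (A z) t \<le> w R t"
proof -
  assume z: "cmod z \<le> R"
  have "total (A z) t \<le> (\<Sum>i\<in>UNIV. \<Sum>j\<in>UNIV. cmod (A0 t i j) + R * cmod (A1 t i j))"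
    unfolding total_def A_def
    by (intro sum_mono order_trans[OF norm_triangle_ineq] add_mono order_refl)
       (simp add: norm_mult z mult_right_mono)
  then show ?thesis by (simp add: w_def total_def sum.distrib sum_distrib_left)
qed

lemma w_nonneg: "0 \<le> R \<Longrightarrow> 0 \<le> w R t"
  by (simp add: w_def total_nonneg)

lemma w_abs_int: "S \<in> sets lebesgue \<Longrightarrow> w R absolutely_integrable_on S"
  unfolding w_def[abs_def] by (intro set_integral_add set_integrable_mult_right abs_int_total A0 A1)

lemma w_int: "S \<in> sets lebesgue \<Longrightarrow> w R integrable_on S"
  by (intro set_lebesgue_integral_eq_integral(1) w_abs_int)

lemma C0_nonneg: "0 \<le> C0"
proof -
  obtain x where x: "0 < x" "x < b" using dense[OF b_pos] by blast
  have "0 \<le> cmod (c undefined) * \<alpha> undefined x" using \<alpha>_pos[OF x] by (simp add: less_imp_le)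
  then have "0 \<le> C0 * \<beta> x" using c_bound[OF x] by (rule order_trans)
  then show ?thesis using \<beta>_pos[OF x] by (simp add: zero_le_mult_iff)
qed

lemma W_nonneg: "0 \<le> R \<Longrightarrow> 0 \<le> W R x"
  unfolding W_def by (rule Henstock_Kurzweil_Integration.integral_nonneg) (simp_all add: w_int dom_sets w_nonneg)

lemma W_le: "0 \<le> R \<Longrightarrow> 0 \<le> x \<Longrightarrow> x \<le> b \<Longrightarrow> W R x \<le> integral {0..b} (w R)"
  unfolding W_def by (rule integral_subset_le) (simp_all add: dom_subset w_int dom_sets w_nonneg)

lemma W_mono: "R \<le> R' \<Longrightarrow> W R x \<le> W R' x"
  unfolding W_def by (rule integral_le) (simp_all add: w_int dom_sets w_def mult_right_mono total_nonneg)

definition sgn_dir :: real where "sgn_dir = (if forward then 1 else - 1)"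

lemma W_indef: "indef_integral_on {0..b} (W R) (\<lambda>t. sgn_dir * w R t)"
  unfolding indef_integral_on_def
proof (intro ballI impI conjI)
  fix x y assume xy: "x \<in> {0..b}" "y \<in> {0..b}" "x \<le> y"
  show "(\<lambda>t. sgn_dir * w R t) absolutely_integrable_on {x..y}"
    by (intro set_integrable_mult_right w_abs_int) simp
  have "integral {x..y} (w R) = sgn_dir * (W R y - W R x)"
  proof (cases forward)
    case True
    have "integral {0..x} (w R) + integral {x..y} (w R) = integral {0..y} (w R)"
      by (rule Henstock_Kurzweil_Integration.integral_combine) (use xy in \<open>simp_all add: w_int\<close>)
    then show ?thesis unfolding W_def dom_def sgn_dir_def using True by (simp add: algebra_simps)
  next
    case False
    have "integral {x..y} (w R) + integral {y..b} (w R) = integral {x..b} (w R)"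
      by (rule Henstock_Kurzweil_Integration.integral_combine) (use xy in \<open>simp_all add: w_int\<close>)
    then show ?thesis unfolding W_def dom_def sgn_dir_def using False by (simp add: algebra_simps)
  qed
  then have "integral {x..y} (\<lambda>t. sgn_dir * w R t) = W R y - W R x" by (simp add: sgn_dir_def)
  moreover have "(\<lambda>t. sgn_dir * w R t) integrable_on {x..y}"
    by (intro integrable_on_mult_right w_int) simp
  ultimately show "((\<lambda>t. sgn_dir * w R t) has_integral W R y - W R x) {x..y}"
    using integrable_integral by metis
qed

text \<open>
  The integral that turns the bound \<open>W\<^sup>n / n!\<close> into the next one.
\<close>
lemma W_power_integral:
  assumes x: "0 \<le> x" "x \<le> b"
  shows "((\<lambda>t. w R t * W R t ^ n) has_integral (W R x ^ Suc n / of_nat (Suc n))) (dom x)"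
proof -
  note P = indef_integral_on_power[OF W_indef is_interval_cc, of R n]
  have eq: "(1 / (sgn_dir * of_nat (Suc n))) * (of_nat (Suc n) * (sgn_dir * w R t * W R t ^ n)) = w R t * W R t ^ n" for t
    by (simp add: sgn_dir_def)
  show ?thesis
  proof (cases forward)
    case True
    have "W R 0 = 0" unfolding W_def dom_def using True by simp
    then have "((\<lambda>t. of_nat (Suc n) * (sgn_dir * w R t * W R t ^ n)) has_integral (W R x ^ Suc n)) {0..x}"
      using indef_integral_onD(2)[OF P, of 0 x] x by simp
    from has_integral_mult_right[OF this, of "1 / (sgn_dir * of_nat (Suc n))"]
    moreover have "sgn_dir = 1" unfolding sgn_dir_def using True by simp
    ultimately show ?thesis unfolding eq dom_def using True by simp
  next
    case False
    have "W R b = 0" unfolding W_def dom_def using False by simp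
    then have "((\<lambda>t. of_nat (Suc n) * (sgn_dir * w R t * W R t ^ n)) has_integral (- (W R x ^ Suc n))) {x..b}"
      using indef_integral_onD(2)[OF P, of x b] x by simp
    from has_integral_mult_right[OF this, of "1 / (sgn_dir * of_nat (Suc n))"]
    moreover have "1 / (sgn_dir * of_nat (Suc n)) * - (W R x ^ Suc n) = W R x ^ Suc n / of_nat (Suc n)"
      unfolding sgn_dir_def using False by (simp del: of_nat_Suc power_Suc)
    ultimately show ?thesis unfolding eq dom_def using False by simp
  qed
qed

lemma weighted_iter: "weighted (iter z n)"
proof (induction n)
  case 0
  show ?case unfolding weighted_def iter.simps
  proof (intro conjI allI exI[of _ C0] ballI)
    show "cmod (c i * of_real (\<alpha> i x)) \<le> C0 * \<beta> x" if "x \<in> {0<..<b}" for x i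
      using c_bound[of x i] \<alpha>_pos[of x i] that by (simp add: norm_mult)
    show "continuous_on {0<..<b} (\<lambda>x. c i * complex_of_real (\<alpha> i x))" for i
      by (intro continuous_on_mult continuous_on_const continuous_on_of_real \<alpha>_cont)
  qed
next
  case (Suc n)
  then show ?case by (simp add: weighted_T coeff_A)
qed

lemma iter_bound:
  assumes z: "cmod z \<le> R"
  shows "0 < x \<Longrightarrow> x < b \<Longrightarrow> cmod (iter z n x i) \<le> (C0 * (W R x ^ n / fact n)) * \<beta> x"
proof (induction n arbitrary: x i)
  case 0
  then show ?case using c_bound[of x i] \<alpha>_pos[of x i] by (simp add: norm_mult)
next
  case (Suc n)
  have R: "0 \<le> R" using z norm_ge_zero order_trans by blast
  have hi: "((\<lambda>t. w R t * (C0 * (W R t ^ n / fact n))) has_integral (C0 * (W R x ^ Suc n / fact (Suc n)))) (dom x)"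
    using has_integral_mult_right[OF W_power_integral[of x R n], of "C0 / fact n"] Suc.prems
    by (simp add: mult_ac)
  have "cmod (T (A z) (iter z n) x i) \<le> integral (dom x) (\<lambda>t. w R t * (C0 * (W R t ^ n / fact n))) * \<beta> x"
  proof (rule T_bound[OF coeff_A weighted_iter total_A_le[OF z]])
    show "(\<lambda>t. w R t * (C0 * (W R t ^ n / fact n))) integrable_on dom x" using hi by blast
    show "cmod (iter z n t j) \<le> C0 * (W R t ^ n / fact n) * \<beta> t" if "t \<in> {0<..<b}" for t j
      using Suc.IH[of t j] that by simp
    show "0 \<le> C0 * (W R t ^ n / fact n)" for t using C0_nonneg W_nonneg[OF R, of t] by simp
  qed (use Suc.prems in auto)
  then show ?case unfolding integral_unique[OF hi] iter.simps .
qed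

lemma summable_majorant: "summable (\<lambda>n. C0 * (W R x ^ n / fact n) * \<beta> x)"
  using summable_exp[of "W R x"]
  by (intro summable_mult2 summable_mult) (simp add: divide_inverse mult.commute)

lemma summable_iter: "0 < x \<Longrightarrow> x < b \<Longrightarrow> summable (\<lambda>n. iter z n x i)"
  by (rule summable_comparison_test'[OF summable_majorant[of "cmod z" x]]) (rule iter_bound[OF order_refl])

text \<open>
  The iterates are polynomials in \<open>z\<close>, so the solution is a locally uniform limit of entire functions.
\<close>
lemma iter_polynomial:
  "\<exists>p. (\<forall>j. weighted (p j)) \<and> (\<forall>z x i. 0 < x \<longrightarrow> x < b \<longrightarrow> iter z n x i = (\<Sum>j\<le>n. z ^ j * p j x i))"
proof (induction n)
  case 0
  show ?case
    by (rule exI[of _ "\<lambda>_. iter 0 0"]) (simp only: weighted_iter, simp)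
next
  case (Suc n)
  then obtain p where p: "\<forall>j. weighted (p j)" and
    it: "\<forall>z x i. 0 < x \<longrightarrow> x < b \<longrightarrow> iter z n x i = (\<Sum>j\<le>n. z ^ j * p j x i)"
    by (elim exE conjE)
  define p' where "p' = (\<lambda>j x i. (if j \<le> n then 1 else 0) * T A0 (p j) x i + (if j = 0 then 0 else 1) * T A1 (p (j - 1)) x i)"
  have "weighted (p' j)" for j
    unfolding p'_def using p by (intro weighted_add weighted_cmult weighted_T A0 A1) auto
  moreover have "iter z (Suc n) x i = (\<Sum>j\<le>Suc n. z ^ j * p' j x i)" if x: "0 < x" "x < b" for z x i
  proof -
    let ?S = "\<lambda>x i. \<Sum>j\<le>n. z ^ j * p j x i"
    have S: "weighted ?S" using p by (intro weighted_sum weighted_cmult) auto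
    have ex: "T B ?S x i = (\<Sum>j\<le>n. z ^ j * T B (p j) x i)" if "coeff B" for B
      using T_sum[OF finite_atMost[of n] _ that x, of "\<lambda>j x i. z ^ j * p j x i" i] p
      by (simp add: weighted_cmult T_cmult)
    have "iter z (Suc n) x i = T (A z) ?S x i"
      unfolding iter.simps by (subst T_cong[OF coeff_A, of "iter z n" ?S]) (use it in auto)
    also have "\<dots> = T A0 ?S x i + z * T A1 ?S x i"
      unfolding A_def[abs_def] by (rule T_coeff_add[OF A0 A1 S x])
    also have "\<dots> = (\<Sum>j\<le>n. z ^ j * T A0 (p j) x i) + (\<Sum>j\<le>n. z ^ Suc j * T A1 (p j) x i)"
      unfolding ex[OF A0] ex[OF A1] by (simp add: sum_distrib_left mult.assoc)
    also have "(\<Sum>j\<le>n. z ^ j * T A0 (p j) x i) = (\<Sum>j\<le>Suc n. z ^ j * ((if j \<le> n then 1 else 0) * T A0 (p j) x i))"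
      by simp
    also have "(\<Sum>j\<le>n. z ^ Suc j * T A1 (p j) x i)
        = (\<Sum>j\<le>Suc n. z ^ j * ((if j = 0 then 0 else 1) * T A1 (p (j - 1)) x i))"
      by (subst sum.atMost_Suc_shift) simp
    finally show ?thesis unfolding p'_def by (simp only: sum.distrib[symmetric] distrib_left)
  qed
  ultimately show ?case by (intro exI[of _ p'] conjI allI impI)
qed

lemma iter_holomorphic: "0 < x \<Longrightarrow> x < b \<Longrightarrow> (\<lambda>z. iter z n x i) holomorphic_on UNIV"
proof -
  assume x: "0 < x" "x < b"
  obtain p where it: "\<forall>z x i. 0 < x \<longrightarrow> x < b \<longrightarrow> iter z n x i = (\<Sum>j\<le>n. z ^ j * p j x i)"
    using iter_polynomial[of n] by (elim exE conjE)
  have "(\<lambda>z. \<Sum>j\<le>n. z ^ j * p j x i) holomorphic_on UNIV" by (intro holomorphic_intros)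
  then show ?thesis by (rule holomorphic_transform) (use it x in simp)
qed

lemma sol_holomorphic: "0 < x \<Longrightarrow> x < b \<Longrightarrow> (\<lambda>z. sol z x i) holomorphic_on UNIV"
proof -
  assume x: "0 < x" "x < b"
  show ?thesis
  proof (rule holomorphic_uniform_sequence[where f = "\<lambda>N z. \<Sum>n<N. iter z n x i"])
    show "(\<lambda>z. \<Sum>n<N. iter z n x i) holomorphic_on UNIV" for N
      by (intro holomorphic_on_sum iter_holomorphic x)
    fix z0 :: complex
    have "uniform_limit (cball z0 1) (\<lambda>N z. \<Sum>n<N. iter z n x i) (\<lambda>z. sol z x i) sequentially"
      unfolding sol_def
    proof (rule Weierstrass_m_test[OF _ summable_majorant])
      fix n z assume "z \<in> cball z0 1"
      then have "cmod z \<le> cmod z0 + 1"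
        using norm_triangle_ineq4[of z0 "z0 - z"] by (simp add: dist_norm)
      then show "cmod (iter z n x i) \<le> C0 * (W (cmod z0 + 1) x ^ n / fact n) * \<beta> x"
        by (rule iter_bound) (use x in auto)
    qed
    then show "\<exists>d>0. cball z0 d \<subseteq> UNIV \<and> uniform_limit (cball z0 d) (\<lambda>N z. \<Sum>n<N. iter z n x i) (\<lambda>z. sol z x i) sequentially"
      by (intro exI[of _ 1]) simp
  qed simp
qed

lemma exp_tail:
  assumes "0 \<le> (y :: real)" "y \<le> Y"
  shows "(\<Sum>n. y ^ (n + N) / fact (n + N)) \<le> (\<Sum>n. Y ^ (n + N) / fact (n + N))"
proof (rule suminf_le)
  have s: "summable (\<lambda>n. v ^ (n + N) / fact (n + N))" for v :: real
    using summable_ignore_initial_segment[OF summable_exp[of v], of N] by (simp add: divide_inverse mult.commute)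
  show "summable (\<lambda>n. y ^ (n + N) / fact (n + N))" "summable (\<lambda>n. Y ^ (n + N) / fact (n + N))" by (rule s)+
  show "y ^ (n + N) / fact (n + N) \<le> Y ^ (n + N) / fact (n + N)" for n
    using assms by (intro divide_right_mono power_mono) auto
qed

definition tail :: "real \<Rightarrow> nat \<Rightarrow> real" where
  "tail R N = C0 * (\<Sum>n. integral {0..b} (w R) ^ (n + N) / fact (n + N))"

lemma sol_tail:
  assumes x: "0 < x" "x < b"
  shows "cmod (sol z x i - (\<Sum>n<N. iter z n x i)) \<le> C0 * (\<Sum>n. W (cmod z) x ^ (n + N) / fact (n + N)) * \<beta> x"
    "cmod (sol z x i - (\<Sum>n<N. iter z n x i)) \<le> tail (cmod z) N * \<beta> x"
proof -
  have s: "summable (\<lambda>n. v ^ (n + N) / fact (n + N))" for v :: real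
    using summable_ignore_initial_segment[OF summable_exp[of v], of N] by (simp add: divide_inverse mult.commute)
  have bd: "cmod (iter z n x i) \<le> C0 * (W (cmod z) x ^ n / fact n) * \<beta> x" for n
    by (rule iter_bound[OF order_refl x])
  have "sol z x i - (\<Sum>n<N. iter z n x i) = (\<Sum>n. iter z (n + N) x i)"
    unfolding sol_def using suminf_minus_initial_segment[OF summable_iter[OF x, of z i], of N] by simp
  also have "cmod \<dots> \<le> (\<Sum>n. C0 * (W (cmod z) x ^ (n + N) / fact (n + N)) * \<beta> x)"
    by (intro norm_suminf_le bd summable_mult2 summable_mult s)
  also have "\<dots> = C0 * (\<Sum>n. W (cmod z) x ^ (n + N) / fact (n + N)) * \<beta> x"
    by (simp only: suminf_mult2[symmetric, OF summable_mult[OF s]] suminf_mult[OF s])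
  finally show 1: "cmod (sol z x i - (\<Sum>n<N. iter z n x i))
     \<le> C0 * (\<Sum>n. W (cmod z) x ^ (n + N) / fact (n + N)) * \<beta> x" .
  also have "\<dots> \<le> tail (cmod z) N * \<beta> x"
    unfolding tail_def using x \<beta>_pos[OF x] C0_nonneg W_nonneg[of "cmod z" x] W_le[of "cmod z" x]
    by (intro mult_right_mono mult_left_mono exp_tail) auto
  finally show "cmod (sol z x i - (\<Sum>n<N. iter z n x i)) \<le> tail (cmod z) N * \<beta> x" .
qed

lemma tail_tendsto_0: "tail R \<longlonglongrightarrow> 0"
proof -
  have "summable (\<lambda>n. integral {0..b} (w R) ^ n / fact n)"
    using summable_exp[of "integral {0..b} (w R)"] by (simp add: divide_inverse mult.commute)
  from suminf_exist_split2[OF this] show ?thesis unfolding tail_def by (auto intro!: tendsto_mult_right_zero)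
qed

text \<open>
  The second bound is the one that gives the behaviour at the initial endpoint, where \<open>W\<close> vanishes.
\<close>
lemma sol_bound:
  assumes x: "0 < x" "x < b"
  shows "cmod (sol z x i) \<le> C0 * exp (W (cmod z) x) * \<beta> x"
    "cmod (sol z x i - c i * of_real (\<alpha> i x)) \<le> C0 * (exp (W (cmod z) x) - 1) * \<beta> x"
proof -
  have e: "(\<Sum>n. v ^ n / fact n) = exp v" for v :: real
    by (simp add: exp_def divide_inverse mult.commute)
  have sm: "summable (\<lambda>n. v ^ n / fact n)" for v :: real
    using summable_exp[of v] by (simp add: divide_inverse mult.commute)
  show "cmod (sol z x i) \<le> C0 * exp (W (cmod z) x) * \<beta> x"
    using sol_tail(1)[OF x, of z i 0] by (simp add: e)
  have "(\<Sum>n. W (cmod z) x ^ (n + 1) / fact (n + 1)) = exp (W (cmod z) x) - 1"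
    using suminf_split_head[OF sm[of "W (cmod z) x"]] by (simp add: e)
  then show "cmod (sol z x i - c i * of_real (\<alpha> i x)) \<le> C0 * (exp (W (cmod z) x) - 1) * \<beta> x"
    using sol_tail(1)[OF x, of z i 1] by simp
qed

text \<open>
  The series converges uniformly after division by \<beta>, which yields continuity.
\<close>
lemma weighted_sol: "weighted (sol z)"
  unfolding weighted_def
proof (intro conjI allI)
  have "cmod (sol z x i) \<le> tail (cmod z) 0 * \<beta> x" if "x \<in> {0<..<b}" for x i
    using sol_tail(2)[of x z i 0] that by simp
  then show "\<exists>C. \<forall>x\<in>{0<..<b}. \<forall>i. cmod (sol z x i) \<le> C * \<beta> x" by (intro exI[of _ "tail (cmod z) 0"]) blast
  fix i
  have "uniform_limit {0<..<b} (\<lambda>N x. (\<Sum>n<N. iter z n x i) / of_real (\<beta> x)) (\<lambda>x. sol z x i / of_real (\<beta> x)) sequentially"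
  proof (rule uniform_limitI)
    fix e :: real assume "0 < e"
    with tail_tendsto_0[of "cmod z"] have "\<forall>\<^sub>F N in sequentially. tail (cmod z) N < e" by (rule order_tendstoD)
    then show "\<forall>\<^sub>F N in sequentially. \<forall>x\<in>{0<..<b}. dist ((\<Sum>n<N. iter z n x i) / of_real (\<beta> x)) (sol z x i / of_real (\<beta> x)) < e"
    proof eventually_elim
      case (elim N)
      show ?case
      proof
        fix x assume x: "x \<in> {0<..<b}"
        have b: "0 < \<beta> x" using x by (intro \<beta>_pos) auto
        have "dist ((\<Sum>n<N. iter z n x i) / of_real (\<beta> x)) (sol z x i / of_real (\<beta> x))
            = cmod (sol z x i - (\<Sum>n<N. iter z n x i)) / \<beta> x"
          using b by (simp add: dist_norm diff_divide_distrib[symmetric] norm_divide norm_minus_commute)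
        also have "\<dots> \<le> tail (cmod z) N" using sol_tail(2)[of x z i N] x b by (simp add: divide_le_eq)
        finally show "dist ((\<Sum>n<N. iter z n x i) / of_real (\<beta> x)) (sol z x i / of_real (\<beta> x)) < e" using elim by simp
      qed
    qed
  qed
  moreover have "continuous_on {0<..<b} (\<lambda>x. (\<Sum>n<N. iter z n x i) / of_real (\<beta> x))" for N
  proof (intro continuous_on_divide continuous_on_sum continuous_on_of_real \<beta>_cont ballI)
    show "continuous_on {0<..<b} (\<lambda>x. iter z n x i)" for n using weighted_iter[of z n] by (simp add: weighted_def)
    show "complex_of_real (\<beta> x) \<noteq> 0" if "x \<in> {0<..<b}" for x using \<beta>_pos[of x] that by simp
  qed
  ultimately have "continuous_on {0<..<b} (\<lambda>x. sol z x i / of_real (\<beta> x))"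
    by (intro uniform_limit_theorem[where F = sequentially]) auto
  then have "continuous_on {0<..<b} (\<lambda>x. sol z x i / of_real (\<beta> x) * of_real (\<beta> x))"
    by (intro continuous_on_mult continuous_on_of_real \<beta>_cont)
  then show "continuous_on {0<..<b} (\<lambda>x. sol z x i)"
  proof (rule continuous_on_eq)
    show "sol z x i / of_real (\<beta> x) * of_real (\<beta> x) = sol z x i" if "x \<in> {0<..<b}" for x
      using \<beta>_pos[of x] that by simp
  qed
qed

lemma sol_equation:
  assumes x: "0 < x" "x < b"
  shows "sol z x i = of_real (\<alpha> i x) * (c i + J (integrand (A z) (sol z) i) x)"
proof -
  define S where "S = (\<lambda>N x i. \<Sum>n<N. iter z n x i)"
  have wS: "weighted (S N)" for N unfolding S_def by (intro weighted_sum weighted_iter) simp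
  have "(\<lambda>N. T (A z) (S N) x i) \<longlonglongrightarrow> T (A z) (sol z) x i"
  proof (rule LIM_zero_cancel, rule Lim_null_comparison)
    define D where "D = integral (dom x) (w (cmod z)) * \<beta> x"
    show "\<forall>\<^sub>F N in sequentially. cmod (T (A z) (S N) x i - T (A z) (sol z) x i) \<le> tail (cmod z) N * D"
    proof (rule always_eventually, rule allI)
      fix N
      let ?d = "\<lambda>x i. S N x i + (- 1) * sol z x i"
      have wd: "weighted ?d" by (intro weighted_add weighted_cmult wS weighted_sol)
      have "T (A z) ?d x i = T (A z) (S N) x i + T (A z) (\<lambda>x i. (- 1) * sol z x i) x i"
        by (intro T_add coeff_A wS weighted_cmult weighted_sol x)
      then have eq: "T (A z) (S N) x i - T (A z) (sol z) x i = T (A z) ?d x i" unfolding T_cmult by simp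
      have t0: "0 \<le> tail (cmod z) N"
        unfolding tail_def using C0_nonneg W_nonneg[of "cmod z" 0] W_le[of "cmod z" 0] b_pos
        by (intro mult_nonneg_nonneg suminf_nonneg summable_ignore_initial_segment[where f = "\<lambda>n. integral {0..b} (w (cmod z)) ^ n / fact n"])
           (use summable_exp[of "integral {0..b} (w (cmod z))"] in \<open>auto simp: divide_inverse mult.commute\<close>)
      have "cmod (T (A z) ?d x i) \<le> integral (dom x) (\<lambda>t. w (cmod z) t * tail (cmod z) N) * \<beta> x"
      proof (rule T_bound[OF coeff_A wd total_A_le[OF order_refl]])
        show "(\<lambda>t. w (cmod z) t * tail (cmod z) N) integrable_on dom x"
          by (intro integrable_on_mult_left w_int dom_sets)
        show "cmod (S N t j + - 1 * sol z t j) \<le> tail (cmod z) N * \<beta> t" if "t \<in> {0<..<b}" for t j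
          using sol_tail(2)[of t z j N] that by (simp add: S_def norm_minus_commute)
      qed (use x t0 in auto)
      then show "cmod (T (A z) (S N) x i - T (A z) (sol z) x i) \<le> tail (cmod z) N * D"
        unfolding eq D_def by (simp add: mult_ac)
    qed
    show "(\<lambda>N. tail (cmod z) N * D) \<longlonglongrightarrow> 0" by (rule tendsto_mult_left_zero[OF tail_tendsto_0])
  qed
  moreover have "T (A z) (S N) x i = S (Suc N) x i - iter z 0 x i" for N
  proof -
    have "T (A z) (S N) x i = (\<Sum>n<N. iter z (Suc n) x i)"
      unfolding S_def iter.simps by (rule T_sum) (simp_all add: weighted_iter coeff_A x)
    also have "\<dots> = S (Suc N) x i - iter z 0 x i"
      unfolding S_def by (subst sum.lessThan_Suc_shift) simp
    finally show ?thesis .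
  qed
  moreover have "(\<lambda>N. S (Suc N) x i - iter z 0 x i) \<longlonglongrightarrow> sol z x i - iter z 0 x i"
    unfolding S_def sol_def
    by (intro tendsto_diff tendsto_const LIMSEQ_Suc summable_LIMSEQ summable_iter x)
  ultimately have "T (A z) (sol z) x i = sol z x i - iter z 0 x i" by (simp add: LIMSEQ_unique)
  then show ?thesis by (simp add: T_def algebra_simps)
qed

lemma integral_in_Reals: "(\<And>t. f t \<in> \<real>) \<Longrightarrow> integral S (f :: real \<Rightarrow> complex) \<in> \<real>"
proof (cases "f integrable_on S")
  case True
  assume "\<And>t. f t \<in> \<real>"
  then have "Im \<circ> f = (\<lambda>t. 0)" by (auto simp: complex_is_Real_iff)
  then have "Im (integral S f) = 0" using integral_linear[OF True bounded_linear_Im] by simp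
  then show ?thesis by (simp add: complex_is_Real_iff)
qed (simp add: not_integrable_integral)

lemma J_in_Reals: "(\<And>S. integral S \<phi> \<in> \<real>) \<Longrightarrow> J \<phi> x \<in> \<real>"
  by (simp add: J_def)

lemma sol_real:
  assumes r: "\<And>t i j. A0 t i j \<in> \<real>" "\<And>t i j. A1 t i j \<in> \<real>" "\<And>i. c i \<in> \<real>" and z: "z \<in> \<real>" and x: "0 < x" "x < b"
  shows "sol z x i \<in> \<real>"
proof -
  have "iter z n t i \<in> \<real>" for n t i
  proof (induction n arbitrary: t i)
    case (Suc n)
    have "integrand (A z) (iter z n) i s \<in> \<real>" for s
      unfolding integrand_def A_def
      by (intro Reals_divide sum_in_Reals Reals_mult Reals_add r z Suc.IH Reals_of_real)
    then have "integral S (integrand (A z) (iter z n) i) \<in> \<real>" for S by (rule integral_in_Reals)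
    then have "J (integrand (A z) (iter z n) i) t \<in> \<real>" by (rule J_in_Reals)
    then show ?case unfolding iter.simps T_def by (intro Reals_mult Reals_of_real)
  qed (simp add: r)
  then have "\<forall>N. (\<Sum>n<N. iter z n x i) \<in> \<real>" by (intro allI sum_in_Reals)
  moreover have "(\<lambda>N. \<Sum>n<N. iter z n x i) \<longlonglongrightarrow> sol z x i"
    unfolding sol_def by (rule summable_LIMSEQ[OF summable_iter[OF x]])
  ultimately show ?thesis by (metis closed_sequentially[OF closed_complex_Reals])
qed

end

section \<open>Solutions of the radial Dirac equation\<close>

lemma absolutely_integrable_vec2_iff:
  fixes f :: "real \<Rightarrow> complex^2"
  shows "f absolutely_integrable_on S \<longleftrightarrow>
    (\<lambda>x. f x $ 1) absolutely_integrable_on S \<and> (\<lambda>x. f x $ 2) absolutely_integrable_on S"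
proof
  assume f: "f absolutely_integrable_on S"
  have "(\<lambda>x. f x $ i) absolutely_integrable_on S" for i
    using absolutely_integrable_linear[OF f bounded_linear_vec_nth[of i]] by (simp add: o_def)
  then show "(\<lambda>x. f x $ 1) absolutely_integrable_on S \<and> (\<lambda>x. f x $ 2) absolutely_integrable_on S" by blast
next
  assume f: "(\<lambda>x. f x $ 1) absolutely_integrable_on S \<and> (\<lambda>x. f x $ 2) absolutely_integrable_on S"
  have ax: "bounded_linear (axis i :: complex \<Rightarrow> complex^2)" for i
    by (rule linear_conv_bounded_linear[THEN iffD1], rule linearI)
       (simp_all add: Finite_Cartesian_Product.vec_eq_iff axis_def)
  have "(\<lambda>x. axis 1 (f x $ 1) + axis 2 (f x $ 2) :: complex^2) absolutely_integrable_on S"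
    using absolutely_integrable_linear[OF conjunct1[OF f] ax[of 1]]
      absolutely_integrable_linear[OF conjunct2[OF f] ax[of 2]]
    unfolding o_def by (rule set_integral_add(1))
  moreover have "axis 1 (f x $ 1) + axis 2 (f x $ 2) = f x" for x :: real
    by (simp add: Finite_Cartesian_Product.vec_eq_iff forall_2 axis_def)
  ultimately show "f absolutely_integrable_on S" by simp
qed

lemma has_integral_vec2_iff:
  fixes f :: "real \<Rightarrow> complex^2"
  shows "(f has_integral y) S \<longleftrightarrow>
    ((\<lambda>x. f x $ 1) has_integral y $ 1) S \<and> ((\<lambda>x. f x $ 2) has_integral y $ 2) S"
proof
  assume f: "(f has_integral y) S"
  have "((\<lambda>x. f x $ i) has_integral y $ i) S" for i
    using has_integral_linear[OF f bounded_linear_vec_nth[of i]] by (simp add: o_def)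
  then show "((\<lambda>x. f x $ 1) has_integral y $ 1) S \<and> ((\<lambda>x. f x $ 2) has_integral y $ 2) S" by blast
next
  assume f: "((\<lambda>x. f x $ 1) has_integral y $ 1) S \<and> ((\<lambda>x. f x $ 2) has_integral y $ 2) S"
  have ax: "bounded_linear (axis i :: complex \<Rightarrow> complex^2)" for i
    by (rule linear_conv_bounded_linear[THEN iffD1], rule linearI)
       (simp_all add: Finite_Cartesian_Product.vec_eq_iff axis_def)
  have "((\<lambda>x. axis 1 (f x $ 1) + axis 2 (f x $ 2) :: complex^2) has_integral (axis 1 (y $ 1) + axis 2 (y $ 2) :: complex^2)) S"
    using has_integral_linear[OF conjunct1[OF f] ax[of 1]]
      has_integral_linear[OF conjunct2[OF f] ax[of 2]]
    unfolding o_def by (rule has_integral_add)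
  moreover have "axis 1 (v $ 1) + axis 2 (v $ 2) = v" for v :: "complex^2"
    by (simp add: Finite_Cartesian_Product.vec_eq_iff forall_2 axis_def)
  ultimately show "(f has_integral y) S" by simp
qed

text \<open>
  The two components can be treated separately, which reduces the vector calculus to the scalar one.
\<close>
lemma has_ac_derivative_iff:
  "has_ac_derivative b u u' \<longleftrightarrow>
     indef_integral_on {0<..<b} (\<lambda>x. u x $ 1) (\<lambda>x. u' x $ 1) \<and>
     indef_integral_on {0<..<b} (\<lambda>x. u x $ 2) (\<lambda>x. u' x $ 2)"
  unfolding has_ac_derivative_def indef_integral_on_def absolutely_integrable_vec2_iff
    has_integral_vec2_iff[of u'] vector_minus_component
proof
  assume *: "\<forall>x y. 0 < x \<and> x \<le> y \<and> y < b \<longrightarrow>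
     ((\<lambda>x. u' x $ 1) absolutely_integrable_on {x..y} \<and> (\<lambda>x. u' x $ 2) absolutely_integrable_on {x..y}) \<and>
     ((\<lambda>x. u' x $ 1) has_integral u y $ 1 - u x $ 1) {x..y} \<and> ((\<lambda>x. u' x $ 2) has_integral u y $ 2 - u x $ 2) {x..y}"
  have "(\<lambda>x. u' x $ i) absolutely_integrable_on {x..y} \<and> ((\<lambda>x. u' x $ i) has_integral u y $ i - u x $ i) {x..y}"
    if "x \<in> {0<..<b}" "y \<in> {0<..<b}" "x \<le> y" for x y i
    using *[rule_format, of x y] that exhaust_2[of i] by auto
  then show "(\<forall>x\<in>{0<..<b}. \<forall>y\<in>{0<..<b}. x \<le> y \<longrightarrow>
     (\<lambda>x. u' x $ 1) absolutely_integrable_on {x..y} \<and> ((\<lambda>x. u' x $ 1) has_integral u y $ 1 - u x $ 1) {x..y}) \<and>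
    (\<forall>x\<in>{0<..<b}. \<forall>y\<in>{0<..<b}. x \<le> y \<longrightarrow>
     (\<lambda>x. u' x $ 2) absolutely_integrable_on {x..y} \<and> ((\<lambda>x. u' x $ 2) has_integral u y $ 2 - u x $ 2) {x..y})"
    by blast
next
  assume *: "(\<forall>x\<in>{0<..<b}. \<forall>y\<in>{0<..<b}. x \<le> y \<longrightarrow>
     (\<lambda>x. u' x $ 1) absolutely_integrable_on {x..y} \<and> ((\<lambda>x. u' x $ 1) has_integral u y $ 1 - u x $ 1) {x..y}) \<and>
    (\<forall>x\<in>{0<..<b}. \<forall>y\<in>{0<..<b}. x \<le> y \<longrightarrow>
     (\<lambda>x. u' x $ 2) absolutely_integrable_on {x..y} \<and> ((\<lambda>x. u' x $ 2) has_integral u y $ 2 - u x $ 2) {x..y})"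
  show "\<forall>x y. 0 < x \<and> x \<le> y \<and> y < b \<longrightarrow>
     ((\<lambda>x. u' x $ 1) absolutely_integrable_on {x..y} \<and> (\<lambda>x. u' x $ 2) absolutely_integrable_on {x..y}) \<and>
     ((\<lambda>x. u' x $ 1) has_integral u y $ 1 - u x $ 1) {x..y} \<and> ((\<lambda>x. u' x $ 2) has_integral u y $ 2 - u x $ 2) {x..y}"
  proof (intro allI impI)
    fix x y assume "0 < x \<and> x \<le> y \<and> y < b"
    then have m: "x \<in> {0<..<b}" "y \<in> {0<..<b}" "x \<le> y" by simp_all
    show "((\<lambda>x. u' x $ 1) absolutely_integrable_on {x..y} \<and> (\<lambda>x. u' x $ 2) absolutely_integrable_on {x..y}) \<and>
     ((\<lambda>x. u' x $ 1) has_integral u y $ 1 - u x $ 1) {x..y} \<and> ((\<lambda>x. u' x $ 2) has_integral u y $ 2 - u x $ 2) {x..y}"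
      using conjunct1[OF *, rule_format, OF m] conjunct2[OF *, rule_format, OF m] by simp
  qed
qed

lemma absolutely_integrable_if_regular:
  fixes Q :: "real \<Rightarrow> complex^2^2"
  assumes "L1_loc_at_0 b Q" "regular_endpoint b Q"
  shows "(\<lambda>x. Q x $ i $ j) absolutely_integrable_on {0<..<b}"
proof -
  obtain c where c: "c \<in> {0<..<b}" and 2: "(\<lambda>x. Q x $ i $ j) absolutely_integrable_on {c<..<b}"
    using assms(2) by (auto simp: regular_endpoint_def)
  obtain d where d: "c < d" "d < b" using c dense by auto
  have 1: "(\<lambda>x. Q x $ i $ j) absolutely_integrable_on {0<..<d}"
    using assms(1) c d by (simp add: L1_loc_at_0_def)
  have "{0<..<d} \<union> {c<..<b} = {0<..<b}" using c d by auto
  with set_integrable_Un[OF 1 2] show ?thesis by simp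
qed

text \<open>
  The diagonal entries \<open>p11\<close>, \<open>p22\<close> combine the electrostatic potential with mass and scalar potential,
  and \<open>p12\<close> is the anomalous magnetic moment.
\<close>
locale dirac_system =
  fixes \<kappa> b :: real and p11 p12 p22 :: "real \<Rightarrow> real" and Q :: "real \<Rightarrow> complex^2^2"
  assumes b: "0 < b" and \<kappa>: "0 < \<kappa>"
    and Q: "\<And>x. Q x $ 1 $ 1 = of_real (p11 x)" "\<And>x. Q x $ 1 $ 2 = of_real (p12 x)"
      "\<And>x. Q x $ 2 $ 1 = of_real (p12 x)" "\<And>x. Q x $ 2 $ 2 = of_real (p22 x)"
    and Q_int: "\<And>i j. (\<lambda>x. Q x $ i $ j) absolutely_integrable_on {0<..<b}"
begin

text \<open>
  \<open>rhs1\<close> and \<open>rhs2\<close> are the components of \<open>u'\<close> in the equation \<open>\<tau> u = z u\<close> solved for the derivative.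
\<close>
definition rhs1 :: "complex \<Rightarrow> (real \<Rightarrow> complex^2) \<Rightarrow> real \<Rightarrow> complex" where
  "rhs1 z u x = - of_real (\<kappa> / x) * u x $ 1 - of_real (p12 x) * u x $ 1 + (z - of_real (p22 x)) * u x $ 2"

definition rhs2 :: "complex \<Rightarrow> (real \<Rightarrow> complex^2) \<Rightarrow> real \<Rightarrow> complex" where
  "rhs2 z u x = of_real (\<kappa> / x) * u x $ 2 + of_real (p12 x) * u x $ 2 + (of_real (p11 x) - z) * u x $ 1"

lemma dirac_expr_eq_iff:
  "dirac_expr \<kappa> Q u u' x = z *s u x \<longleftrightarrow> u' x $ 1 = rhs1 z u x \<and> u' x $ 2 = rhs2 z u x"
proof -
  have "dirac_expr \<kappa> Q u u' x $ 1 = - u' x $ 2 + of_real (\<kappa> / x) * u x $ 2 + of_real (p11 x) * u x $ 1 + of_real (p12 x) * u x $ 2"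
    by (simp add: dirac_expr_def sigma1_def sigma2_def matrix_vector_mult_def sum_2 Q) (simp add: scaleR_conv_of_real)
  moreover have "dirac_expr \<kappa> Q u u' x $ 2 = u' x $ 1 + of_real (\<kappa> / x) * u x $ 1 + of_real (p12 x) * u x $ 1 + of_real (p22 x) * u x $ 2"
    by (simp add: dirac_expr_def sigma1_def sigma2_def matrix_vector_mult_def sum_2 Q) (simp add: scaleR_conv_of_real)
  ultimately show ?thesis
    by (simp add: Finite_Cartesian_Product.vec_eq_iff forall_2 rhs1_def rhs2_def) (auto simp: algebra_simps)
qed

lemma dirac_solution_iff:
  "dirac_solution \<kappa> Q b z u \<longleftrightarrow>
     indef_integral_on {0<..<b} (\<lambda>x. u x $ 1) (rhs1 z u) \<and> indef_integral_on {0<..<b} (\<lambda>x. u x $ 2) (rhs2 z u)"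
proof
  assume "dirac_solution \<kappa> Q b z u"
  then obtain u' where ac: "has_ac_derivative b u u'"
    and ae: "AE x in lebesgue. x \<in> {0<..<b} \<longrightarrow> dirac_expr \<kappa> Q u u' x = z *s u x"
    unfolding dirac_solution_def by (elim exE conjE)
  have "AE x in lebesgue. x \<in> {0<..<b} \<longrightarrow> u' x $ 1 = rhs1 z u x"
    "AE x in lebesgue. x \<in> {0<..<b} \<longrightarrow> u' x $ 2 = rhs2 z u x"
    using ae unfolding dirac_expr_eq_iff by (rule eventually_mono, blast)+
  then show "indef_integral_on {0<..<b} (\<lambda>x. u x $ 1) (rhs1 z u) \<and> indef_integral_on {0<..<b} (\<lambda>x. u x $ 2) (rhs2 z u)"
    using ac unfolding has_ac_derivative_iff
    by (intro conjI; elim conjE) (erule indef_integral_on_AE, assumption, rule is_interval_oo, rule order_refl)+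
next
  assume *: "indef_integral_on {0<..<b} (\<lambda>x. u x $ 1) (rhs1 z u) \<and> indef_integral_on {0<..<b} (\<lambda>x. u x $ 2) (rhs2 z u)"
  define u' where "u' = (\<lambda>x. vector [rhs1 z u x, rhs2 z u x] :: complex^2)"
  have u': "u' x $ 1 = rhs1 z u x" "u' x $ 2 = rhs2 z u x" for x by (simp_all add: u'_def)
  show "dirac_solution \<kappa> Q b z u"
    unfolding dirac_solution_def
  proof (intro exI[of _ u'] conjI)
    show "has_ac_derivative b u u'" unfolding has_ac_derivative_iff u' using * .
    show "AE x in lebesgue. x \<in> {0<..<b} \<longrightarrow> dirac_expr \<kappa> Q u u' x = z *s u x"
      by (simp add: dirac_expr_eq_iff u')
  qed
qed

text \<open>
  The Lagrange identity: in the derivative of the Wronskian all terms with \<kappa> and the potential cancel,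
  because the potential is symmetric.
\<close>
lemma wronskian_indef:
  assumes "dirac_solution \<kappa> Q b z u" "dirac_solution \<kappa> Q b \<zeta> v"
  shows "indef_integral_on {0<..<b} (\<lambda>x. wronskian x u v)
    (\<lambda>x. (z - \<zeta>) * (u x $ 1 * v x $ 1 + u x $ 2 * v x $ 2))"
proof -
  note u = assms(1)[unfolded dirac_solution_iff] and v = assms(2)[unfolded dirac_solution_iff]
  note I = is_interval_oo[of 0 b]
  note m1 = indef_integral_on_mult[OF conjunct1[OF u] conjunct2[OF v] I]
  note m2 = indef_integral_on_mult[OF conjunct2[OF u] conjunct1[OF v] I]
  show ?thesis
    by (rule indef_integral_on_cong[OF indef_integral_on_add[OF m1 indef_integral_on_cmult[OF m2, of "- 1"]] I])
       (simp_all add: wronskian_def rhs1_def rhs2_def algebra_simps)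
qed

lemma wronskian_const:
  assumes "dirac_solution \<kappa> Q b z u" "dirac_solution \<kappa> Q b z v" "x \<in> {0<..<b}" "y \<in> {0<..<b}"
  shows "wronskian x u v = wronskian y u v"
  using indef_integral_on_unique_constant[OF _ assms(3,4)] wronskian_indef[OF assms(1,2)] by simp

text \<open>
  Solutions of the equation with \<open>Q = 0\<close> and \<open>z = 0\<close>.
\<close>
definition \<alpha> :: "2 \<Rightarrow> real \<Rightarrow> real" where "\<alpha> i x = x powr (if i = 1 then - \<kappa> else \<kappa>)"

definition A0 :: "real \<Rightarrow> 2 \<Rightarrow> 2 \<Rightarrow> complex" where
  "A0 t i j = (if t \<in> {0<..<b} then
      (if i = 1 then (if j = 1 then - Q t $ 1 $ 2 else - Q t $ 2 $ 2)
       else (if j = 1 then Q t $ 1 $ 1 else Q t $ 1 $ 2)) else 0)"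

definition A1 :: "real \<Rightarrow> 2 \<Rightarrow> 2 \<Rightarrow> complex" where
  "A1 t i j = (if t \<in> {0<..<b} then (if i = j then 0 else if i = 1 then 1 else - 1) else 0)"

text \<open>
  When integrating away from 0 the growing solution dominates both propagators, when integrating towards
  0 the decaying one does.
\<close>
lemma singular_volterra_dir:
  "singular_volterra b forward \<alpha> (\<lambda>x. x powr (if forward then \<kappa> else - \<kappa>))"
proof
  show "\<alpha> i x * t powr (if forward then \<kappa> else - \<kappa>) \<le> x powr (if forward then \<kappa> else - \<kappa>) * \<alpha> i t"
    if x: "0 < x" "0 < t" and o: "if forward then t \<le> x else x \<le> t" for i x t
  proof -
    define e where "e = (if forward then \<kappa> else - \<kappa>)"
    have m: "t powr e \<le> x powr e" "x powr - e \<le> t powr - e"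
      using x o \<kappa> unfolding e_def by (cases forward; simp add: powr_mono2 powr_mono2')+
    have "(if i = 1 then - \<kappa> else \<kappa>) = e \<or> (if i = 1 then - \<kappa> else \<kappa>) = - e" unfolding e_def by auto
    then show ?thesis unfolding \<alpha>_def e_def[symmetric]
    proof
      assume "(if i = 1 then - \<kappa> else \<kappa>) = - e"
      then show "x powr (if i = 1 then - \<kappa> else \<kappa>) * t powr e \<le> x powr e * t powr (if i = 1 then - \<kappa> else \<kappa>)"
        using mult_mono[OF m(2,1)] by (simp only: powr_ge_zero mult.commute)
    qed simp
  qed
qed (use b in \<open>auto simp: \<alpha>_def intro!: continuous_intros\<close>)

lemma coeff_A0: "singular_volterra.coeff b A0"
proof -
  interpret singular_volterra b True \<alpha> "\<lambda>x. x powr (if True then \<kappa> else - \<kappa>)" by (rule singular_volterra_dir)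
  have Q: "integrable lebesgue (\<lambda>t. if t \<in> {0<..<b} then Q t $ i $ j else 0)" for i j
    using Q_int[of i j] unfolding set_integrable_def by (rule Bochner_Integration.integrable_cong[THEN iffD1, rotated 2]) auto
  have Qm: "integrable lebesgue (\<lambda>t. if t \<in> {0<..<b} then - Q t $ i $ j else 0)" for i j
    using integrable_minus[OF Q[of i j]] by (rule Bochner_Integration.integrable_cong[THEN iffD1, rotated 2]) auto
  show ?thesis unfolding coeff_def
  proof (intro conjI allI impI)
    show "integrable lebesgue (\<lambda>t. A0 t i j)" for i j
      unfolding A0_def by (cases "i = 1"; cases "j = 1"; simp only: if_True if_False simp_thms Q Qm)
    show "A0 t i j = 0" if "t \<notin> {0<..<b}" for t i j
      unfolding A0_def using that by (simp only: if_False)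
  qed
qed

lemma coeff_A1: "singular_volterra.coeff b A1"
proof -
  interpret singular_volterra b True \<alpha> "\<lambda>x. x powr (if True then \<kappa> else - \<kappa>)" by (rule singular_volterra_dir)
  have "integrable lebesgue (\<lambda>t. indicator {0<..<b} t *\<^sub>R c)" for c :: complex
    by (intro integrable_scaleR_left) (simp add: integrable_indicator_iff emeasure_lborel_Ioo less_imp_le[OF b])
  then have "integrable lebesgue (\<lambda>t. if t \<in> {0<..<b} then c else 0)" for c :: complex
    by (rule Bochner_Integration.integrable_cong[THEN iffD1, rotated 2]) auto
  note c = this
  show ?thesis unfolding coeff_def
  proof (intro conjI allI impI)
    show "integrable lebesgue (\<lambda>t. A1 t i j)" for i j
      unfolding A1_def by (rule c)
    show "A1 t i j = 0" if "t \<notin> {0<..<b}" for t i j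
      unfolding A1_def using that by (simp only: if_False)
  qed
qed

lemma \<alpha>_indef: "indef_integral_on {0<..<b} (\<lambda>x. complex_of_real (\<alpha> i x))
    (\<lambda>x. complex_of_real ((if i = 1 then - \<kappa> else \<kappa>) / x * \<alpha> i x))"
proof (rule indef_integral_on_deriv)
  fix x assume x: "x \<in> {0<..<b}"
  define e where "e = (if i = 1 then - \<kappa> else \<kappa>)"
  have "((\<lambda>x. x powr e) has_real_derivative (e * x powr (e - 1))) (at x)"
    using x by (intro has_real_derivative_powr) simp
  also have "e * x powr (e - 1) = e / x * x powr e" using x by (simp add: powr_diff)
  finally have "((\<lambda>x. x powr e) has_real_derivative (e / x * x powr e)) (at x)" .
  from has_vector_derivative_of_real[OF this]
  show "((\<lambda>x. complex_of_real (\<alpha> i x)) has_vector_derivative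
      complex_of_real ((if i = 1 then - \<kappa> else \<kappa>) / x * \<alpha> i x)) (at x)"
    unfolding \<alpha>_def e_def[symmetric] .
qed (auto simp: \<alpha>_def intro!: continuous_intros)

lemma volterra_solution_dirac_solution:
  assumes "singular_volterra_system b forward \<alpha> \<beta> A0 A1 c C0"
  defines "s \<equiv> singular_volterra_system.sol b forward \<alpha> A0 A1 c"
  shows "dirac_solution \<kappa> Q b z (\<lambda>x. vector [s z x 1, s z x 2])"
proof -
  interpret singular_volterra_system b forward \<alpha> \<beta> A0 A1 c C0 by (rule assms(1))
  define u :: "real \<Rightarrow> complex^2" where "u = (\<lambda>x. vector [s z x 1, s z x 2])"
  have I: "is_interval {0<..<b}" by (rule is_interval_oo)
  have u: "u x $ i = sol z x i" for x i
    using exhaust_2[of i] by (auto simp: u_def s_def)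
  have main: "indef_integral_on {0<..<b} (\<lambda>x. u x $ i)
      (\<lambda>x. of_real ((if i = 1 then - \<kappa> else \<kappa>) / x) * u x $ i + (\<Sum>j\<in>UNIV. A z x i j * u x $ j))" for i
  proof -
    have "indef_integral_on {0<..<b} (J (integrand (A z) (sol z) i)) (integrand (A z) (sol z) i)"
      by (intro J_indef integrand_integrable coeff_A weighted_sol)
    from indef_integral_on_mult[OF \<alpha>_indef[of i] indef_integral_on_add[OF indef_integral_on_const[of _ "c i"] this] I]
    show ?thesis
    proof (rule indef_integral_on_cong[OF _ I])
      fix x assume x: "x \<in> {0<..<b}"
      show e: "of_real (\<alpha> i x) * (c i + J (integrand (A z) (sol z) i) x) = u x $ i"
        unfolding u using sol_equation[of x z i] x by simp
      have "\<alpha> i x \<noteq> 0" using \<alpha>_pos[of x i] x by simp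
      then have "of_real (\<alpha> i x) * (0 + integrand (A z) (sol z) i x) = (\<Sum>j\<in>UNIV. A z x i j * u x $ j)"
        by (simp add: integrand_def u)
      then show "of_real ((if i = 1 then - \<kappa> else \<kappa>) / x * \<alpha> i x) * (c i + J (integrand (A z) (sol z) i) x)
          + of_real (\<alpha> i x) * (0 + integrand (A z) (sol z) i x)
          = of_real ((if i = 1 then - \<kappa> else \<kappa>) / x) * u x $ i + (\<Sum>j\<in>UNIV. A z x i j * u x $ j)"
        unfolding e[symmetric] by (simp add: mult.assoc)
    qed
  qed
  have "indef_integral_on {0<..<b} (\<lambda>x. u x $ 1) (rhs1 z u)"
    by (rule indef_integral_on_cong[OF main[of 1] I refl])
       (simp add: A_def A0_def A1_def rhs1_def sum_2 Q algebra_simps)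
  moreover have "indef_integral_on {0<..<b} (\<lambda>x. u x $ 2) (rhs2 z u)"
    by (rule indef_integral_on_cong[OF main[of 2] I refl])
       (simp add: A_def A0_def A1_def rhs2_def sum_2 Q algebra_simps)
  ultimately have "dirac_solution \<kappa> Q b z u" unfolding dirac_solution_iff by blast
  then show ?thesis by (simp only: u_def)
qed

lemma A0_real: "A0 t i j \<in> \<real>" by (simp add: A0_def Q)
lemma A1_real: "A1 t i j \<in> \<real>" by (simp add: A1_def)

lemma volterra_solution_real_entire:
  assumes "singular_volterra_system b forward \<alpha> \<beta> A0 A1 c C0" and c: "\<And>i. c i \<in> \<real>"
  defines "s \<equiv> singular_volterra_system.sol b forward \<alpha> A0 A1 c"
  shows "real_entire_solution \<kappa> Q b (\<lambda>z x. vector [s z x 1, s z x 2])"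
proof -
  interpret singular_volterra_system b forward \<alpha> \<beta> A0 A1 c C0 by (rule assms(1))
  have u: "(vector [s z x 1, s z x 2] :: complex^2) $ i = sol z x i" for z x i
    using exhaust_2[of i] by (auto simp: s_def)
  show ?thesis unfolding real_entire_solution_def u real_valued_on_def
  proof (intro conjI allI ballI)
    show "dirac_solution \<kappa> Q b z (\<lambda>x. vector [s z x 1, s z x 2])" for z
      unfolding s_def by (rule volterra_solution_dirac_solution[OF assms(1)])
    show "(\<lambda>z. sol z x i) holomorphic_on UNIV" if "x \<in> {0<..<b}" for x i
      by (rule sol_holomorphic) (use that in auto)
    show "sol z x i \<in> \<real>" if "z \<in> \<real>" "x \<in> {0<..<b}" for z x i
      by (rule sol_real[OF A0_real A1_real c]) (use that in auto)
  qed
qed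

text \<open>
  The Volterra equation integrated from \<open>b\<close>: its integral term vanishes at \<open>b\<close> for every \<open>z\<close>.
\<close>
lemma solution_with_values_at_b:
  fixes e :: "2 \<Rightarrow> real"
  shows "\<exists>U. real_entire_solution \<kappa> Q b U \<and> (\<forall>z i. ((\<lambda>x. U z x $ i) \<longlongrightarrow> of_real (e i)) (at_left b))"
proof -
  define c where "c = (\<lambda>i. complex_of_real (e i / \<alpha> i b))"
  define M where "M = cmod (c 1) + cmod (c 2)"
  \<comment> \<open>On \<open>(0, b)\<close> both free solutions are at most \<open>1 + b powr (2 * \<kappa>)\<close> times the weight.\<close>
  define C0 where "C0 = M * (1 + b powr (2 * \<kappa>))"
  interpret V: singular_volterra b False \<alpha> "\<lambda>x. x powr - \<kappa>" using singular_volterra_dir[of False] by simp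
  have bnd: "cmod (c i) * \<alpha> i x \<le> C0 * x powr - \<kappa>" if x: "0 < x" "x < b" for x i
  proof -
    have "x powr (2 * \<kappa>) \<le> b powr (2 * \<kappa>)" using x \<kappa> by (intro powr_mono2) auto
    then have "x powr \<kappa> \<le> b powr (2 * \<kappa>) * x powr - \<kappa>"
      using mult_right_mono[of "x powr (2 * \<kappa>)" "b powr (2 * \<kappa>)" "x powr - \<kappa>"] by (simp add: powr_add[symmetric])
    then have a: "\<alpha> i x \<le> (1 + b powr (2 * \<kappa>)) * x powr - \<kappa>"
      unfolding \<alpha>_def by (simp add: ring_distribs add_increasing)
    have "cmod (c i) \<le> M" using exhaust_2[of i] by (auto simp: M_def)
    then show ?thesis using a unfolding C0_def mult.assoc
      by (intro mult_mono) (auto simp: \<alpha>_def M_def)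
  qed
  have sys: "singular_volterra_system b False \<alpha> (\<lambda>x. x powr - \<kappa>) A0 A1 c C0"
    by unfold_locales (fact coeff_A0 coeff_A1 bnd)+
  interpret singular_volterra_system b False \<alpha> "\<lambda>x. x powr - \<kappa>" A0 A1 c C0 by (rule sys)
  define U :: "complex \<Rightarrow> real \<Rightarrow> complex^2" where "U = (\<lambda>z x. vector [sol z x 1, sol z x 2])"
  have u: "U z x $ i = sol z x i" for z x i using exhaust_2[of i] by (auto simp: U_def)
  have "real_entire_solution \<kappa> Q b U"
    unfolding U_def by (rule volterra_solution_real_entire[OF sys]) (simp add: c_def)
  moreover have "((\<lambda>x. U z x $ i) \<longlongrightarrow> of_real (e i)) (at_left b)" for z i
  proof -
    have ev: "\<forall>\<^sub>F x in at_left b. 0 < x \<and> x < b"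
      by (rule eventually_at_leftI[OF _ b]) simp
    have cW: "continuous_on {0..b} (W (cmod z))" by (rule indef_integral_on_continuous[OF W_indef])
    have "W (cmod z) b = 0" by (simp add: W_def V.dom_def)
    then have W0: "(W (cmod z) \<longlongrightarrow> 0) (at_left b)"
      using cW b by (metis continuous_on_Icc_at_leftD)
    have \<alpha>b: "((\<lambda>x. \<alpha> i x) \<longlongrightarrow> \<alpha> i b) (at_left b)"
      unfolding \<alpha>_def using b by (intro tendsto_powr tendsto_ident_at tendsto_const) simp
    have "((\<lambda>x. sol z x i - c i * of_real (\<alpha> i x)) \<longlongrightarrow> 0) (at_left b)"
    proof (rule Lim_null_comparison)
      show "\<forall>\<^sub>F x in at_left b. cmod (sol z x i - c i * of_real (\<alpha> i x)) \<le> C0 * (exp (W (cmod z) x) - 1) * x powr - \<kappa>"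
        using ev by eventually_elim (rule sol_bound(2); simp)
      have "((\<lambda>x. C0 * (exp (W (cmod z) x) - 1) * x powr - \<kappa>) \<longlongrightarrow> C0 * (exp 0 - 1) * b powr - \<kappa>) (at_left b)"
        using b by (intro tendsto_intros W0) simp
      then show "((\<lambda>x. C0 * (exp (W (cmod z) x) - 1) * x powr - \<kappa>) \<longlongrightarrow> 0) (at_left b)" by simp
    qed
    moreover have "((\<lambda>x. c i * of_real (\<alpha> i x)) \<longlongrightarrow> c i * of_real (\<alpha> i b)) (at_left b)"
      by (intro tendsto_mult tendsto_const tendsto_of_real \<alpha>b)
    ultimately have "((\<lambda>x. (sol z x i - c i * of_real (\<alpha> i x)) + c i * of_real (\<alpha> i x)) \<longlongrightarrow> 0 + c i * of_real (\<alpha> i b)) (at_left b)"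
      by (rule tendsto_add)
    moreover have "\<alpha> i b \<noteq> 0" using b by (simp add: \<alpha>_def)
    ultimately show ?thesis unfolding u by (simp add: c_def)
  qed
  ultimately show ?thesis by (intro exI[of _ U]) blast
qed

text \<open>
  The Volterra equation integrated from 0, with leading term \<open>(0, c0 x^\<kappa>)\<close>. The relative error is at
  most \<open>exp (W \<bar>z\<bar> x) - 1\<close>, where \<open>W \<bar>z\<bar> x\<close> is the sum of \<open>W 0 x\<close> and a term of size \<open>\<bar>z\<bar> x\<close>.
  The last conclusion, which is uniform in \<open>z\<close>, bounds the eigenfunctions from below near 0.
\<close>
lemma regular_solution_at_0:
  fixes c0 :: real
  assumes c0: "0 < c0"
  shows "\<exists>\<Phi>. real_entire_solution \<kappa> Q b \<Phi>
    \<and> (\<forall>z. (\<lambda>x. norm (\<Phi> z x - x powr \<kappa> *\<^sub>R vector [0, complex_of_real c0])) \<in> o[at_right 0](\<lambda>x. x powr \<kappa>))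
    \<and> (\<forall>R. \<exists>C. \<forall>z. cmod z \<le> R \<longrightarrow> (\<forall>x\<in>{0<..<b}. \<forall>i. cmod (\<Phi> z x $ i) \<le> C * x powr \<kappa>))
    \<and> (\<exists>\<delta>>0. \<forall>z. \<forall>x\<in>{0<..<b}. x \<le> \<delta> \<longrightarrow> cmod z * x \<le> \<delta> \<longrightarrow>
          cmod (\<Phi> z x $ 2 - of_real (c0 * x powr \<kappa>)) \<le> c0 / 2 * x powr \<kappa>)"
proof -
  define c where "c = (\<lambda>i :: 2. if i = 1 then 0 else complex_of_real c0)"
  interpret V: singular_volterra b True \<alpha> "\<lambda>x. x powr \<kappa>" using singular_volterra_dir[of True] by simp
  have sys: "singular_volterra_system b True \<alpha> (\<lambda>x. x powr \<kappa>) A0 A1 c c0"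
  proof unfold_locales
    show "cmod (c i) * \<alpha> i x \<le> c0 * x powr \<kappa>" for x i
      using c0 by (simp add: c_def \<alpha>_def)
  qed (fact coeff_A0 coeff_A1)+
  interpret singular_volterra_system b True \<alpha> "\<lambda>x. x powr \<kappa>" A0 A1 c c0 by (rule sys)
  define \<Phi> :: "complex \<Rightarrow> real \<Rightarrow> complex^2" where "\<Phi> = (\<lambda>z x. vector [sol z x 1, sol z x 2])"
  have u: "\<Phi> z x $ i = sol z x i" for z x i using exhaust_2[of i] by (auto simp: \<Phi>_def)
  have "real_entire_solution \<kappa> Q b \<Phi>"
    unfolding \<Phi>_def by (rule volterra_solution_real_entire[OF sys]) (simp add: c_def)
  moreover have "\<forall>R. \<exists>C. \<forall>z. cmod z \<le> R \<longrightarrow> (\<forall>x\<in>{0<..<b}. \<forall>i. cmod (\<Phi> z x $ i) \<le> C * x powr \<kappa>)"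
  proof (intro allI)
    fix R
    have "cmod (\<Phi> z x $ i) \<le> c0 * exp (integral {0..b} (w R)) * x powr \<kappa>"
      if z: "cmod z \<le> R" and x: "x \<in> {0<..<b}" for z x i
    proof -
      have "0 \<le> R" using z norm_ge_zero order_trans by blast
      then have "W (cmod z) x \<le> integral {0..b} (w R)"
        using W_mono[OF z, of x] W_le[of R x] x by simp
      then have "c0 * exp (W (cmod z) x) * x powr \<kappa> \<le> c0 * exp (integral {0..b} (w R)) * x powr \<kappa>"
        using c0 by (intro mult_right_mono mult_left_mono) auto
      then show ?thesis using sol_bound(1)[of x z i] x by (simp add: u)
    qed
    then show "\<exists>C. \<forall>z. cmod z \<le> R \<longrightarrow> (\<forall>x\<in>{0<..<b}. \<forall>i. cmod (\<Phi> z x $ i) \<le> C * x powr \<kappa>)"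
      by (intro exI[of _ "c0 * exp (integral {0..b} (w R))"]) blast
  qed
  moreover have near: "cmod (\<Phi> z x $ i - (if i = 1 then 0 else of_real (c0 * x powr \<kappa>))) \<le> c0 * (exp (W (cmod z) x) - 1) * x powr \<kappa>"
    if "x \<in> {0<..<b}" for z x i
    using sol_bound(2)[of x z i] that by (simp add: u c_def \<alpha>_def split: if_splits)
  have cW: "continuous_on {0..b} (W R)" for R by (rule indef_integral_on_continuous[OF W_indef])
  have W00: "W R 0 = 0" for R by (simp add: W_def V.dom_def)
  have W0: "(W R \<longlongrightarrow> 0) (at_right 0)" for R
    using cW[of R] b W00[of R] by (metis continuous_on_Icc_at_rightD)
  have ev: "\<forall>\<^sub>F x in at_right 0. x \<in> {0<..<b}"
    by (rule eventually_at_rightI[OF _ b]) simp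
  have "(\<lambda>x. norm (\<Phi> z x - x powr \<kappa> *\<^sub>R vector [0, complex_of_real c0])) \<in> o[at_right 0](\<lambda>x. x powr \<kappa>)" for z
  proof (rule smalloI_tendsto)
    show "\<forall>\<^sub>F x in at_right 0. x powr \<kappa> \<noteq> 0" using ev by eventually_elim simp
    show "((\<lambda>x. norm (\<Phi> z x - x powr \<kappa> *\<^sub>R vector [0, complex_of_real c0]) / x powr \<kappa>) \<longlongrightarrow> 0) (at_right 0)"
    proof (rule Lim_null_comparison)
      show "\<forall>\<^sub>F x in at_right 0. norm (norm (\<Phi> z x - x powr \<kappa> *\<^sub>R vector [0, complex_of_real c0]) / x powr \<kappa>)
          \<le> 2 * (c0 * (exp (W (cmod z) x) - 1))"
        using ev
      proof eventually_elim
        case (elim x)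
        let ?v = "\<Phi> z x - x powr \<kappa> *\<^sub>R vector [0, complex_of_real c0]"
        have "norm ?v \<le> (\<Sum>i\<in>UNIV. cmod (?v $ i))" unfolding norm_vec_def by (rule L2_set_le_sum) simp
        also have "\<dots> \<le> (\<Sum>i\<in>(UNIV :: 2 set). c0 * (exp (W (cmod z) x) - 1) * x powr \<kappa>)"
        proof (rule sum_mono)
          fix i :: 2
          show "cmod (?v $ i) \<le> c0 * (exp (W (cmod z) x) - 1) * x powr \<kappa>"
            using near[OF elim, of z i] exhaust_2[of i]
              by (elim disjE; simp) (simp add: scaleR_conv_of_real mult.commute)
        qed
        finally show ?case using elim by (simp add: divide_le_eq)
      qed
      have "((\<lambda>x. 2 * (c0 * (exp (W (cmod z) x) - 1))) \<longlongrightarrow> 2 * (c0 * (exp 0 - 1))) (at_right 0)"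
        by (intro tendsto_intros W0)
      then show "((\<lambda>x. 2 * (c0 * (exp (W (cmod z) x) - 1))) \<longlongrightarrow> 0) (at_right 0)" by simp
    qed
  qed
  moreover have "\<exists>\<delta>>0. \<forall>z. \<forall>x\<in>{0<..<b}. x \<le> \<delta> \<longrightarrow> cmod z * x \<le> \<delta> \<longrightarrow>
          cmod (\<Phi> z x $ 2 - of_real (c0 * x powr \<kappa>)) \<le> c0 / 2 * x powr \<kappa>"
  proof -
    have "\<forall>\<^sub>F x in at_right 0. W 0 x < 1 / 8" using W0[of 0] by (rule order_tendstoD) simp
    then obtain d where d: "d > 0" "\<And>x. 0 < x \<Longrightarrow> x < d \<Longrightarrow> W 0 x < 1 / 8"
      unfolding eventually_at_right_field by blast
    \<comment> \<open>Both parts of \<open>W \<bar>z\<bar> x\<close> are at most 1/8, so that \<open>exp (W \<bar>z\<bar> x) - 1\<close> is at most 1/2.\<close>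
    define \<delta> where "\<delta> = min (d / 2) (1 / 16)"
    have "cmod (\<Phi> z x $ 2 - of_real (c0 * x powr \<kappa>)) \<le> c0 / 2 * x powr \<kappa>"
      if x: "x \<in> {0<..<b}" "x \<le> \<delta>" and zx: "cmod z * x \<le> \<delta>" for z x
    proof -
      have "W (cmod z) x = integral {0..x} (\<lambda>t. V.total A0 t + cmod z * V.total A1 t)"
        by (simp add: W_def V.dom_def w_def[abs_def])
      also have "\<dots> = integral {0..x} (V.total A0) + integral {0..x} (\<lambda>t. cmod z * V.total A1 t)"
        by (intro Henstock_Kurzweil_Integration.integral_add integrable_on_mult_right
            set_lebesgue_integral_eq_integral(1) V.abs_int_total coeff_A0 coeff_A1) simp_all
      also have "integral {0..x} (V.total A0) = W 0 x" by (simp add: W_def V.dom_def w_def[abs_def])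
      also have "integral {0..x} (\<lambda>t. cmod z * V.total A1 t) \<le> integral {0..x} (\<lambda>t. cmod z * 2)"
      proof (intro integral_le)
        show "(\<lambda>t. cmod z * V.total A1 t) integrable_on {0..x}"
          by (intro integrable_on_mult_right set_lebesgue_integral_eq_integral(1) V.abs_int_total coeff_A1) simp
        show "cmod z * V.total A1 t \<le> cmod z * 2" for t
          by (intro mult_left_mono) (auto simp: V.total_def A1_def sum_2)
      qed (rule integrable_const_ivl)
      also have "\<dots> = 2 * (cmod z * x)" using x by simp
      finally have "W (cmod z) x \<le> W 0 x + 2 * (cmod z * x)" by simp
      moreover have "W 0 x < 1 / 8" using d x by (auto simp: \<delta>_def)
      moreover have "2 * (cmod z * x) \<le> 1 / 8" using zx by (simp add: \<delta>_def)
      ultimately have W4: "W (cmod z) x \<le> 1 / 4" by linarith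
      have "exp (W (cmod z) x) \<le> 1 + 2 * W (cmod z) x"
        using exp_bound_lemma[of "W (cmod z) x"] W4 W_nonneg[of "cmod z" x] by simp
      then have e: "exp (W (cmod z) x) - 1 \<le> 1 / 2" using W4 by simp
      have "cmod (\<Phi> z x $ 2 - of_real (c0 * x powr \<kappa>)) \<le> c0 * (exp (W (cmod z) x) - 1) * x powr \<kappa>"
        using near[OF x(1), of z 2] by simp
      also have "\<dots> \<le> c0 * (1 / 2) * x powr \<kappa>"
        using c0 by (intro mult_right_mono mult_left_mono e) auto
      finally show ?thesis by simp
    qed
    moreover have "\<delta> > 0" using d by (simp add: \<delta>_def)
    ultimately show ?thesis by blast
  qed
  ultimately show ?thesis by (intro exI[of _ \<Phi>]) blast
qed

end

section \<open>The boundary function and its zeros\<close>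

lemma bounded_continuous_absolutely_integrable:
  fixes g :: "real \<Rightarrow> 'a::euclidean_space"
  assumes "continuous_on {a<..<b} g" "\<And>x. x \<in> {a<..<b} \<Longrightarrow> norm (g x) \<le> C"
  shows "g absolutely_integrable_on {a..b}"
proof -
  have "g absolutely_integrable_on {a<..<b}"
  proof (rule measurable_bounded_by_integrable_imp_absolutely_integrable[where g = "\<lambda>x. C"])
    show "g \<in> borel_measurable (lebesgue_on {a<..<b})"
      by (rule continuous_imp_measurable_on_sets_lebesgue[OF assms(1)]) simp
    show "(\<lambda>x. C) integrable_on {a<..<b}"
      using integrable_on_open_interval_real[of "\<lambda>x. C" a b] integrable_const_ivl[of C a b] by blast
  qed (use assms(2) in auto)
  then show ?thesis
    using absolutely_integrable_on_open_interval[where f = g and a = a and b = b] by (simp add: box_real)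
qed

lemma zero_islimpt_Reals: "(0 :: complex) islimpt \<real>"
  unfolding islimpt_sequential
proof (intro exI[of _ "\<lambda>n. complex_of_real (1 / real (Suc n))"] conjI allI)
  show "complex_of_real (1 / real (Suc n)) \<in> \<real> - {0}" for n
    by (simp only: Diff_iff Reals_of_real singleton_iff of_real_eq_0_iff) simp
  have "(\<lambda>n. 1 / real (Suc n)) \<longlonglongrightarrow> 0" using LIMSEQ_inverse_real_of_nat by (simp add: inverse_eq_divide)
  from tendsto_of_real[OF this] show "(\<lambda>n. complex_of_real (1 / real (Suc n))) \<longlonglongrightarrow> 0" by (simp only: of_real_0)
qed

text \<open>
  The Schwarz reflection principle, here a consequence of the identity theorem.
\<close>
lemma entire_reflection:
  assumes f: "f holomorphic_on UNIV" and r: "\<And>z. z \<in> \<real> \<Longrightarrow> f z \<in> \<real>"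
  shows "f (cnj z) = cnj (f z)"
proof -
  have "(cnj \<circ> f \<circ> cnj) holomorphic_on UNIV"
  proof -
    have "range cnj = UNIV" by (rule surjI[of _ cnj]) simp
    then show ?thesis using holomorphic_on_compose_cnj_cnj[of f UNIV] f by (simp only: open_UNIV)
  qed
  then have h: "(\<lambda>z. (cnj \<circ> f \<circ> cnj) z - f z) holomorphic_on UNIV" using f by (intro holomorphic_intros)
  have "(cnj \<circ> f \<circ> cnj) (cnj z) - f (cnj z) = 0"
  proof (rule analytic_continuation[OF h, of \<real> 0])
    show "(0 :: complex) islimpt \<real>" by (rule zero_islimpt_Reals)
    show "(cnj \<circ> f \<circ> cnj) w - f w = 0" if "w \<in> \<real>" for w
      using r[OF that] that by (simp add: Reals_cnj_iff)
  qed auto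
  then show ?thesis by simp
qed

context dirac_system begin

lemma half: "b / 2 \<in> {0<..<b}" using b by simp

lemma solD:
  fixes u :: "complex \<Rightarrow> real \<Rightarrow> complex^2"
  assumes "real_entire_solution \<kappa> Q b u"
  shows "dirac_solution \<kappa> Q b z (u z)" "x \<in> {0<..<b} \<Longrightarrow> (\<lambda>z. u z x $ i) holomorphic_on UNIV"
    "z \<in> \<real> \<Longrightarrow> x \<in> {0<..<b} \<Longrightarrow> u z x $ i \<in> \<real>"
    "x \<in> {0<..<b} \<Longrightarrow> u (cnj z) x $ i = cnj (u z x $ i)"
proof -
  show "dirac_solution \<kappa> Q b z (u z)" and h: "x \<in> {0<..<b} \<Longrightarrow> (\<lambda>z. u z x $ i) holomorphic_on UNIV"
    and r: "z \<in> \<real> \<Longrightarrow> x \<in> {0<..<b} \<Longrightarrow> u z x $ i \<in> \<real>" for z x i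
    using assms unfolding real_entire_solution_def real_valued_on_def by simp_all
  show "u (cnj z) x $ i = cnj (u z x $ i)" if x: "x \<in> {0<..<b}"
    by (rule entire_reflection[OF h[OF x]]) (rule r[OF _ x])
qed

lemma dirac_solution_continuous:
  fixes u :: "real \<Rightarrow> complex^2"
  assumes "dirac_solution \<kappa> Q b z u"
  shows "continuous_on {0<..<b} (\<lambda>x. u x $ i)"
  using assms exhaust_2[of i] unfolding dirac_solution_iff by (auto intro: indef_integral_on_continuous_open)

lemma dirac_solution_lincomb:
  assumes u: "dirac_solution \<kappa> Q b z u" and v: "dirac_solution \<kappa> Q b z v"
  shows "dirac_solution \<kappa> Q b z (\<lambda>x. p *s u x + q *s v x)"
  unfolding dirac_solution_iff
proof
  note u = u[unfolded dirac_solution_iff] and v = v[unfolded dirac_solution_iff]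
  show "indef_integral_on {0<..<b} (\<lambda>x. (p *s u x + q *s v x) $ 1) (rhs1 z (\<lambda>x. p *s u x + q *s v x))"
    by (rule indef_integral_on_cong[OF indef_integral_on_add[OF indef_integral_on_cmult[OF conjunct1[OF u], of p]
          indef_integral_on_cmult[OF conjunct1[OF v], of q]] is_interval_oo]) (simp_all add: rhs1_def algebra_simps)
  show "indef_integral_on {0<..<b} (\<lambda>x. (p *s u x + q *s v x) $ 2) (rhs2 z (\<lambda>x. p *s u x + q *s v x))"
    by (rule indef_integral_on_cong[OF indef_integral_on_add[OF indef_integral_on_cmult[OF conjunct2[OF u], of p]
          indef_integral_on_cmult[OF conjunct2[OF v], of q]] is_interval_oo]) (simp_all add: rhs2_def algebra_simps)
qed

lemma wronskian_tendsto:
  fixes u v :: "real \<Rightarrow> complex^2"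
  assumes "\<And>i. ((\<lambda>x. u x $ i) \<longlongrightarrow> e i) F" "\<And>i. ((\<lambda>x. v x $ i) \<longlongrightarrow> f i) F"
  shows "((\<lambda>x. wronskian x u v) \<longlongrightarrow> e 1 * f 2 - e 2 * f 1) F"
  unfolding wronskian_def by (intro tendsto_intros assms)

lemma wronskian_eq_limit:
  assumes "dirac_solution \<kappa> Q b z u" "dirac_solution \<kappa> Q b z v"
    and "((\<lambda>x. wronskian x u v) \<longlongrightarrow> w) (at_left b)" and x: "x \<in> {0<..<b}"
  shows "wronskian x u v = w"
proof -
  have "\<forall>\<^sub>F y in at_left b. wronskian y u v = wronskian x u v"
    by (rule eventually_at_leftI[OF _ b]) (rule wronskian_const[OF assms(1,2) _ x])
  then have "((\<lambda>y. wronskian y u v) \<longlongrightarrow> wronskian x u v) (at_left b)" by (rule tendsto_eventually)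
  then show ?thesis using assms(3) by (rule tendsto_unique[OF trivial_limit_at_left_real])
qed

end

locale dirac_fundamental_system = dirac_system +
  fixes U V :: "complex \<Rightarrow> real \<Rightarrow> complex^2" and e f :: "2 \<Rightarrow> real"
  assumes U: "real_entire_solution \<kappa> Q b U" and V: "real_entire_solution \<kappa> Q b V"
    and U_lim: "\<And>z i. ((\<lambda>x. U z x $ i) \<longlongrightarrow> of_real (e i)) (at_left b)"
    and V_lim: "\<And>z i. ((\<lambda>x. V z x $ i) \<longlongrightarrow> of_real (f i)) (at_left b)"
    and det: "e 1 * f 2 - e 2 * f 1 = 1"
begin

lemma wronskian_UV: "x \<in> {0<..<b} \<Longrightarrow> wronskian x (U z) (V z) = 1"
proof (rule wronskian_eq_limit[OF solD(1)[OF U] solD(1)[OF V]])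
  have "((\<lambda>x. wronskian x (U z) (V z)) \<longlongrightarrow> of_real (e 1) * of_real (f 2) - of_real (e 2) * of_real (f 1)) (at_left b)"
    by (rule wronskian_tendsto[where e = "\<lambda>i. of_real (e i)" and f = "\<lambda>i. of_real (f i)"]) (rule U_lim V_lim)+
  moreover have "complex_of_real (e 1) * of_real (f 2) - of_real (e 2) * of_real (f 1) = 1"
    using arg_cong[OF det, of complex_of_real] by simp
  ultimately show "((\<lambda>x. wronskian x (U z) (V z)) \<longlongrightarrow> 1) (at_left b)" by simp
qed

lemma solution_expansion:
  fixes u :: "real \<Rightarrow> complex^2"
  assumes u: "dirac_solution \<kappa> Q b z u" and x: "x \<in> {0<..<b}"
  shows "u x $ i = wronskian (b / 2) u (V z) * U z x $ i + wronskian (b / 2) (U z) u * V z x $ i"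
proof -
  have "u x $ i = (u x $ 1 * V z x $ 2 - u x $ 2 * V z x $ 1) * U z x $ i
      + (U z x $ 1 * u x $ 2 - U z x $ 2 * u x $ 1) * V z x $ i"
  proof -
    have w: "U z x $ 1 * V z x $ 2 - U z x $ 2 * V z x $ 1 = 1"
      using wronskian_UV[OF x, of z] by (simp add: wronskian_def)
    have "(u x $ 1 * V z x $ 2 - u x $ 2 * V z x $ 1) * U z x $ i
      + (U z x $ 1 * u x $ 2 - U z x $ 2 * u x $ 1) * V z x $ i
      = u x $ i * (U z x $ 1 * V z x $ 2 - U z x $ 2 * V z x $ 1)"
      using exhaust_2[of i] by (auto simp: algebra_simps)
    then show ?thesis unfolding w by simp
  qed
  then show ?thesis
    unfolding wronskian_def[symmetric]
    using wronskian_const[OF u solD(1)[OF V] x half] wronskian_const[OF solD(1)[OF U] u x half] by simp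
qed

lemma solution_limit:
  fixes u :: "real \<Rightarrow> complex^2"
  assumes u: "dirac_solution \<kappa> Q b z u"
  shows "((\<lambda>x. u x $ i) \<longlongrightarrow> wronskian (b / 2) u (V z) * of_real (e i) + wronskian (b / 2) (U z) u * of_real (f i)) (at_left b)"
proof (rule Lim_transform_eventually)
  show "((\<lambda>x. wronskian (b / 2) u (V z) * U z x $ i + wronskian (b / 2) (U z) u * V z x $ i) \<longlongrightarrow>
      wronskian (b / 2) u (V z) * of_real (e i) + wronskian (b / 2) (U z) u * of_real (f i)) (at_left b)"
    by (intro tendsto_intros U_lim V_lim)
  show "\<forall>\<^sub>F x in at_left b. wronskian (b / 2) u (V z) * U z x $ i + wronskian (b / 2) (U z) u * V z x $ i = u x $ i"
    by (rule eventually_at_leftI[OF _ b]) (rule solution_expansion[OF u, symmetric])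
qed

end

text \<open>
  The solution \<Phi> is regular at 0, and the vector \<open>e\<close> gives the boundary condition at \<open>b\<close>. The
  constants \<open>c0\<close> and \<delta> describe how long \<Phi> follows its leading term.
\<close>
locale dirac_boundary = dirac_fundamental_system +
  fixes \<Phi> :: "complex \<Rightarrow> real \<Rightarrow> complex^2" and c0 \<delta> :: real
  assumes \<Phi>: "real_entire_solution \<kappa> Q b \<Phi>"
    and \<Phi>_bound: "\<And>R. \<exists>C. \<forall>z. cmod z \<le> R \<longrightarrow> (\<forall>x\<in>{0<..<b}. \<forall>i. cmod (\<Phi> z x $ i) \<le> C * x powr \<kappa>)"
    and c0: "0 < c0" and \<delta>: "0 < \<delta>"
    and \<Phi>_near: "\<And>z x. x \<in> {0<..<b} \<Longrightarrow> x \<le> \<delta> \<Longrightarrow> cmod z * x \<le> \<delta> \<Longrightarrow>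
          cmod (\<Phi> z x $ 2 - of_real (c0 * x powr \<kappa>)) \<le> c0 / 2 * x powr \<kappa>"
begin

text \<open>
  The coefficients in \<open>\<Phi> = A U + B V\<close>. Wronskians of solutions are constant, so the point at which they
  are evaluated is arbitrary.
\<close>
definition A :: "complex \<Rightarrow> complex" where "A z = wronskian (b / 2) (\<Phi> z) (V z)"
definition B :: "complex \<Rightarrow> complex" where "B z = wronskian (b / 2) (U z) (\<Phi> z)"

lemma A_holomorphic: "A holomorphic_on S" and B_holomorphic: "B holomorphic_on S"
proof -
  have "A holomorphic_on UNIV" unfolding A_def[abs_def] wronskian_def
    by (intro holomorphic_intros solD(2)[OF \<Phi> half] solD(2)[OF V half])
  then show "A holomorphic_on S" by (rule holomorphic_on_subset) simp
  have "B holomorphic_on UNIV" unfolding B_def[abs_def] wronskian_def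
    by (intro holomorphic_intros solD(2)[OF \<Phi> half] solD(2)[OF U half])
  then show "B holomorphic_on S" by (rule holomorphic_on_subset) simp
qed

lemma A_real: "z \<in> \<real> \<Longrightarrow> A z \<in> \<real>" and B_real: "z \<in> \<real> \<Longrightarrow> B z \<in> \<real>"
  unfolding A_def B_def wronskian_def
  by (auto intro!: Reals_diff Reals_mult solD(3)[OF \<Phi> _ half] solD(3)[OF U _ half] solD(3)[OF V _ half])

lemma A_cnj: "A (cnj z) = cnj (A z)" and B_cnj: "B (cnj z) = cnj (B z)"
  by (rule entire_reflection[OF A_holomorphic A_real] entire_reflection[OF B_holomorphic B_real], assumption)+

definition dens :: "complex \<Rightarrow> complex \<Rightarrow> real \<Rightarrow> complex" where
  "dens z \<zeta> x = \<Phi> z x $ 1 * \<Phi> \<zeta> x $ 1 + \<Phi> z x $ 2 * \<Phi> \<zeta> x $ 2"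

text \<open>
  A bilinear pairing without complex conjugation, so that it depends holomorphically on both parameters.
\<close>
definition pairing :: "complex \<Rightarrow> complex \<Rightarrow> complex" where "pairing z \<zeta> = integral {0..b} (dens z \<zeta>)"

lemma \<Phi>_continuous: "continuous_on {0<..<b} (\<lambda>x. \<Phi> z x $ i)"
  by (rule dirac_solution_continuous[OF solD(1)[OF \<Phi>]])

lemma \<Phi>_bounded:
  obtains C where "0 \<le> C" "\<And>z x i. cmod z \<le> R \<Longrightarrow> x \<in> {0<..<b} \<Longrightarrow> cmod (\<Phi> z x $ i) \<le> C * x powr \<kappa>"
    "\<And>z x i. cmod z \<le> R \<Longrightarrow> x \<in> {0<..<b} \<Longrightarrow> cmod (\<Phi> z x $ i) \<le> C * b powr \<kappa>"
proof -
  obtain C where C: "\<forall>z. cmod z \<le> R \<longrightarrow> (\<forall>x\<in>{0<..<b}. \<forall>i. cmod (\<Phi> z x $ i) \<le> C * x powr \<kappa>)"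
    using \<Phi>_bound[of R] by (elim exE)
  have 1: "cmod (\<Phi> z x $ i) \<le> \<bar>C\<bar> * x powr \<kappa>" if "cmod z \<le> R" "x \<in> {0<..<b}" for z x i
  proof -
    have "cmod (\<Phi> z x $ i) \<le> C * x powr \<kappa>" using C that by blast
    also have "\<dots> \<le> \<bar>C\<bar> * x powr \<kappa>" by (intro mult_right_mono) auto
    finally show ?thesis .
  qed
  have 2: "cmod (\<Phi> z x $ i) \<le> \<bar>C\<bar> * b powr \<kappa>" if "cmod z \<le> R" "x \<in> {0<..<b}" for z x i
  proof -
    have "x powr \<kappa> \<le> b powr \<kappa>" using that(2) \<kappa> by (intro powr_mono2) auto
    then have "\<bar>C\<bar> * x powr \<kappa> \<le> \<bar>C\<bar> * b powr \<kappa>" by (intro mult_left_mono) auto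
    with 1[OF that, of i] show ?thesis by linarith
  qed
  show ?thesis by (rule that[of "\<bar>C\<bar>"]) (simp, (fact 1 2)+)
qed

lemma dens_bound:
  assumes C: "0 \<le> C" "\<And>i. cmod (\<Phi> z x $ i) \<le> C" "\<And>i. cmod (\<Phi> \<zeta> x $ i) \<le> C"
  shows "cmod (dens z \<zeta> x) \<le> 2 * C\<^sup>2"
proof -
  have "cmod (\<Phi> z x $ i * \<Phi> \<zeta> x $ i) \<le> C * C" for i
    unfolding norm_mult using C by (intro mult_mono) auto
  from order_trans[OF norm_triangle_ineq add_mono[OF this[of 1] this[of 2]]]
  show ?thesis by (simp add: dens_def power2_eq_square)
qed

lemma dens_absolutely_integrable: "dens z \<zeta> absolutely_integrable_on {0..b}"
proof -
  obtain C where C: "0 \<le> C" "\<And>z' x i. cmod z' \<le> max (cmod z) (cmod \<zeta>) \<Longrightarrow> x \<in> {0<..<b} \<Longrightarrow> cmod (\<Phi> z' x $ i) \<le> C * b powr \<kappa>"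
    using \<Phi>_bounded[of "max (cmod z) (cmod \<zeta>)"] by metis
  show ?thesis
  proof (rule bounded_continuous_absolutely_integrable)
    show "continuous_on {0<..<b} (dens z \<zeta>)"
      unfolding dens_def[abs_def] by (intro continuous_intros \<Phi>_continuous)
    show "norm (dens z \<zeta> x) \<le> 2 * (C * b powr \<kappa>)\<^sup>2" if "x \<in> {0<..<b}" for x
      by (rule dens_bound) (use C that in auto)
  qed
qed

lemma dens_integrable: "dens z \<zeta> integrable_on {0..b}"
  by (rule set_lebesgue_integral_eq_integral(1)[OF dens_absolutely_integrable])

text \<open>
  Both factors are \<open>O(x^\<kappa>)\<close>, so no boundary term arises at the singular endpoint.
\<close>
lemma wronskian_\<Phi>_at_0: "((\<lambda>x. wronskian x (\<Phi> z) (\<Phi> \<zeta>)) \<longlongrightarrow> 0) (at_right 0)"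
proof -
  obtain C where C: "0 \<le> C" "\<And>z' x i. cmod z' \<le> max (cmod z) (cmod \<zeta>) \<Longrightarrow> x \<in> {0<..<b} \<Longrightarrow> cmod (\<Phi> z' x $ i) \<le> C * x powr \<kappa>"
    using \<Phi>_bounded[of "max (cmod z) (cmod \<zeta>)"] by metis
  show ?thesis
  proof (rule Lim_null_comparison)
    have "cmod (wronskian x (\<Phi> z) (\<Phi> \<zeta>)) \<le> 2 * (C * x powr \<kappa>)\<^sup>2" if x: "x \<in> {0<..<b}" for x
    proof -
      have "cmod (\<Phi> z x $ i * \<Phi> \<zeta> x $ j) \<le> (C * x powr \<kappa>) * (C * x powr \<kappa>)" for i j
        unfolding norm_mult using C x by (intro mult_mono) auto
      from order_trans[OF norm_triangle_ineq4 add_mono[OF this[of 1 2] this[of 2 1]]]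
      show ?thesis by (simp only: wronskian_def power2_eq_square mult_2)
    qed
    then show "\<forall>\<^sub>F x in at_right 0. cmod (wronskian x (\<Phi> z) (\<Phi> \<zeta>)) \<le> 2 * (C * x powr \<kappa>)\<^sup>2"
      by (intro eventually_at_rightI[OF _ b])
    have "((\<lambda>x. x powr \<kappa>) \<longlongrightarrow> 0 powr \<kappa>) (at_right 0)"
      using \<kappa> by (intro tendsto_powr' tendsto_ident_at tendsto_const) (auto simp: eventually_at_filter)
    then have "((\<lambda>x. 2 * (C * x powr \<kappa>)\<^sup>2) \<longlongrightarrow> 2 * (C * 0)\<^sup>2) (at_right 0)"
      by (intro tendsto_intros) simp
    then show "((\<lambda>x. 2 * (C * x powr \<kappa>)\<^sup>2) \<longlongrightarrow> 0) (at_right 0)" by simp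
  qed
qed

lemma wronskian_\<Phi>_at_b: "((\<lambda>x. wronskian x (\<Phi> z) (\<Phi> \<zeta>)) \<longlongrightarrow> A z * B \<zeta> - B z * A \<zeta>) (at_left b)"
proof -
  have "((\<lambda>x. wronskian x (\<Phi> z) (\<Phi> \<zeta>)) \<longlongrightarrow>
      (A z * of_real (e 1) + B z * of_real (f 1)) * (A \<zeta> * of_real (e 2) + B \<zeta> * of_real (f 2))
      - (A z * of_real (e 2) + B z * of_real (f 2)) * (A \<zeta> * of_real (e 1) + B \<zeta> * of_real (f 1))) (at_left b)"
    unfolding A_def B_def
    by (rule wronskian_tendsto[where e = "\<lambda>i. wronskian (b / 2) (\<Phi> z) (V z) * of_real (e i) + wronskian (b / 2) (U z) (\<Phi> z) * of_real (f i)"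
          and f = "\<lambda>i. wronskian (b / 2) (\<Phi> \<zeta>) (V \<zeta>) * of_real (e i) + wronskian (b / 2) (U \<zeta>) (\<Phi> \<zeta>) * of_real (f i)"])
       (rule solution_limit[OF solD(1)[OF \<Phi>]])+
  also have "(A z * of_real (e 1) + B z * of_real (f 1)) * (A \<zeta> * of_real (e 2) + B \<zeta> * of_real (f 2))
      - (A z * of_real (e 2) + B z * of_real (f 2)) * (A \<zeta> * of_real (e 1) + B \<zeta> * of_real (f 1))
      = (A z * B \<zeta> - B z * A \<zeta>) * of_real (e 1 * f 2 - e 2 * f 1)"
    by (simp add: algebra_simps)
  finally show ?thesis unfolding det by simp
qed

text \<open>
  The Lagrange identity integrated over the whole interval; only the boundary term at \<open>b\<close> remains, where
  the values of \<Phi> are expressed through \<open>e\<close> and \<open>f\<close>.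
\<close>
lemma green_identity: "A z * B \<zeta> - B z * A \<zeta> = (z - \<zeta>) * pairing z \<zeta>"
proof -
  define H where "H = (\<lambda>x. integral {0..x} (dens z \<zeta>))"
  define w where "w = (\<lambda>x. wronskian x (\<Phi> z) (\<Phi> \<zeta>))"
  have cH: "continuous_on {0..b} H" unfolding H_def by (rule indefinite_integral_continuous_1[OF dens_integrable])
  have Hb: "(H \<longlongrightarrow> pairing z \<zeta>) (at_left b)" and H0: "(H \<longlongrightarrow> 0) (at_right 0)"
    using continuous_on_Icc_at_leftD[OF cH b] continuous_on_Icc_at_rightD[OF cH b] by (simp_all add: H_def pairing_def)
  have step: "w y - (z - \<zeta>) * H y = w x - (z - \<zeta>) * H x" if xy: "x \<in> {0<..<b}" "y \<in> {0<..<b}" "x \<le> y" for x y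
  proof -
    have "w y - w x = integral {x..y} (\<lambda>x. (z - \<zeta>) * dens z \<zeta> x)"
      using indef_integral_onD(4)[OF wronskian_indef[OF solD(1)[OF \<Phi>] solD(1)[OF \<Phi>]] xy, of z \<zeta>]
      by (simp add: w_def dens_def)
    also have "\<dots> = (z - \<zeta>) * integral {x..y} (dens z \<zeta>)" by simp
    also have "integral {x..y} (dens z \<zeta>) = H y - H x"
    proof -
      have "dens z \<zeta> integrable_on {0..y}" by (rule integrable_on_subinterval[OF dens_integrable]) (use xy in auto)
      then show ?thesis using Henstock_Kurzweil_Integration.integral_combine[of 0 x y "dens z \<zeta>"] xy
        by (simp add: H_def algebra_simps)
    qed
    finally show ?thesis by (simp add: algebra_simps)
  qed
  have const: "w y - (z - \<zeta>) * H y = w (b / 2) - (z - \<zeta>) * H (b / 2)" if y: "y \<in> {0<..<b}" for y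
    using step[OF y half] step[OF half y] by (cases "y \<le> b / 2") auto
  define c where "c = w (b / 2) - (z - \<zeta>) * H (b / 2)"
  have "\<forall>\<^sub>F y in at_right 0. w y - (z - \<zeta>) * H y = c"
    unfolding c_def by (rule eventually_at_rightI[OF const b])
  then have "((\<lambda>y. w y - (z - \<zeta>) * H y) \<longlongrightarrow> c) (at_right 0)" by (rule tendsto_eventually)
  moreover have "((\<lambda>y. w y - (z - \<zeta>) * H y) \<longlongrightarrow> 0 - (z - \<zeta>) * 0) (at_right 0)"
    unfolding w_def by (intro tendsto_intros H0 wronskian_\<Phi>_at_0)
  ultimately have "c = 0 - (z - \<zeta>) * 0" by (rule tendsto_unique[OF trivial_limit_at_right_real])
  have "\<forall>\<^sub>F y in at_left b. w y - (z - \<zeta>) * H y = c"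
    unfolding c_def by (rule eventually_at_leftI[OF const b])
  then have "((\<lambda>y. w y - (z - \<zeta>) * H y) \<longlongrightarrow> c) (at_left b)" by (rule tendsto_eventually)
  moreover have "((\<lambda>y. w y - (z - \<zeta>) * H y) \<longlongrightarrow> (A z * B \<zeta> - B z * A \<zeta>) - (z - \<zeta>) * pairing z \<zeta>) (at_left b)"
    unfolding w_def by (intro tendsto_intros Hb wronskian_\<Phi>_at_b)
  ultimately have "c = (A z * B \<zeta> - B z * A \<zeta>) - (z - \<zeta>) * pairing z \<zeta>"
    by (rule tendsto_unique[OF trivial_limit_at_left_real])
  with \<open>c = 0 - (z - \<zeta>) * 0\<close> show ?thesis by simp
qed

lemma pairing_tendsto:
  assumes "\<zeta>s \<longlonglongrightarrow> z"
  shows "(\<lambda>n. pairing (\<zeta>s n) \<zeta>) \<longlonglongrightarrow> pairing z \<zeta>"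
proof -
  obtain R0 where R0: "\<And>n. cmod (\<zeta>s n) \<le> R0"
    using convergent_imp_bounded[OF assms] unfolding bounded_iff by auto
  define R where "R = max R0 (max (cmod z) (cmod \<zeta>))"
  obtain C where C: "0 \<le> C" "\<And>z' x i. cmod z' \<le> R \<Longrightarrow> x \<in> {0<..<b} \<Longrightarrow> cmod (\<Phi> z' x $ i) \<le> C * b powr \<kappa>"
    using \<Phi>_bounded[of R] by metis
  have int: "integral {0..b} (dens z \<zeta>) = integral {0<..<b} (dens z \<zeta>)" for z \<zeta>
    by (simp add: integral_open_interval_real)
  have "(\<lambda>n. integral {0<..<b} (dens (\<zeta>s n) \<zeta>)) \<longlonglongrightarrow> integral {0<..<b} (dens z \<zeta>)"
  proof (rule dominated_convergence(2)[where h = "\<lambda>x. 2 * (C * b powr \<kappa>)\<^sup>2"])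
    show "dens (\<zeta>s n) \<zeta> integrable_on {0<..<b}" for n
      using dens_integrable[of "\<zeta>s n" \<zeta>] integrable_on_open_interval_real by blast
    show "(\<lambda>x. 2 * (C * b powr \<kappa>)\<^sup>2) integrable_on {0<..<b}"
      using integrable_on_open_interval_real integrable_const_ivl by blast
    show "norm (dens (\<zeta>s n) \<zeta> x) \<le> 2 * (C * b powr \<kappa>)\<^sup>2" if "x \<in> {0<..<b}" for n x
      by (rule dens_bound) (use C that R0[of n] in \<open>auto simp: R_def\<close>)
    show "(\<lambda>n. dens (\<zeta>s n) \<zeta> x) \<longlonglongrightarrow> dens z \<zeta> x" if x: "x \<in> {0<..<b}" for x
    proof -
      have "(\<lambda>n. \<Phi> (\<zeta>s n) x $ i) \<longlonglongrightarrow> \<Phi> z x $ i" for i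
      proof (rule continuous_on_tendsto_compose[where f = "\<lambda>z. \<Phi> z x $ i" and s = UNIV])
        show "continuous_on UNIV (\<lambda>z. \<Phi> z x $ i)"
          by (rule holomorphic_on_imp_continuous_on[OF solD(2)[OF \<Phi> x]])
      qed (use assms in auto)
      then show ?thesis unfolding dens_def by (intro tendsto_add tendsto_mult tendsto_const)
    qed
  qed
  then show ?thesis by (simp only: pairing_def int)
qed

definition energy :: "complex \<Rightarrow> real" where
  "energy z = integral {0..b} (\<lambda>x. (cmod (\<Phi> z x $ 1))\<^sup>2 + (cmod (\<Phi> z x $ 2))\<^sup>2)"

lemma dens_cnj: "x \<in> {0<..<b} \<Longrightarrow> dens z (cnj z) x = of_real ((cmod (\<Phi> z x $ 1))\<^sup>2 + (cmod (\<Phi> z x $ 2))\<^sup>2)"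
  by (simp only: dens_def solD(4)[OF \<Phi>] of_real_add complex_norm_square)

lemma pairing_cnj: "pairing z (cnj z) = of_real (energy z)"
  and energy_integrable: "(\<lambda>x. (cmod (\<Phi> z x $ 1))\<^sup>2 + (cmod (\<Phi> z x $ 2))\<^sup>2) integrable_on {0..b}"
proof -
  let ?g = "\<lambda>x. (cmod (\<Phi> z x $ 1))\<^sup>2 + (cmod (\<Phi> z x $ 2))\<^sup>2"
  have "(\<lambda>x. Re (dens z (cnj z) x)) integrable_on {0<..<b}"
    using integrable_linear[OF dens_integrable bounded_linear_Re] integrable_on_open_interval_real[of _ 0 b]
    by (auto simp: o_def)
  then have g: "?g integrable_on {0<..<b}"
    by (rule integrable_eq) (simp add: dens_cnj del: of_real_add of_real_power)
  then show "?g integrable_on {0..b}" using integrable_on_open_interval_real by blast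
  have "pairing z (cnj z) = integral {0<..<b} (dens z (cnj z))"
    unfolding pairing_def by (simp add: integral_open_interval_real)
  also have "\<dots> = integral {0<..<b} (\<lambda>x. complex_of_real (?g x))"
    by (rule Henstock_Kurzweil_Integration.integral_cong) (rule dens_cnj)
  also have "\<dots> = of_real (integral {0<..<b} ?g)"
    using integral_linear[OF g bounded_linear_of_real] by (simp only: o_def)
  also have "integral {0<..<b} ?g = energy z" unfolding energy_def by (simp add: integral_open_interval_real)
  finally show "pairing z (cnj z) = of_real (energy z)" .
qed

lemma \<Phi>_lower:
  assumes "x \<in> {0<..<b}" "x \<le> \<delta>" "cmod z * x \<le> \<delta>"
  shows "c0 / 2 * x powr \<kappa> \<le> Re (\<Phi> z x $ 2)"
proof -
  have "\<bar>Re (\<Phi> z x $ 2 - of_real (c0 * x powr \<kappa>))\<bar> \<le> c0 / 2 * x powr \<kappa>"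
    by (rule order_trans[OF abs_Re_le_cmod \<Phi>_near[OF assms]])
  then have "\<bar>Re (\<Phi> z x $ 2) - c0 * x powr \<kappa>\<bar> \<le> c0 / 2 * x powr \<kappa>" by simp
  then have "c0 * x powr \<kappa> - Re (\<Phi> z x $ 2) \<le> c0 / 2 * x powr \<kappa>" by linarith
  moreover have "c0 * x powr \<kappa> = c0 / 2 * x powr \<kappa> + c0 / 2 * x powr \<kappa>" by simp
  ultimately show ?thesis by linarith
qed

text \<open>
  Up to this radius the leading term controls \<Phi> for all parameters of modulus at most \<open>L\<close>. For
  \<open>L \<ge> 1\<close> it is inversely proportional to \<open>L\<close>.
\<close>
definition near_radius :: "real \<Rightarrow> real" where "near_radius L = min (b / 2) \<delta> / max 1 L"

lemma near_radius:
  assumes "cmod z \<le> L" "0 < x" "x \<le> near_radius L"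
  shows "x \<in> {0<..<b}" "x \<le> \<delta>" "cmod z * x \<le> \<delta>"
proof -
  have d: "0 < min (b / 2) \<delta>" using b \<delta> by simp
  have mx: "max 1 L * x \<le> min (b / 2) \<delta>"
  proof -
    have "0 < max 1 L" by (simp add: less_max_iff_disj)
    from pos_le_divide_eq[OF this] show ?thesis using assms(3) by (simp only: near_radius_def mult.commute)
  qed
  have "1 * x \<le> max 1 L * x" using assms(2) by (intro mult_right_mono) auto
  then have "x \<le> min (b / 2) \<delta>" using mx by simp
  then show "x \<in> {0<..<b}" "x \<le> \<delta>" using assms(2) b by auto
  have "cmod z * x \<le> max 1 L * x" using assms(1,2) by (intro mult_right_mono) auto
  then show "cmod z * x \<le> \<delta>" using mx by simp
qed

lemma near_radius_pos: "0 < near_radius L" using b \<delta> by (simp add: near_radius_def)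

text \<open>
  Near 0 the second component of \<Phi> is bounded below by its leading term.
\<close>
lemma energy_pos: "0 < energy z"
proof -
  define y where "y = near_radius (cmod z)"
  have y: "0 < y" "y \<in> {0<..<b}" using near_radius(1)[of z "cmod z" y] near_radius_pos by (auto simp: y_def)
  define g where "g = (\<lambda>x. (c0 / 2 * x powr \<kappa>)\<^sup>2)"
  have gi: "(g has_integral ((c0 / 2)\<^sup>2 * (y powr (2 * \<kappa> + 1) / (2 * \<kappa> + 1)))) {0..y}"
  proof -
    have "((\<lambda>x. x powr (2 * \<kappa>)) has_integral (y powr (2 * \<kappa> + 1) / (2 * \<kappa> + 1))) {0..y}"
      using has_integral_powr_from_0[of "2 * \<kappa>" y] \<kappa> y by simp
    from has_integral_mult_right[OF this, of "(c0 / 2)\<^sup>2"]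
    moreover have "(c0 / 2)\<^sup>2 * x powr (2 * \<kappa>) = g x" for x
      by (simp only: g_def power_mult_distrib) (simp add: power2_eq_square powr_add[symmetric])
    ultimately show ?thesis by (simp only:)
  qed
  have "0 < (c0 / 2)\<^sup>2 * (y powr (2 * \<kappa> + 1) / (2 * \<kappa> + 1))" using c0 y \<kappa> by simp
  also have "\<dots> = integral {0..y} g" using gi by (simp add: integral_unique)
  also have "\<dots> \<le> integral {0..y} (\<lambda>x. (cmod (\<Phi> z x $ 1))\<^sup>2 + (cmod (\<Phi> z x $ 2))\<^sup>2)"
  proof (rule integral_le)
    show "g integrable_on {0..y}" using gi by blast
    show "(\<lambda>x. (cmod (\<Phi> z x $ 1))\<^sup>2 + (cmod (\<Phi> z x $ 2))\<^sup>2) integrable_on {0..y}"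
      by (rule integrable_on_subinterval[OF energy_integrable]) (use y in auto)
    fix x assume x: "x \<in> {0..y}"
    show "g x \<le> (cmod (\<Phi> z x $ 1))\<^sup>2 + (cmod (\<Phi> z x $ 2))\<^sup>2"
    proof (cases "x = 0")
      case False
      then have "0 < x" "x \<le> near_radius (cmod z)" using x by (auto simp: y_def)
      from \<Phi>_lower[OF near_radius[OF order_refl this]]
      have "c0 / 2 * x powr \<kappa> \<le> cmod (\<Phi> z x $ 2)" using complex_Re_le_cmod order_trans by blast
      then have "g x \<le> (cmod (\<Phi> z x $ 2))\<^sup>2" unfolding g_def using c0 by (intro power_mono) auto
      then show ?thesis by (simp add: add_increasing)
    qed (simp add: g_def)
  qed
  also have "\<dots> \<le> energy z"
    unfolding energy_def using y
    by (intro integral_subset_le energy_integrable integrable_on_subinterval[OF energy_integrable]) auto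
  finally show ?thesis .
qed

text \<open>
  Green's identity for \<open>z\<close> and its conjugate: the eigenvalues of a symmetric boundary value problem are
  real.
\<close>
lemma B_nonreal: "z \<notin> \<real> \<Longrightarrow> B z \<noteq> 0"
proof
  assume z: "z \<notin> \<real>" and Bz: "B z = 0"
  have "(z - cnj z) * of_real (energy z) = 0"
    using green_identity[of z "cnj z"] by (simp add: Bz B_cnj pairing_cnj)
  then show False using z energy_pos[of z] by (simp add: Reals_cnj_iff)
qed

text \<open>
  \<open>B\<close> vanishes exactly when \<Phi> is a multiple of \<open>U\<close>, that is, when \<Phi> satisfies the boundary condition
  at \<open>b\<close>.
\<close>
definition eigenvalues :: "real set" where "eigenvalues = {l. B (of_real l) = 0}"

lemma B_eq_0_iff: "B z = 0 \<longleftrightarrow> z \<in> complex_of_real ` eigenvalues"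
  using B_nonreal[of z] by (auto simp: eigenvalues_def elim: Reals_cases)

text \<open>
  Green's identity divided by \<open>z - \<zeta>\<close>, with one parameter equal to the eigenvalue and the
  other one tending to it.
\<close>
lemma derivative_at_eigenvalue:
  assumes l: "l \<in> eigenvalues"
  shows "deriv B (of_real l) * A (of_real l) = - of_real (energy (of_real l))"
proof -
  define z where "z = complex_of_real l"
  have Bz: "B z = 0" using l by (simp add: z_def eigenvalues_def)
  define zs where "zs = (\<lambda>n. z + of_real (1 / real (Suc n)))"
  have "(\<lambda>n. 1 / real (Suc n)) \<longlonglongrightarrow> 0" using LIMSEQ_inverse_real_of_nat by (simp add: inverse_eq_divide)
  from tendsto_add[OF tendsto_const[of z] tendsto_of_real[OF this]]
  have zs: "zs \<longlonglongrightarrow> z" by (simp only: zs_def of_real_0 add_0_right)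
  have ne: "zs n \<noteq> z" for n
  proof -
    have "complex_of_real (1 / real (Suc n)) \<noteq> 0" by (simp only: of_real_eq_0_iff) simp
    then show ?thesis by (simp only: zs_def add_cancel_left_right simp_thms)
  qed
  have "(B has_field_derivative deriv B z) (at z)"
    by (rule holomorphic_derivI[OF B_holomorphic open_UNIV UNIV_I])
  then have "((\<lambda>w. (B w - B z) / (w - z)) \<longlongrightarrow> deriv B z) (at z)" by (simp add: has_field_derivative_iff)
  then have "(\<lambda>n. (B (zs n) - B z) / (zs n - z)) \<longlonglongrightarrow> deriv B z"
    by (rule filterlim_compose) (use zs ne in \<open>simp add: filterlim_at\<close>)
  from tendsto_mult[OF this tendsto_const[of "A z"]]
  have "(\<lambda>n. (B (zs n) - B z) / (zs n - z) * A z) \<longlonglongrightarrow> deriv B z * A z" .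
  moreover have "(B (zs n) - B z) / (zs n - z) * A z = - pairing (zs n) z" for n
  proof -
    have "B (zs n) * A z = - ((zs n - z) * pairing (zs n) z)"
      using green_identity[of "zs n" z] Bz by (simp add: algebra_simps)
    then show ?thesis using ne[of n] Bz by simp
  qed
  ultimately have "(\<lambda>n. - pairing (zs n) z) \<longlonglongrightarrow> deriv B z * A z" by (simp only:)
  moreover have "(\<lambda>n. - pairing (zs n) z) \<longlonglongrightarrow> - pairing z z" by (intro tendsto_minus pairing_tendsto zs)
  ultimately have "deriv B z * A z = - pairing z z" by (rule LIMSEQ_unique)
  also have "pairing z z = of_real (energy z)" using pairing_cnj[of z] by (simp add: z_def)
  finally show ?thesis by (simp only: z_def)
qed

lemma pairing_orthogonal:
  assumes "l \<in> eigenvalues" "m \<in> eigenvalues" "l \<noteq> m"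
  shows "pairing (of_real l) (of_real m) = 0"
  using green_identity[of "of_real l" "of_real m"] assms by (simp add: eigenvalues_def)

end

section \<open>Growth of the spectral weights\<close>

context dirac_boundary begin

definition \<phi> :: "real \<Rightarrow> 2 \<Rightarrow> real \<Rightarrow> real" where "\<phi> l i y = Re (\<Phi> (of_real l) y $ i)"

lemma \<Phi>_eq_\<phi>: "y \<in> {0<..<b} \<Longrightarrow> \<Phi> (of_real l) y $ i = of_real (\<phi> l i y)"
  unfolding \<phi>_def using solD(3)[OF \<Phi>, of "of_real l" y i] by (simp add: of_real_Re)

lemma \<phi>_pairing:
  "((\<lambda>y. \<phi> l 1 y * \<phi> m 1 y + \<phi> l 2 y * \<phi> m 2 y) has_integral Re (pairing (of_real l) (of_real m))) {0..b}"
proof -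
  have "(dens (of_real l) (of_real m) has_integral pairing (of_real l) (of_real m)) {0..b}"
    unfolding pairing_def by (rule integrable_integral[OF dens_integrable])
  from has_integral_linear[OF this bounded_linear_Re]
  have "((\<lambda>y. Re (dens (of_real l) (of_real m) y)) has_integral Re (pairing (of_real l) (of_real m))) {0..b}"
    by (simp only: o_def)
  then show ?thesis
  proof (rule has_integral_spike_finite[of "{0, b}", rotated 2])
    fix y assume "y \<in> {0..b} - {0, b}"
    then have "y \<in> {0<..<b}" by auto
    from \<Phi>_eq_\<phi>[OF this]
    show "\<phi> l 1 y * \<phi> m 1 y + \<phi> l 2 y * \<phi> m 2 y = Re (dens (of_real l) (of_real m) y)"
      by (simp add: dens_def)
  qed simp
qed

lemma pairing_eigenvalues:
  assumes "l \<in> eigenvalues" "m \<in> eigenvalues"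
  shows "Re (pairing (of_real l) (of_real m)) = (if l = m then energy (of_real l) else 0)"
  using pairing_orthogonal[OF assms] pairing_cnj[of "of_real l"] by auto

lemma power_times_\<phi>_absolutely_integrable:
  assumes x: "x < b"
  shows "(\<lambda>y. y powr \<kappa> * \<phi> l 2 y) absolutely_integrable_on {0..x}"
proof -
  obtain C where C: "0 \<le> C" "\<And>z' x i. cmod z' \<le> \<bar>l\<bar> \<Longrightarrow> x \<in> {0<..<b} \<Longrightarrow> cmod (\<Phi> z' x $ i) \<le> C * b powr \<kappa>"
    using \<Phi>_bounded[of "\<bar>l\<bar>"] by metis
  show ?thesis
  proof (rule bounded_continuous_absolutely_integrable)
    show "continuous_on {0<..<x} (\<lambda>y. y powr \<kappa> * \<phi> l 2 y)"
      unfolding \<phi>_def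
      by (intro continuous_on_mult continuous_on_Re continuous_on_subset[OF \<Phi>_continuous] continuous_intros) (use x in auto)
    fix y assume y: "y \<in> {0<..<x}"
    have "\<bar>\<phi> l 2 y\<bar> \<le> C * b powr \<kappa>"
      unfolding \<phi>_def by (rule order_trans[OF abs_Re_le_cmod C(2)]) (use y x in auto)
    moreover have "y powr \<kappa> \<le> b powr \<kappa>" using y x \<kappa> by (intro powr_mono2) auto
    ultimately show "norm (y powr \<kappa> * \<phi> l 2 y) \<le> b powr \<kappa> * (C * b powr \<kappa>)"
      unfolding norm_mult by (intro mult_mono) auto
  qed
qed

text \<open>
  Eigenfunctions for different eigenvalues are orthogonal by Green's identity, so this is Bessel's
  inequality for the function \<open>(0, y^\<kappa>)\<close> restricted to \<open>(0, x)\<close>, whose squared norm is the right-hand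
  side.
\<close>
lemma bessel_inequality:
  assumes F: "finite F" "F \<subseteq> eigenvalues" and x: "0 < x" "x < b"
  shows "(\<Sum>l\<in>F. (integral {0..x} (\<lambda>y. y powr \<kappa> * \<phi> l 2 y))\<^sup>2 / energy (of_real l))
    \<le> x powr (2 * \<kappa> + 1) / (2 * \<kappa> + 1)"
proof -
  define H where "H = x powr (2 * \<kappa> + 1) / (2 * \<kappa> + 1)"
  define c where "c = (\<lambda>l. integral {0..x} (\<lambda>y. y powr \<kappa> * \<phi> l 2 y))"
  define N where "N = (\<lambda>l. energy (complex_of_real l))"
  define h where "h = (\<lambda>y. if y \<in> {0..x} then y powr \<kappa> else 0)"
  \<comment> \<open>Fourier coefficients; the squared distance to the corresponding combination \<open>s\<close> is nonnegative.\<close>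
  define a where "a = (\<lambda>l. c l / N l)"
  have N: "N l > 0" for l by (simp add: N_def energy_pos)
  have sub: "{0..x} \<subseteq> {0..b}" using x by auto
  have hh: "((\<lambda>y. h y * h y) has_integral H) {0..b}"
  proof -
    have "((\<lambda>y. y powr (2 * \<kappa>)) has_integral H) {0..x}"
      using has_integral_powr_from_0[of "2 * \<kappa>" x] \<kappa> x by (simp add: H_def)
    then have "((\<lambda>y. if y \<in> {0..x} then y powr (2 * \<kappa>) else 0) has_integral H) {0..b}"
      by (subst has_integral_restrict[OF sub])
    then show ?thesis
      by (rule has_integral_eq[rotated]) (auto simp: h_def powr_add[symmetric])
  qed
  have h\<phi>: "((\<lambda>y. h y * \<phi> l 2 y) has_integral c l) {0..b}" for l
  proof -
    have "((\<lambda>y. y powr \<kappa> * \<phi> l 2 y) has_integral c l) {0..x}"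
      unfolding c_def by (rule integrable_integral[OF set_lebesgue_integral_eq_integral(1)[OF power_times_\<phi>_absolutely_integrable[OF x(2)]]])
    then have "((\<lambda>y. if y \<in> {0..x} then y powr \<kappa> * \<phi> l 2 y else 0) has_integral c l) {0..b}"
      by (subst has_integral_restrict[OF sub])
    then show ?thesis
      by (rule has_integral_eq[rotated]) (auto simp: h_def)
  qed
  define s where "s = (\<lambda>i y. \<Sum>l\<in>F. a l * \<phi> l i y)"
  have "((\<lambda>y. h y * h y - 2 * (\<Sum>l\<in>F. a l * (h y * \<phi> l 2 y))
        + (\<Sum>l\<in>F. \<Sum>m\<in>F. (a l * a m) * (\<phi> l 1 y * \<phi> m 1 y + \<phi> l 2 y * \<phi> m 2 y)))
      has_integral (H - 2 * (\<Sum>l\<in>F. a l * c l) + (\<Sum>l\<in>F. \<Sum>m\<in>F. (a l * a m) * Re (pairing (of_real l) (of_real m))))) {0..b}"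
    by (intro has_integral_add has_integral_diff has_integral_mult_right has_integral_sum hh h\<phi> \<phi>_pairing F(1))
  moreover have "h y * h y - 2 * (\<Sum>l\<in>F. a l * (h y * \<phi> l 2 y))
        + (\<Sum>l\<in>F. \<Sum>m\<in>F. (a l * a m) * (\<phi> l 1 y * \<phi> m 1 y + \<phi> l 2 y * \<phi> m 2 y))
      = (h y - s 2 y)\<^sup>2 + (s 1 y)\<^sup>2" for y
  proof -
    have "(\<Sum>l\<in>F. \<Sum>m\<in>F. (a l * a m) * (\<phi> l 1 y * \<phi> m 1 y + \<phi> l 2 y * \<phi> m 2 y)) = s 1 y * s 1 y + s 2 y * s 2 y"
      unfolding s_def sum_product sum.distrib[symmetric] by (intro sum.cong refl) (simp add: algebra_simps)
    moreover have "(\<Sum>l\<in>F. a l * (h y * \<phi> l 2 y)) = h y * s 2 y"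
      unfolding s_def sum_distrib_left by (intro sum.cong refl) simp
    ultimately show ?thesis by (simp add: power2_eq_square algebra_simps)
  qed
  ultimately have "0 \<le> H - 2 * (\<Sum>l\<in>F. a l * c l) + (\<Sum>l\<in>F. \<Sum>m\<in>F. (a l * a m) * Re (pairing (of_real l) (of_real m)))"
    by (auto intro: has_integral_nonneg)
  also have "(\<Sum>l\<in>F. \<Sum>m\<in>F. (a l * a m) * Re (pairing (of_real l) (of_real m))) = (\<Sum>l\<in>F. a l * c l)"
  proof (intro sum.cong refl)
    fix l assume l: "l \<in> F"
    have "(\<Sum>m\<in>F. (a l * a m) * Re (pairing (of_real l) (of_real m))) = (\<Sum>m\<in>F. if l = m then a l * a l * N l else 0)"
    proof (intro sum.cong refl)
      fix m assume m: "m \<in> F"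
      have "Re (pairing (of_real l) (of_real m)) = (if l = m then energy (of_real l) else 0)"
        by (rule pairing_eigenvalues) (use l m F in auto)
      then show "(a l * a m) * Re (pairing (of_real l) (of_real m)) = (if l = m then a l * a l * N l else 0)"
        by (simp add: N_def)
    qed
    also have "\<dots> = a l * a l * N l" using F(1) l by simp
    also have "\<dots> = a l * c l" using N[of l] by (simp add: a_def)
    finally show "(\<Sum>m\<in>F. (a l * a m) * Re (pairing (of_real l) (of_real m))) = a l * c l" .
  qed
  finally have "(\<Sum>l\<in>F. a l * c l) \<le> H" by simp
  moreover have "(\<Sum>l\<in>F. a l * c l) = (\<Sum>l\<in>F. (c l)\<^sup>2 / N l)"
    by (simp add: a_def power2_eq_square)
  ultimately show ?thesis by (simp only: c_def N_def H_def)
qed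

definition weight :: "real \<Rightarrow> real" where "weight l = 1 / energy (of_real l)"

lemma weight_pos: "0 < weight l" by (simp add: weight_def energy_pos)

text \<open>
  With \<open>x\<close> proportional to \<open>1 / L\<close>, the second component of every eigenfunction with \<open>\<bar>l\<bar> \<le> L\<close> is at least
  \<open>c0 / 2 * y^\<kappa>\<close> on \<open>(0, x)\<close>, so each coefficient in Bessel's inequality is at least a multiple of the
  squared norm \<open>H\<close> of the test function. The sum of the weights is then at most a multiple of \<open>1 / H\<close>.
\<close>
lemma weight_sum_bound:
  obtains K where "0 \<le> K"
    "\<And>F L. finite F \<Longrightarrow> F \<subseteq> eigenvalues \<Longrightarrow> (\<And>l. l \<in> F \<Longrightarrow> \<bar>l\<bar> \<le> L) \<Longrightarrow> 1 \<le> L \<Longrightarrow>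
       (\<Sum>l\<in>F. weight l) \<le> K * L powr (2 * \<kappa> + 1)"
proof -
  define p where "p = 2 * \<kappa> + 1"
  define \<mu> where "\<mu> = min (b / 2) \<delta>"
  define K where "K = 4 * p / (c0\<^sup>2 * \<mu> powr p)"
  have p: "p > 0" using \<kappa> by (simp add: p_def)
  have \<mu>: "\<mu> > 0" using b \<delta> by (simp add: \<mu>_def)
  have K0: "0 \<le> K" using p by (simp add: K_def)
  have "(\<Sum>l\<in>F. weight l) \<le> K * L powr p"
    if F: "finite F" "F \<subseteq> eigenvalues" "\<And>l. l \<in> F \<Longrightarrow> \<bar>l\<bar> \<le> L" and L: "1 \<le> L" for F L
  proof -
    define x where "x = near_radius L"
    have xe: "x = \<mu> / L" using L by (simp add: x_def near_radius_def \<mu>_def)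
    have x: "0 < x" using near_radius_pos by (simp add: x_def)
    have xb: "x < b" using near_radius(1)[of 0 L x] x L by (simp add: x_def)
    define H where "H = x powr p / p"
    have H: "H > 0" using x p by (simp add: H_def)
    have c: "c0 / 2 * H \<le> integral {0..x} (\<lambda>y. y powr \<kappa> * \<phi> l 2 y)" if l: "l \<in> F" for l
    proof -
      have 1: "((\<lambda>y. c0 / 2 * y powr (2 * \<kappa>)) has_integral (c0 / 2 * H)) {0..x}"
        using has_integral_powr_from_0[of "2 * \<kappa>" x] \<kappa> x
        by (intro has_integral_mult_right) (simp add: H_def p_def)
      have int: "(\<lambda>y. y powr \<kappa> * \<phi> l 2 y) integrable_on {0..x}"
        by (rule set_lebesgue_integral_eq_integral(1)[OF power_times_\<phi>_absolutely_integrable[OF xb]])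
      have "integral {0..x} (\<lambda>y. c0 / 2 * y powr (2 * \<kappa>)) \<le> integral {0..x} (\<lambda>y. y powr \<kappa> * \<phi> l 2 y)"
      proof (rule integral_le[OF _ int])
        show "(\<lambda>y. c0 / 2 * y powr (2 * \<kappa>)) integrable_on {0..x}" using 1 by blast
        fix y assume y: "y \<in> {0..x}"
        show "c0 / 2 * y powr (2 * \<kappa>) \<le> y powr \<kappa> * \<phi> l 2 y"
        proof (cases "y = 0")
          case False
          then have y': "0 < y" "y \<le> near_radius L" using y by (auto simp: x_def)
          have "c0 / 2 * y powr \<kappa> \<le> \<phi> l 2 y"
            unfolding \<phi>_def by (rule \<Phi>_lower[OF near_radius[OF _ y', of "of_real l"]]) (use F(3)[OF l] in simp_all)
          then have "y powr \<kappa> * (c0 / 2 * y powr \<kappa>) \<le> y powr \<kappa> * \<phi> l 2 y" by (intro mult_left_mono) auto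
          moreover have "y powr \<kappa> * y powr \<kappa> = y powr (2 * \<kappa>)" by (simp add: powr_add[symmetric])
          ultimately show ?thesis by (simp add: mult_ac)
        qed simp
      qed
      then show ?thesis by (simp only: integral_unique[OF 1])
    qed
    have "(\<Sum>l\<in>F. (c0 / 2 * H)\<^sup>2 * weight l)
        \<le> (\<Sum>l\<in>F. (integral {0..x} (\<lambda>y. y powr \<kappa> * \<phi> l 2 y))\<^sup>2 / energy (of_real l))"
    proof (rule sum_mono)
      fix l assume l: "l \<in> F"
      have "(c0 / 2 * H)\<^sup>2 \<le> (integral {0..x} (\<lambda>y. y powr \<kappa> * \<phi> l 2 y))\<^sup>2"
        using c[OF l] c0 H by (intro power_mono) auto
      from divide_right_mono[OF this less_imp_le[OF energy_pos[of "of_real l"]]]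
      show "(c0 / 2 * H)\<^sup>2 * weight l \<le> (integral {0..x} (\<lambda>y. y powr \<kappa> * \<phi> l 2 y))\<^sup>2 / energy (of_real l)"
        by (simp add: weight_def)
    qed
    also have "\<dots> \<le> H"
      using bessel_inequality[OF F(1,2) x xb] by (simp add: H_def p_def)
    finally have "(c0 / 2 * H)\<^sup>2 * (\<Sum>l\<in>F. weight l) \<le> H" by (simp only: sum_distrib_left)
    then have "(\<Sum>l\<in>F. weight l) \<le> H / (c0 / 2 * H)\<^sup>2"
      using c0 H by (simp add: pos_le_divide_eq mult.commute)
    also have "\<dots> = 4 / (c0\<^sup>2 * H)" using H c0 by (simp add: power2_eq_square)
    also have "\<dots> = K * L powr p"
      using L \<mu> p by (simp add: H_def xe K_def powr_divide)
    finally show ?thesis .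
  qed
  then show ?thesis using that[OF K0] by (simp only: p_def)
qed

end

lemma dyadic_bracket:
  assumes "1 \<le> (y :: real)"
  obtains n where "2 ^ n \<le> y" "y \<le> 2 ^ Suc n"
proof -
  obtain n where n: "y < 2 ^ n" using real_arch_pow[of 2 y] by auto
  define m where "m = (LEAST n. y < 2 ^ n)"
  have m: "y < 2 ^ m" unfolding m_def by (rule LeastI[where P = "\<lambda>n. y < 2 ^ n", OF n])
  have "m \<noteq> 0" using m assms by (intro notI) simp
  then obtain j where j: "m = Suc j" using not0_implies_Suc by blast
  have "\<not> y < 2 ^ j" using not_less_Least[of j "\<lambda>n. y < 2 ^ n"] j by (simp add: m_def)
  then show ?thesis using that[of j] m j by simp
qed

text \<open>
  The indices with \<open>1 + \<bar>l\<bar>\<close> between \<open>2 ^ n\<close> and \<open>2 ^ (n + 1)\<close> contribute at most a constant times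
  \<open>2 powr (n * (p - q))\<close>, a geometric sequence.
\<close>
lemma summable_on_if_partial_sums_le_powr:
  fixes w :: "real \<Rightarrow> real" and p :: real and q :: nat
  assumes w: "\<And>l. l \<in> Z \<Longrightarrow> 0 \<le> w l" and K: "0 \<le> K" and q: "p < real q"
    and bd: "\<And>F L. finite F \<Longrightarrow> F \<subseteq> Z \<Longrightarrow> (\<And>l. l \<in> F \<Longrightarrow> \<bar>l\<bar> \<le> L) \<Longrightarrow> 1 \<le> L \<Longrightarrow> (\<Sum>l\<in>F. w l) \<le> K * L powr p"
  shows "(\<lambda>l. w l / (1 + \<bar>l\<bar>) ^ q) summable_on Z"
proof (rule nonneg_bdd_above_summable_on)
  show "0 \<le> w l / (1 + \<bar>l\<bar>) ^ q" if "l \<in> Z" for l using w[OF that] by simp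
  define r where "r = 2 powr (p - real q)"
  have r: "0 < r" "r < 1"
    using q powr_less_mono[of "p - real q" 0 2] by (simp_all add: r_def)
  have "(\<Sum>l\<in>F. w l / (1 + \<bar>l\<bar>) ^ q) \<le> K * 2 powr p * (1 / (1 - r))" if F: "finite F" "F \<subseteq> Z" for F
  proof -
    have "\<forall>l :: real. \<exists>n. 2 ^ n \<le> 1 + \<bar>l\<bar> \<and> 1 + \<bar>l\<bar> \<le> 2 ^ Suc n"
    proof
      fix l :: real
      obtain n where "2 ^ n \<le> 1 + \<bar>l\<bar>" "1 + \<bar>l\<bar> \<le> 2 ^ Suc n" using dyadic_bracket[of "1 + \<bar>l\<bar>"] by auto
      then show "\<exists>n. 2 ^ n \<le> 1 + \<bar>l\<bar> \<and> 1 + \<bar>l\<bar> \<le> 2 ^ Suc n" by blast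
    qed
    from choice[OF this] obtain j where j: "\<forall>l. 2 ^ j l \<le> 1 + \<bar>l :: real\<bar> \<and> 1 + \<bar>l\<bar> \<le> 2 ^ Suc (j l)" by (elim exE)
    obtain M where M: "\<And>l. l \<in> F \<Longrightarrow> j l < M"
      using finite_nat_set_iff_bounded[of "j ` F"] F(1) by auto
    \<comment> \<open>The whole ball of radius \<open>2 ^ Suc n\<close> is summed for each \<open>n\<close>, as \<open>bd\<close> speaks of balls.\<close>
    have "(\<Sum>l\<in>F. w l / (1 + \<bar>l\<bar>) ^ q)
        \<le> (\<Sum>l\<in>F. \<Sum>n<M. if 1 + \<bar>l\<bar> \<le> 2 ^ Suc n then w l / (2 ^ n) ^ q else 0)"
    proof (rule sum_mono)
      fix l assume l: "l \<in> F"
      then have wl: "0 \<le> w l" using w F by auto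
      have "w l / (1 + \<bar>l\<bar>) ^ q \<le> w l / (2 ^ j l) ^ q"
        using j wl by (intro divide_left_mono power_mono mult_pos_pos) auto
      also have "\<dots> = (if 1 + \<bar>l\<bar> \<le> 2 ^ Suc (j l) then w l / (2 ^ j l) ^ q else 0)" using j by simp
      also have "\<dots> \<le> (\<Sum>n<M. if 1 + \<bar>l\<bar> \<le> 2 ^ Suc n then w l / (2 ^ n) ^ q else 0)"
        by (rule member_le_sum[of _ _ "\<lambda>n. if 1 + \<bar>l\<bar> \<le> 2 ^ Suc n then w l / (2 ^ n) ^ q else 0"])
           (use M[OF l] wl in auto)
      finally show "w l / (1 + \<bar>l\<bar>) ^ q \<le> (\<Sum>n<M. if 1 + \<bar>l\<bar> \<le> 2 ^ Suc n then w l / (2 ^ n) ^ q else 0)" .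
    qed
    also have "\<dots> = (\<Sum>n<M. (\<Sum>l\<in>{l \<in> F. 1 + \<bar>l\<bar> \<le> 2 ^ Suc n}. w l) / (2 ^ n) ^ q)"
      by (subst sum.swap, intro sum.cong refl)
         (simp only: sum.inter_filter[OF F(1)] sum_divide_distrib, intro sum.cong refl, simp)
    also have "\<dots> \<le> (\<Sum>n<M. K * 2 powr p * r ^ n)"
    proof (rule sum_mono)
      fix n
      have "(\<Sum>l\<in>{l \<in> F. 1 + \<bar>l\<bar> \<le> 2 ^ Suc n}. w l) \<le> K * (2 ^ Suc n) powr p"
        by (rule bd) (use F one_le_power[of "2 :: real" "Suc n"] in auto)
      then have "(\<Sum>l\<in>{l \<in> F. 1 + \<bar>l\<bar> \<le> 2 ^ Suc n}. w l) / (2 ^ n) ^ q \<le> K * (2 ^ Suc n) powr p / (2 ^ n) ^ q"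
        by (rule divide_right_mono) simp
      also have "K * (2 ^ Suc n) powr p / (2 ^ n) ^ q = K * 2 powr p * r ^ n"
      proof -
        have "(2 ^ Suc n :: real) powr p = 2 powr p * 2 powr (real n * p)"
        proof -
          have "(2 ^ Suc n :: real) powr p = 2 powr (real (Suc n) * p)"
            using powr_realpow[of 2 "Suc n"] by (simp only: powr_powr[symmetric])
          also have "real (Suc n) * p = p + real n * p" by (simp add: algebra_simps)
          finally show ?thesis by (simp only: powr_add)
        qed
        moreover have "(2 ^ n :: real) ^ q = 2 powr (real n * real q)"
          by (simp add: powr_realpow[symmetric] powr_powr power_mult[symmetric])
        moreover have "r ^ n = 2 powr (real n * p) / 2 powr (real n * real q)"
          by (simp add: r_def powr_power powr_diff[symmetric] algebra_simps)
        ultimately show ?thesis by simp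
      qed
      finally show "(\<Sum>l\<in>{l \<in> F. 1 + \<bar>l\<bar> \<le> 2 ^ Suc n}. w l) / (2 ^ n) ^ q \<le> K * 2 powr p * r ^ n" .
    qed
    also have "\<dots> = K * 2 powr p * (\<Sum>n<M. r ^ n)" by (simp only: sum_distrib_left)
    also have "(\<Sum>n<M. r ^ n) \<le> 1 / (1 - r)"
      using r by (simp add: sum_gp_strict divide_right_mono)
    finally show ?thesis using K by (simp add: mult_left_mono)
  qed
  then show "bdd_above (sum (\<lambda>l. w l / (1 + \<bar>l\<bar>) ^ q) ` {F. F \<subseteq> Z \<and> finite F})"
    by (intro bdd_aboveI[of _ "K * 2 powr p * (1 / (1 - r))"]) auto
qed

context dirac_boundary begin

lemma weight_summable:
  assumes "2 * \<kappa> + 1 < real q"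
  shows "(\<lambda>l. weight l / (1 + \<bar>l\<bar>) ^ q) summable_on eigenvalues"
proof (rule weight_sum_bound)
  fix K assume K: "0 \<le> K"
    "\<And>F L. finite F \<Longrightarrow> F \<subseteq> eigenvalues \<Longrightarrow> (\<And>l. l \<in> F \<Longrightarrow> \<bar>l\<bar> \<le> L) \<Longrightarrow> 1 \<le> L \<Longrightarrow>
       (\<Sum>l\<in>F. weight l) \<le> K * L powr (2 * \<kappa> + 1)"
  show ?thesis by (rule summable_on_if_partial_sums_le_powr[OF less_imp_le[OF weight_pos] K(1) assms K(2)])
qed

text \<open>
  Otherwise \<open>B\<close> would vanish identically, although it has no zero off the real axis.
\<close>
lemma real_non_eigenvalue_exists: "\<exists>t :: real. t \<notin> eigenvalues"
proof (rule ccontr)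
  assume "\<not> (\<exists>t :: real. t \<notin> eigenvalues)"
  then have 0: "B z = 0" if "z \<in> \<real>" for z using that by (auto simp: B_eq_0_iff elim: Reals_cases)
  from analytic_continuation[OF B_holomorphic open_UNIV connected_UNIV subset_UNIV UNIV_I zero_islimpt_Reals 0 UNIV_I[of \<i>]]
  have "B \<i> = 0" .
  then show False using B_nonreal[of \<i>] by (simp add: complex_is_Real_iff)
qed

lemma eigenvalue_gap:
  assumes t: "t \<notin> eigenvalues"
  obtains g where "0 < g" "\<And>l. l \<in> eigenvalues \<Longrightarrow> g * (1 + \<bar>l\<bar>) \<le> \<bar>l - t\<bar>"
proof -
  have "B (of_real t) \<noteq> 0" using t by (simp add: eigenvalues_def)
  moreover have "isCont B (of_real t)"
    using holomorphic_on_imp_continuous_on[OF B_holomorphic[of UNIV]] by (simp add: continuous_on_eq_continuous_at)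
  ultimately obtain d where d: "0 < d" "\<And>z. dist (of_real t) z < d \<Longrightarrow> B z \<noteq> 0"
    using continuous_at_avoid[of "of_real t" B 0] by auto
  have far: "d \<le> \<bar>l - t\<bar>" if "l \<in> eigenvalues" for l
  proof (rule ccontr)
    assume "\<not> d \<le> \<bar>l - t\<bar>"
    then have "dist (complex_of_real t) (of_real l) < d" by (simp add: dist_of_real dist_real_def abs_minus_commute)
    then show False using d(2) that by (auto simp: eigenvalues_def)
  qed
  define g where "g = 1 / (1 + (1 + \<bar>t\<bar>) / d)"
  have D: "0 < 1 + (1 + \<bar>t\<bar>) / d" using d(1) by (intro add_pos_nonneg) auto
  have "g * (1 + \<bar>l\<bar>) \<le> \<bar>l - t\<bar>" if l: "l \<in> eigenvalues" for l
  proof -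
    have "1 + \<bar>t\<bar> \<le> (1 + \<bar>t\<bar>) / d * \<bar>l - t\<bar>"
      using far[OF l] d(1) by (simp add: pos_le_divide_eq mult_left_mono)
    then have "1 + \<bar>l\<bar> \<le> \<bar>l - t\<bar> * (1 + (1 + \<bar>t\<bar>) / d)" by (simp add: ring_distribs mult.commute)
    then show ?thesis using D by (simp add: g_def pos_divide_le_eq)
  qed
  moreover have "0 < g" using D by (simp add: g_def)
  ultimately show ?thesis using that by blast
qed

end

section \<open>The singular Weyl function\<close>

context dirac_fundamental_system begin

lemma const_wronskian_eq:
  assumes "\<And>x. x \<in> {0<..<b} \<Longrightarrow> wronskian x u v = w"
  shows "const_wronskian b u v = w"
  unfolding const_wronskian_def
proof (rule the_equality)
  show "w' = w" if "\<forall>x\<in>{0<..<b}. wronskian x u v = w'" for w'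
    using that assms[OF half] half by auto
qed (use assms in blast)

text \<open>
  The boundary condition annihilates the coefficient of \<open>V\<close>, so the solution chosen by \<open>weyl_solution\<close> is
  determined up to a factor.
\<close>
lemma weyl_solution_eq:
  assumes up: "\<And>i. ((\<lambda>x. u_plus x $ i) \<longlongrightarrow> complex_of_real (e i)) (at_left b)"
  shows "\<exists>a. a \<noteq> 0 \<and> (\<forall>x\<in>{0<..<b}. \<forall>i. weyl_solution \<kappa> Q b u_plus z x $ i = a * U z x $ i)"
proof -
  define P where "P = (\<lambda>u. dirac_solution \<kappa> Q b z u \<and> nontrivial_on b u \<and> boundary_condition b u_plus u)"
  have "P (U z)"
    unfolding P_def
  proof (intro conjI)
    show "dirac_solution \<kappa> Q b z (U z)" by (rule solD(1)[OF U])
    have "U z (b / 2) \<noteq> 0" using wronskian_UV[OF half, of z] by (auto simp: wronskian_def)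
    then show "nontrivial_on b (U z)" unfolding nontrivial_on_def using half by blast
    have "((\<lambda>x. wronskian x u_plus (U z)) \<longlongrightarrow> of_real (e 1) * of_real (e 2) - of_real (e 2) * of_real (e 1)) (at_left b)"
      by (rule wronskian_tendsto[where e = "\<lambda>i. of_real (e i)" and f = "\<lambda>i. of_real (e i)", OF up U_lim])
    then show "boundary_condition b u_plus (U z)" unfolding boundary_condition_def by simp
  qed
  then have "P (SOME u. P u)" by (rule someI[of P])
  then have "P (weyl_solution \<kappa> Q b u_plus z)" by (simp only: weyl_solution_def P_def)
  then have w: "dirac_solution \<kappa> Q b z (weyl_solution \<kappa> Q b u_plus z)" "nontrivial_on b (weyl_solution \<kappa> Q b u_plus z)"
    "boundary_condition b u_plus (weyl_solution \<kappa> Q b u_plus z)" unfolding P_def by blast+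
  define u where "u = weyl_solution \<kappa> Q b u_plus z"
  note w = w[folded u_def]
  define a where "a = wronskian (b / 2) u (V z)"
  define d where "d = wronskian (b / 2) (U z) u"
  note ex = solution_expansion[OF w(1), folded a_def d_def]
  note lim = solution_limit[OF w(1), folded a_def d_def]
  have "((\<lambda>x. wronskian x u_plus u) \<longlongrightarrow> of_real (e 1) * (a * of_real (e 2) + d * of_real (f 2))
      - of_real (e 2) * (a * of_real (e 1) + d * of_real (f 1))) (at_left b)"
    by (rule wronskian_tendsto[where e = "\<lambda>i. of_real (e i)" and f = "\<lambda>i. a * of_real (e i) + d * of_real (f i)", OF up lim])
  also have "of_real (e 1) * (a * of_real (e 2) + d * of_real (f 2)) - of_real (e 2) * (a * of_real (e 1) + d * of_real (f 1))
      = d * of_real (e 1 * f 2 - e 2 * f 1)" by (simp add: algebra_simps)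
  finally have "((\<lambda>x. wronskian x u_plus u) \<longlongrightarrow> d) (at_left b)" unfolding det by simp
  then have d: "d = 0"
    using w(3) unfolding boundary_condition_def by (rule tendsto_unique[OF trivial_limit_at_left_real])
  have eq: "u x $ i = a * U z x $ i" if "x \<in> {0<..<b}" for x i using ex[OF that, of i] d by simp
  have "a \<noteq> 0"
  proof
    assume "a = 0"
    then have "u x = 0" if "x \<in> {0<..<b}" for x
      using eq[OF that] by (simp add: Finite_Cartesian_Product.vec_eq_iff)
    then show False using w(2) unfolding nontrivial_on_def by blast
  qed
  then show ?thesis using eq unfolding u_def by (intro exI[of _ a]) blast
qed

end

context dirac_boundary begin

text \<open>
  The factor \<open>a\<close> of the Weyl solution cancels in the quotient of Wronskians, and \<open>M = - R / B\<close> for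
  \<open>\<Theta> = P U + R V\<close>. The functions \<open>P\<close>, \<open>R\<close> are those of \<open>entire_interpolation\<close>.
\<close>
lemma weyl_function_solution_system:
  assumes up: "\<And>i. ((\<lambda>x. u_plus x $ i) \<longlongrightarrow> complex_of_real (e i)) (at_left b)"
    and k: "\<kappa> < real k + 1 / 2"
  shows "\<exists>\<Theta>. real_entire_solution \<kappa> Q b \<Theta> \<and> (\<forall>z. \<forall>x\<in>{0<..<b}. wronskian x (\<Theta> z) (\<Phi> z) = 1)
    \<and> singular_weyl_function \<kappa> Q b u_plus \<Phi> \<Theta> \<in> gen_nevanlinna_inf k"
proof -
  obtain t where t: "t \<notin> eigenvalues" using real_non_eigenvalue_exists by blast
  obtain g where g: "0 < g" "\<And>l. l \<in> eigenvalues \<Longrightarrow> g * (1 + \<bar>l\<bar>) \<le> \<bar>l - t\<bar>"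
    using eigenvalue_gap[OF t] by metis
  interpret Z: real_simple_zeros A B eigenvalues weight t g k
  proof
    show "(\<lambda>l. weight l / (1 + \<bar>l\<bar>) ^ (2 * k + 2)) summable_on eigenvalues"
      by (rule weight_summable) (use k in simp)
    show "deriv B (complex_of_real l) * A (complex_of_real l) = - complex_of_real (1 / weight l)" if "l \<in> eigenvalues" for l
      using derivative_at_eigenvalue[OF that] by (simp add: weight_def)
  qed (fact A_holomorphic B_holomorphic A_cnj B_cnj B_eq_0_iff g(1) | rule weight_pos | rule g(2), assumption)+
  have "\<exists>c0. \<forall>c>c0. \<forall>M. (\<forall>z\<in>- (\<real> :: complex set). M z = (z - t) ^ (2 * k) * (of_real c * (z - t) + Z.G z)) \<longrightarrow>
           M \<in> gen_nevanlinna_inf k"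
  proof (rule gen_nevanlinna_inf_of_herglotz_series[OF Z.G_has_sum _ Z.G_holomorphic])
    show "0 \<le> weight l / (l - t) ^ (2 * k) \<and> l \<noteq> t" if "l \<in> eigenvalues" for l
      using that t weight_pos[of l] by (auto simp: power_mult)
  qed
  then obtain c0 where c0: "\<forall>c>c0. \<forall>M. (\<forall>z\<in>- (\<real> :: complex set). M z = (z - t) ^ (2 * k) * (of_real c * (z - t) + Z.G z)) \<longrightarrow>
           M \<in> gen_nevanlinna_inf k" by (elim exE)
  define c where "c = c0 + 1"
  obtain P R where PR: "P holomorphic_on UNIV" "R holomorphic_on UNIV" "\<forall>z\<in>\<real>. P z \<in> \<real> \<and> R z \<in> \<real>"
      "\<forall>z. P z * B z - R z * A z = 1"
      "\<forall>z. z \<notin> \<real> \<longrightarrow> - R z / B z = (z - of_real t) ^ (2 * k) * (of_real c * (z - of_real t) + Z.G z)"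
    using Z.entire_interpolation[of c] by (elim exE conjE)
  define \<Theta> where "\<Theta> = (\<lambda>z x. P z *s U z x + R z *s V z x)"
  have \<Theta>: "\<Theta> z x $ i = P z * U z x $ i + R z * V z x $ i" for z x i by (simp add: \<Theta>_def)
  have \<Phi>_ex: "\<Phi> z x $ i = A z * U z x $ i + B z * V z x $ i" if "x \<in> {0<..<b}" for z x i
    unfolding A_def B_def by (rule solution_expansion[OF solD(1)[OF \<Phi>] that])
  have re: "real_entire_solution \<kappa> Q b \<Theta>"
    unfolding real_entire_solution_def real_valued_on_def \<Theta>
  proof (intro conjI allI ballI)
    show "dirac_solution \<kappa> Q b z (\<Theta> z)" for z
      unfolding \<Theta>_def by (rule dirac_solution_lincomb[OF solD(1)[OF U] solD(1)[OF V]])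
    show "(\<lambda>z. P z * U z x $ i + R z * V z x $ i) holomorphic_on UNIV" if "x \<in> {0<..<b}" for x i
      by (intro holomorphic_on_add holomorphic_on_mult PR solD(2)[OF U that] solD(2)[OF V that])
    show "P z * U z x $ i + R z * V z x $ i \<in> \<real>" if "z \<in> \<real>" "x \<in> {0<..<b}" for z x i
      using PR(3) that(1) by (intro Reals_add Reals_mult solD(3)[OF U that] solD(3)[OF V that]) auto
  qed
  have W\<Theta>\<Phi>: "wronskian x (\<Theta> z) (\<Phi> z) = 1" if x: "x \<in> {0<..<b}" for x z
  proof -
    have "wronskian x (\<Theta> z) (\<Phi> z) = (P z * B z - R z * A z) * wronskian x (U z) (V z)"
      by (simp add: wronskian_def \<Theta> \<Phi>_ex[OF x] algebra_simps)
    then show ?thesis using PR(4) wronskian_UV[OF x] by simp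
  qed
  have M: "singular_weyl_function \<kappa> Q b u_plus \<Phi> \<Theta> z = - R z / B z" for z
  proof -
    obtain a where a: "a \<noteq> 0" "\<forall>x\<in>{0<..<b}. \<forall>i. weyl_solution \<kappa> Q b u_plus z x $ i = a * U z x $ i"
      using weyl_solution_eq[OF up, of z] by (elim exE conjE)
    note a = a(1) a(2)[rule_format]
    have "const_wronskian b (\<Theta> z) (weyl_solution \<kappa> Q b u_plus z) = - a * R z"
    proof (rule const_wronskian_eq)
      fix x assume x: "x \<in> {0<..<b}"
      have "wronskian x (\<Theta> z) (weyl_solution \<kappa> Q b u_plus z) = - a * R z * wronskian x (U z) (V z)"
        by (simp add: wronskian_def \<Theta> a(2)[OF x] algebra_simps)
      then show "wronskian x (\<Theta> z) (weyl_solution \<kappa> Q b u_plus z) = - a * R z" by (simp add: wronskian_UV[OF x])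
    qed
    moreover have "const_wronskian b (\<Phi> z) (weyl_solution \<kappa> Q b u_plus z) = - a * B z"
    proof (rule const_wronskian_eq)
      fix x assume x: "x \<in> {0<..<b}"
      have "wronskian x (\<Phi> z) (weyl_solution \<kappa> Q b u_plus z) = - a * B z * wronskian x (U z) (V z)"
        by (simp add: wronskian_def \<Phi>_ex[OF x] a(2)[OF x] algebra_simps)
      then show "wronskian x (\<Phi> z) (weyl_solution \<kappa> Q b u_plus z) = - a * B z" by (simp add: wronskian_UV[OF x])
    qed
    ultimately show ?thesis using a(1) by (simp add: singular_weyl_function_def)
  qed
  have "singular_weyl_function \<kappa> Q b u_plus \<Phi> \<Theta> \<in> gen_nevanlinna_inf k"
    by (rule c0[rule_format, of c "singular_weyl_function \<kappa> Q b u_plus \<Phi> \<Theta>"]) (simp add: c_def, use PR(5) M in simp)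
  then show ?thesis using re W\<Theta>\<Phi> by (intro exI[of _ \<Theta>]) blast
qed

end

context dirac_system begin

text \<open>
  At \<open>z = 0\<close> the given solution is a combination of the two solutions that have the unit vectors as values
  at \<open>b\<close>, and its coefficients are real.
\<close>
lemma real_solution_limit_at_b:
  assumes u: "dirac_solution \<kappa> Q b 0 u" and nz: "nontrivial_on b u" and r: "real_valued_on b u"
  obtains e :: "2 \<Rightarrow> real" where "\<And>i. ((\<lambda>x. u x $ i) \<longlongrightarrow> complex_of_real (e i)) (at_left b)" "(e 1)\<^sup>2 + (e 2)\<^sup>2 > 0"
proof -
  obtain U where U: "real_entire_solution \<kappa> Q b U"
    and Ul: "\<forall>z i. ((\<lambda>x. U z x $ i) \<longlongrightarrow> of_real ((\<lambda>i. if i = 1 then 1 else 0) i)) (at_left b)"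
    using solution_with_values_at_b[of "\<lambda>i. if i = 1 then 1 else 0"] by (elim exE conjE)
  obtain V where V: "real_entire_solution \<kappa> Q b V"
    and Vl: "\<forall>z i. ((\<lambda>x. V z x $ i) \<longlongrightarrow> of_real ((\<lambda>i. if i = 1 then 0 else 1) i)) (at_left b)"
    using solution_with_values_at_b[of "\<lambda>i. if i = 1 then 0 else 1"] by (elim exE conjE)
  interpret D: dirac_fundamental_system \<kappa> b p11 p12 p22 Q U V "\<lambda>i. if i = 1 then 1 else 0" "\<lambda>i. if i = 1 then 0 else 1"
    by unfold_locales (use U Ul V Vl in auto)
  define a where "a = wronskian (b / 2) u (V 0)"
  define d where "d = wronskian (b / 2) (U 0) u"
  have ur: "u (b / 2) $ i \<in> \<real>" for i using r half unfolding real_valued_on_def by blast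
  have "a \<in> \<real>" "d \<in> \<real>"
    unfolding a_def d_def wronskian_def
    by (intro Reals_diff Reals_mult ur solD(3)[OF U _ half] solD(3)[OF V _ half]; simp)+
  then obtain a' d' where ad: "a = of_real a'" "d = of_real d'" by (auto elim!: Reals_cases)
  define e where "e = (\<lambda>i :: 2. if i = 1 then a' else d')"
  have "((\<lambda>x. u x $ i) \<longlongrightarrow> complex_of_real (e i)) (at_left b)" for i
    using D.solution_limit[OF u, of i] exhaust_2[of i] unfolding a_def[symmetric] d_def[symmetric]
    by (auto simp: e_def ad)
  moreover have "(e 1)\<^sup>2 + (e 2)\<^sup>2 > 0"
  proof (rule ccontr)
    assume "\<not> (e 1)\<^sup>2 + (e 2)\<^sup>2 > 0"
    then have "e 1 = 0" "e 2 = 0" by (simp_all add: not_less sum_power2_le_zero_iff)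
    then have "a = 0" "d = 0" by (simp_all add: e_def ad)
    then have "u x $ i = 0" if "x \<in> {0<..<b}" for x i
      using D.solution_expansion[OF u that, of i] by (simp add: a_def d_def)
    then have "u x = 0" if "x \<in> {0<..<b}" for x using that by (simp add: Finite_Cartesian_Product.vec_eq_iff)
    then show False using nz unfolding nontrivial_on_def by blast
  qed
  ultimately show ?thesis by (rule that)
qed

lemma weyl_function_in_gen_nevanlinna_inf:
  assumes u: "dirac_solution \<kappa> Q b 0 u_plus" "nontrivial_on b u_plus" "real_valued_on b u_plus"
    and c0: "0 < c0" and k: "\<kappa> < real k + 1 / 2"
  shows "\<exists>\<Phi> \<Theta>. real_entire_solution \<kappa> Q b \<Phi> \<and> real_entire_solution \<kappa> Q b \<Theta> \<and>
    (\<forall>z. \<forall>x\<in>{0<..<b}. wronskian x (\<Theta> z) (\<Phi> z) = 1) \<and>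
    (\<forall>z. (\<lambda>x. norm (\<Phi> z x - x powr \<kappa> *\<^sub>R vector [0, complex_of_real c0])) \<in> o[at_right 0](\<lambda>x. x powr \<kappa>)) \<and>
    singular_weyl_function \<kappa> Q b u_plus \<Phi> \<Theta> \<in> gen_nevanlinna_inf k"
proof -
  obtain e where e: "\<And>i. ((\<lambda>x. u_plus x $ i) \<longlongrightarrow> complex_of_real (e i)) (at_left b)" and pos: "(e 1)\<^sup>2 + (e 2)\<^sup>2 > 0"
    using real_solution_limit_at_b[OF u] by metis
  \<comment> \<open>Orthogonal to \<open>e\<close> and scaled so that \<open>e 1 * f 2 - e 2 * f 1 = 1\<close>.\<close>
  define f where "f = (\<lambda>i :: 2. if i = 1 then - e 2 / ((e 1)\<^sup>2 + (e 2)\<^sup>2) else e 1 / ((e 1)\<^sup>2 + (e 2)\<^sup>2))"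
  have det: "e 1 * f 2 - e 2 * f 1 = 1"
    unfolding f_def using pos by (auto simp: add_divide_distrib[symmetric] simp flip: power2_eq_square)
  obtain U where U: "real_entire_solution \<kappa> Q b U" "\<forall>z i. ((\<lambda>x. U z x $ i) \<longlongrightarrow> of_real (e i)) (at_left b)"
    using solution_with_values_at_b[of e] by (elim exE conjE)
  obtain V where V: "real_entire_solution \<kappa> Q b V" "\<forall>z i. ((\<lambda>x. V z x $ i) \<longlongrightarrow> of_real (f i)) (at_left b)"
    using solution_with_values_at_b[of f] by (elim exE conjE)
  obtain \<Phi> \<delta> where regular: "real_entire_solution \<kappa> Q b \<Phi>"
    "\<forall>z. (\<lambda>x. norm (\<Phi> z x - x powr \<kappa> *\<^sub>R vector [0, complex_of_real c0])) \<in> o[at_right 0](\<lambda>x. x powr \<kappa>)"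
    "\<forall>R. \<exists>C. \<forall>z. cmod z \<le> R \<longrightarrow> (\<forall>x\<in>{0<..<b}. \<forall>i. cmod (\<Phi> z x $ i) \<le> C * x powr \<kappa>)"
    "\<delta> > 0" "\<forall>z. \<forall>x\<in>{0<..<b}. x \<le> \<delta> \<longrightarrow> cmod z * x \<le> \<delta> \<longrightarrow>
          cmod (\<Phi> z x $ 2 - of_real (c0 * x powr \<kappa>)) \<le> c0 / 2 * x powr \<kappa>"
    using regular_solution_at_0[OF c0] by (elim exE conjE)
  interpret dirac_boundary \<kappa> b p11 p12 p22 Q U V e f \<Phi> c0 \<delta>
    by unfold_locales (use U V regular det c0 in \<open>(simp; fail) | blast\<close>)+
  obtain \<Theta> where "real_entire_solution \<kappa> Q b \<Theta>" "\<forall>z. \<forall>x\<in>{0<..<b}. wronskian x (\<Theta> z) (\<Phi> z) = 1"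
    "singular_weyl_function \<kappa> Q b u_plus \<Phi> \<Theta> \<in> gen_nevanlinna_inf k"
    using weyl_function_solution_system[OF e k] by (elim exE conjE)
  then show ?thesis using regular(1,2) by (intro exI[of _ \<Phi>] exI[of _ \<Theta>] conjI)
qed

end

theorem corollary4p6:
  fixes \<kappa> b m :: real and q_el q_am q_sc :: "real \<Rightarrow> real"
    and Q :: "real \<Rightarrow> complex^2^2" and u_plus :: "real \<Rightarrow> complex^2"
    and H :: "((real \<Rightarrow> complex^2) \<times> (real \<Rightarrow> complex^2)) set"
  assumes "0 < b" and "0 \<le> m"
    and "Q = dirac_potential m q_el q_am q_sc"
    and "L1_loc_at_0 b Q" and "regular_endpoint b Q"
    and "\<kappa> > 1/2" and "\<kappa> + 1/2 \<notin> \<nat>"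
    and "dirac_solution \<kappa> Q b 0 u_plus" and "nontrivial_on b u_plus" and "real_valued_on b u_plus"
    and "H = radial_dirac_operator \<kappa> Q b u_plus" and "self_adjoint_graph b H"
  shows "\<exists>\<Phi> \<Theta>. real_entire_solution \<kappa> Q b \<Phi> \<and> real_entire_solution \<kappa> Q b \<Theta> \<and>
           (\<forall>z. \<forall>x\<in>{0<..<b}. wronskian x (\<Theta> z) (\<Phi> z) = 1) \<and>
           normalized_at_0 \<kappa> \<Phi> \<and>
           singular_weyl_function \<kappa> Q b u_plus \<Phi> \<Theta> \<in> gen_nevanlinna_inf (nat \<lfloor>\<kappa> + 1/2\<rfloor>)"
proof -
  interpret dirac_system \<kappa> b "\<lambda>x. q_el x + (m + q_sc x)" q_am "\<lambda>x. q_el x - (m + q_sc x)" Q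
  proof
    show "Q x $ 1 $ 1 = of_real (q_el x + (m + q_sc x))" "Q x $ 1 $ 2 = of_real (q_am x)"
      "Q x $ 2 $ 1 = of_real (q_am x)" "Q x $ 2 $ 2 = of_real (q_el x - (m + q_sc x))" for x
      unfolding assms(3) dirac_potential_def
      by (simp_all add: sigma1_def sigma3_def Finite_Cartesian_Product.mat_def scaleR_conv_of_real[where 'a = complex])
    show "(\<lambda>x. Q x $ i $ j) absolutely_integrable_on {0<..<b}" for i j
      by (rule absolutely_integrable_if_regular[OF assms(4,5)])
  qed (use assms(1,6) in auto)
  define c0 where "c0 = sqrt pi / (2 powr \<kappa> * Gamma (\<kappa> + 1/2))"
  have c0: "0 < c0" using assms(6) by (simp add: c0_def Gamma_real_pos)
  have k: "\<kappa> < real (nat \<lfloor>\<kappa> + 1/2\<rfloor>) + 1 / 2" using assms(6) by linarith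
  show ?thesis
    using weyl_function_in_gen_nevanlinna_inf[OF assms(8-10) c0 k]
    unfolding normalized_at_0_def c0_def .
qed

end
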